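(* Let $\Bbbk$ be a field, $\mathsf C$ a small category and $\mathcal A:\mathsf C\to\mathsf{Alg}_\Bbbk$ a diagram of (associative, not necessarily unital) algebras. The asimplicial subcomplex $\mathsf s\operatorname{tot}C_{\mathrm a}^{\bullet,\bullet}(\mathcal A,\mathcal A)$, the reduced subcomplex $\mathsf s\operatorname{tot}\bar C^{\bullet,\bullet}(\mathcal A,\mathcal A)$, and their intersection $\mathsf s\operatorname{tot}\bar C_{\mathrm a}^{\bullet,\bullet}(\mathcal A,\mathcal A)$ are $\mathit{mQuilt}$-subalgebras of $\mathsf s\operatorname{tot}C^{\bullet,\bullet}(\mathcal A,\mathcal A)$. Moreover, the inclusions of the reduced complexes give isomorphisms $$H^\bullet[\operatorname{tot}\bar C^{\bullet,\bullet}(\mathcal A,\mathcal A),\delta]\cong H^\bullet(\mathcal A,\mathcal A),\qquad H^\bullet[\operatorname{tot}\bar C_{\mathrm a}^{\bullet,\bullet}(\mathcal A,\mathcal A),\delta]\cong H^\bullet_{\mathrm a}(\mathcal A,\mathcal A).$$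
   Context: Write $\langle n\rangle=\{1,\dots,n\}$, $[p]=\{0,\dots,p\}$. TREES. A tree $T$ consists of a finite set $V_T$ (vertices), a set $E_T\subset V_T\times V_T$ (edges) and a partial order $\trianglelefteq_T$ on $V_T$ (strict part $\vartriangleleft_T$) such that: $(u,u)\notin E_T$; $E_T$ generates a partial order $\le_T$ with $(u,v)\in E_T\Rightarrow u<_Tv$; there is a unique $\le_T$-minimal vertex (the root); if $(u,v)\in E_T$ there is no $t$ with $u<_Tt<_Tv$; for all $u,v$ exactly one of $u=v$, $u<_Tv$, $u>_Tv$, $u\vartriangleleft_Tv$, $u\vartriangleright_Tv$ holds; if $u\vartriangleleft_Tv$, $u\le_Tu'$, $v\le_Tv'$ then $u'\vartriangleleft_Tv'$. If $(u,v)\in E_T$, $v$ is a child of $u$. $\mathsf{Tree}(n)$ is the set of trees with vertex set $\langle n\rangle$. WORDS. $\mathsf{F_2S}(n)$ is the set of words (finite sequences) $W$ over $\langle n\rangle$ such that every element of $\langle n\rangle$ appears, no element appears twice consecutively, and for $u\ne v$ there is no subsequence $u,v,u,v$. $|W|$ is the length and $\deg W=|W|-n$. Elements of $\langle n\rangle$ are called vertices. QUILTS. $\mathsf{Quilt}(n)$ is the set of pairs $Q=(W_Q,T_Q)\in\mathsf{F_2S}(n)\times\mathsf{Tree}(n)$ such that (1) if some occurrence of $u$ precedes some occurrence of $v$ in $W_Q$ then not $u>_{T_Q}v$; (2) if some occurrence of $v$ lies between two occurrences of $u$ in $W_Q$ then $v\trianglelefteq_{T_Q}u$. $\deg Q=\deg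 W_Q$, arity $\#Q=n$. OCCURRENCES. $\underline a$ denotes an occurrence (position) of $a$ in $W$. The $\downarrow$ order is the order of first occurrences in $W$. If $W=\dots uv\dots u\dots$ ($v$ immediately after an occurrence of $u$, and $u$ occurs again later), $v$ is interposed; there are $\deg W$ interposed vertices. COCHAINS. $B_p\mathsf C$ is the set of strings $\boldsymbol\phi=(\phi_1,\dots,\phi_p)$, $x_0\xleftarrow{\phi_1}x_1\leftarrow\dots\xleftarrow{\phi_p}x_p$ in $\mathsf C$ (objects if $p=0$). $\phi_{k,l}=\phi_{k+1}\circ\dots\circ\phi_l:x_l\to x_k$ (identity if $k=l$). For strictly increasing $\zeta:[p]\to[p']$ and $\boldsymbol\phi\in B_{p'}\mathsf C$, $\zeta^*\boldsymbol\phi=(\phi_{\zeta(0),\zeta(1)},\dots,\phi_{\zeta(p-1),\zeta(p)})\in B_p\mathsf C$ (the object $x_{\zeta(0)}$ if $p=0$). $C^{p,q}(\mathcal A,\mathcal A)=\prod_{(x_0\leftarrow\dots\leftarrow x_p)\in B_p\mathsf C}\operatorname{Hom}_\Bbbk(\mathcal A(x_p)^{\otimes q},\mathcal A(x_0))$; the component of $f$ at $\boldsymbol\phi$ is $f[\boldsymbol\phi]$. For $f\in C^{p,q}$ put $|f|=p+q-1$; $\operatorname{tot}C^{\bullet,\bullet}$ is graded by $p+q$ and $\mathsf s\operatorname{tot}C^{\bullet,\bullet}$ by $|\cdot|$. $\delta^{\mathrm S}:C^{p,q}\to C^{p+1,q}$ is $\delta^{\mathrm S}=\sum_{i=0}^{p+1}(-1)^i\delta^{\mathrm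 S}_i$, $(\delta^{\mathrm S}_if)[\boldsymbol\phi]=\mathcal A[\phi_{0,\varepsilon_i(0)}]\circ f[\varepsilon_i^*\boldsymbol\phi]\circ\mathcal A[\phi_{\varepsilon_i(p),p+1}]^{\otimes q}$, where $\varepsilon_i:[p]\to[p+1]$ is the strictly increasing map whose image omits $i$. $\hat{\mathsf m}\in C^{0,2}(\mathcal A,\mathcal A)$ is multiplication: $\hat{\mathsf m}[x](a,b)=ab$ for $a,b\in\mathcal A(x)$. $\delta^{\mathrm H}f=\widehat B(\hat{\mathsf m},f)-\widehat{B'}(\hat{\mathsf m},f)$, where $B=(12,T)$ with $T$ having root $1$ and single child $2$, and $B'=(21,T')$ with $T'$ having root $2$ and single child $1$ (operations $\widehat Q$ below). $\delta=\delta^{\mathrm S}+\delta^{\mathrm H}$. SUBCOMPLEXES AND COHOMOLOGY. $C_{\mathrm a}^{\bullet,\bullet}=\bigoplus_{p\ge0,\,q\ge1}C^{p,q}$. $\bar C^{p,q}$ is the set of $f\in C^{p,q}$ with $f[\boldsymbol\phi]=0$ whenever some component of $\boldsymbol\phi$ is an identity morphism; $\bar C^{\bullet,\bullet}$ is spanned by these. $\bar C_{\mathrm a}^{\bullet,\bullet}=\bar C^{\bullet,\bullet}\cap C_{\mathrm a}^{\bullet,\bullet}$. $H^\bullet(\mathcal A,\mathcal A)$ and $H^\bullet_{\mathrm a}(\mathcal A,\mathcal A)$ are the cohomologies of $(\operatorname{tot}C^{\bullet,\bullet},\delta)$ and $(\operatorname{tot}C_{\mathrm a}^{\bullet,\bullet},\delta)$.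 $\mathit{mQuilt}$-SUBALGEBRAS. $\mathit{mQuilt}$ is a dg-operad generated as a graded operad by all quilts and one $0$-ary element $\mathsf m$; it acts on $(\mathsf s\operatorname{tot}C^{\bullet,\bullet}(\mathcal A,\mathcal A),\delta)$ with $Q$ acting as $\widehat Q$ and $\mathsf m$ as $\hat{\mathsf m}$. Hence an $\mathit{mQuilt}$-subalgebra is a graded subspace that contains $\hat{\mathsf m}$ and is closed under all $\widehat Q$ and under $\delta$. COLORINGS. Let $T\in\mathsf{Tree}(n)$, $W\in\mathsf{F_2S}(n)$, $\mathbf p,\mathbf q\in\mathbb N^n$ ($\mathbb N\ni0$), $q'=1+\sum_a(q_a-1)$, $p'=\sum_ap_a-\deg W$. $\mathrm{Clr}(T;\mathbf q)$ is the set of $I:E_T\to\mathbb N$ with $1\le I_{(u,v)}\le q_u$ for every edge, and $I_{(t,u)}<I_{(t,v)}$ whenever $u\vartriangleleft_Tv$ are children of $t$. $\mathrm{Clr}(W;\mathbf p)$ is the set of tuples $\boldsymbol\zeta=(\zeta_1,\dots,\zeta_n)$ of strictly increasing maps $\zeta_a:[p_a]\to[p']$ with $\bigcup_a\operatorname{Im}\zeta_a=[p']$ for which there exist (necessarily unique) functions $\pi_a:[p_a]\to W$ such that the image of $\pi_a$ is the set of occurrences of $a$ in $W$; $\zeta_a(\pi_a^{-1}\underline a)$ is a set of consecutive integers for every occurrence $\underline a$; and whenever $\underline b$ immediately follows $\underline a$ in $W$, $\max\zeta_a(\pi_a^{-1}\underline a)=\min\zeta_b(\pi_b^{-1}\underline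 b)$. (Empty if $p'<0$.) For a quilt $Q$, $\boldsymbol\zeta\in\mathrm{Clr}(W_Q;\mathbf p)$, $I\in\mathrm{Clr}(T_Q;\mathbf q)$, one has $\max\zeta_a\le\min\zeta_b$ for each edge $(a,b)$. ACTION OF A COLORING. For $f_a\in C^{p_a,q_a}(\mathcal A,\mathcal A)$ and $\boldsymbol\phi\in B_{p'}\mathsf C$, $\mathcal L(\boldsymbol\zeta,I;f_1,\dots,f_n)[\boldsymbol\phi]:\mathcal A(x_{p'})^{\otimes q'}\to\mathcal A(x_0)$ is the composite of the multilinear maps $f_a[\zeta_a^*\boldsymbol\phi]:\mathcal A(x_{\zeta_a(p_a)})^{\otimes q_a}\to\mathcal A(x_{\zeta_a(0)})$ along the tree: for each edge $(a,b)$ the output of $f_b[\zeta_b^*\boldsymbol\phi]$, after applying $\mathcal A[\phi_{\zeta_a(p_a),\zeta_b(0)}]$, is inserted in the $I_{(a,b)}$-th input of $f_a[\zeta_a^*\boldsymbol\phi]$; each input of $f_a[\zeta_a^*\boldsymbol\phi]$ not used by an edge is precomposed with $\mathcal A[\phi_{\zeta_a(p_a),p'}]$ (remaining inputs in planar order); the output at the root $u$ is followed by $\mathcal A[\phi_{0,\zeta_u(0)}]$. SIGNS. Use letters $0_{\mathrm va},\dots,(p_a-1)_{\mathrm va}$ and $1_{\mathrm ha},\dots,(q_a-1)_{\mathrm ha}$ for each vertex $a$. Initial word: the concatenation over $a=1,\dots,\#Q$ (in this order) of $0_{\mathrm va}\dots(p_a-1)_{\mathrm va}1_{\mathrm ha}\dots(q_a-1)_{\mathrm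 ha}$. Shuffled word: the concatenation of three words: (i) $0_{\mathrm va}$ for each interposed vertex $a$ of $W_Q$, in reverse $\downarrow$ order; (ii) the word having $i_{\mathrm va}$ in position $\zeta_a(i)$ (positions counted from $0$), for $0\le i\le p_a-1$ if $a$ is not interposed and $1\le i\le p_a-1$ if $a$ is interposed; (iii) the word obtained from the corner word of $T_Q$ (the word $C(\mathrm{root})$, where $C(v)=v\,C(c_1)\,v\,C(c_2)\,v\dots C(c_r)\,v$ for a vertex with children $c_1\vartriangleleft\dots\vartriangleleft c_r$) by replacing, in order, each non-last occurrence of $a$ immediately followed by $b$ with the next unused horizontal letters of $a$ up to $(I_{(a,b)}-1)_{\mathrm ha}$, and the last occurrence of $a$ with the remaining horizontal letters of $a$. If $p_a\ge1$ for all interposed $a$ and $q_a\ge1$ for all $a$, $\operatorname{sgn}_Q(\boldsymbol\zeta,I)$ is the sign of the permutation taking the initial word to the shuffled word. Otherwise it is defined by replacing each $q_a=0$ by $2$, and, for each interposed $a$ with $p_a=0$ (so $a$ occurs only once, at $\underline a$), replacing $\boldsymbol\zeta$ by $E_{\underline a}E_{\underline a}\boldsymbol\zeta$, where $E_{\underline a}\boldsymbol\zeta$ is the coloring with $p_a$ increased by $1$ such that $j\in\operatorname{Im}(E_{\underline a}\boldsymbol\zeta)_b$ iff $j=\zeta_b(i)$ with $\pi_b(i)$ before or equal to $\underline a$, or $j=1+\zeta_b(i)$ with $\pi_b(i)$ after or equal to $\underline a$. OPERATIONS. For $Q\in\mathsf{Quilt}(n)$ and $f_a\in C^{p_a,q_a}(\mathcal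 A,\mathcal A)$, $\widehat Q(f_1,\dots,f_n)=\sum_{\boldsymbol\zeta\in\mathrm{Clr}(W_Q;\mathbf p)}\sum_{I\in\mathrm{Clr}(T_Q;\mathbf q)}\operatorname{sgn}_Q(\boldsymbol\zeta,I)\,\mathcal L(\boldsymbol\zeta,I;f_1,\dots,f_n)\in C^{p',q'}(\mathcal A,\mathcal A)$, extended multilinearly. *)

theory Defs
  imports
    "HOL-Algebra.AbelCoset"
    "HOL-Algebra.Module"
    "HOL-Library.Sublist"
    "HOL-Library.FuncSet"
    "HOL-Combinatorics.Permutations"
begin

section \<open>Trees, words and quilts\<close>

text \<open>
  The vertex set is always \<open>{1..n}\<close>.  The relation \<open>planar T\<close> is the (reflexive) partial order
  written with a triangle in the literature; the vertical order is the reflexive transitive closure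
  of the edge relation.
\<close>

record tree =
  edges :: "(nat \<times> nat) set"
  planar :: "(nat \<times> nat) set"

definition tree_le :: "tree \<Rightarrow> nat \<Rightarrow> nat \<Rightarrow> bool" where
  "tree_le T u v \<longleftrightarrow> (u, v) \<in> (edges T)\<^sup>*"

definition tree_less :: "tree \<Rightarrow> nat \<Rightarrow> nat \<Rightarrow> bool" where
  "tree_less T u v \<longleftrightarrow> tree_le T u v \<and> u \<noteq> v"

definition planar_less :: "tree \<Rightarrow> nat \<Rightarrow> nat \<Rightarrow> bool" where
  "planar_less T u v \<longleftrightarrow> (u, v) \<in> planar T \<and> u \<noteq> v"

definition is_root :: "nat \<Rightarrow> tree \<Rightarrow> nat \<Rightarrow> bool" where
  "is_root n T r \<longleftrightarrow> r \<in> {1..n} \<and> (\<forall>v\<in>{1..n}. \<not> tree_less T v r)"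

definition tree_root :: "nat \<Rightarrow> tree \<Rightarrow> nat" where
  "tree_root n T = (THE r. is_root n T r)"

definition exactly_one :: "bool list \<Rightarrow> bool" where
  "exactly_one bs \<longleftrightarrow> length (filter (\<lambda>b. b) bs) = 1"

definition trees :: "nat \<Rightarrow> tree set" where
  "trees n = {T.
     edges T \<subseteq> {1..n} \<times> {1..n} \<and>
     partial_order_on {1..n} (planar T) \<and>
     (\<forall>u. (u, u) \<notin> edges T) \<and>
     antisym ((edges T)\<^sup>*) \<and>
     (\<exists>!r. is_root n T r) \<and>
     (\<forall>u v. (u, v) \<in> edges T \<longrightarrow> \<not> (\<exists>t. tree_less T u t \<and> tree_less T t v)) \<and>
     (\<forall>u\<in>{1..n}. \<forall>v\<in>{1..n}. exactly_one
        [u = v, tree_less T u v, tree_less T v u, planar_less T u v, planar_less T v u]) \<and>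
     (\<forall>u\<in>{1..n}. \<forall>v\<in>{1..n}. \<forall>u'\<in>{1..n}. \<forall>v'\<in>{1..n}.
        planar_less T u v \<and> tree_le T u u' \<and> tree_le T v v' \<longrightarrow> planar_less T u' v')}"

definition children :: "tree \<Rightarrow> nat \<Rightarrow> nat list" where
  "children T u = (THE cs. set cs = {c. (u, c) \<in> edges T} \<and> sorted_wrt (planar_less T) cs)"

definition F2S :: "nat \<Rightarrow> nat list set" where
  "F2S n = {W. set W = {1..n} \<and> distinct_adj W \<and> (\<forall>u v. u \<noteq> v \<longrightarrow> \<not> subseq [u, v, u, v] W)}"

text \<open>The truncated subtraction is exact, since \<open>length W \<ge> n\<close> for every word in \<open>F2S n\<close>.\<close>

definition word_deg :: "nat \<Rightarrow> nat list \<Rightarrow> nat" where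
  "word_deg n W = length W - n"

type_synonym quilt = "nat list \<times> tree"

definition quilts :: "nat \<Rightarrow> quilt set" where
  "quilts n = {(W, T). W \<in> F2S n \<and> T \<in> trees n \<and>
     (\<forall>i j. i < j \<and> j < length W \<longrightarrow> \<not> tree_less T (W ! j) (W ! i)) \<and>
     (\<forall>i j k. i < j \<and> j < k \<and> k < length W \<and> W ! i = W ! k \<longrightarrow> (W ! j, W ! i) \<in> planar T)}"

text \<open>An occurrence of a vertex in a word is a position, counted from 0.\<close>

definition occurrences :: "nat list \<Rightarrow> nat \<Rightarrow> nat set" where
  "occurrences W a = {i. i < length W \<and> W ! i = a}"

definition interposed :: "nat list \<Rightarrow> nat \<Rightarrow> bool" where
  "interposed W v \<longleftrightarrow> (\<exists>i j. Suc i < j \<and> j < length W \<and> W ! Suc i = v \<and> W ! i = W ! j)"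


section \<open>Colorings\<close>

text \<open>
  A family indexed by the vertices is a function on \<^typ>\<open>nat\<close>; families that are summed over are
  made extensional, so that each one is counted once.
\<close>

definition clr_tree :: "tree \<Rightarrow> (nat \<Rightarrow> nat) \<Rightarrow> (nat \<times> nat \<Rightarrow> nat) set" where
  "clr_tree T q = {I \<in> edges T \<rightarrow>\<^sub>E UNIV.
     (\<forall>u v. (u, v) \<in> edges T \<longrightarrow> 1 \<le> I (u, v) \<and> I (u, v) \<le> q u) \<and>
     (\<forall>t u v. (t, u) \<in> edges T \<and> (t, v) \<in> edges T \<and> planar_less T u v \<longrightarrow> I (t, u) < I (t, v))}"

text \<open>
  \<open>fibre p \<zeta> \<pi> a i\<close> is the image under \<open>\<zeta> a\<close> of the preimage of the occurrence \<open>i\<close> under \<open>\<pi> a\<close>.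
\<close>

definition fibre ::
  "(nat \<Rightarrow> nat) \<Rightarrow> (nat \<Rightarrow> nat \<Rightarrow> nat) \<Rightarrow> (nat \<Rightarrow> nat \<Rightarrow> nat) \<Rightarrow> nat \<Rightarrow> nat \<Rightarrow> nat set" where
  "fibre p \<zeta> \<pi> a i = \<zeta> a ` {k \<in> {0..p a}. \<pi> a k = i}"

definition occurrence_map ::
  "nat \<Rightarrow> nat list \<Rightarrow> (nat \<Rightarrow> nat) \<Rightarrow> (nat \<Rightarrow> nat \<Rightarrow> nat) \<Rightarrow> (nat \<Rightarrow> nat \<Rightarrow> nat) \<Rightarrow> bool" where
  "occurrence_map n W p \<zeta> \<pi> \<longleftrightarrow>
     \<pi> \<in> (\<Pi>\<^sub>E a\<in>{1..n}. {0..p a} \<rightarrow>\<^sub>E {..<length W}) \<and>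
     (\<forall>a\<in>{1..n}. \<pi> a ` {0..p a} = occurrences W a) \<and>
     (\<forall>a\<in>{1..n}. \<forall>i\<in>occurrences W a. \<exists>l u. fibre p \<zeta> \<pi> a i = {l..u}) \<and>
     (\<forall>i. Suc i < length W \<longrightarrow>
        Max (fibre p \<zeta> \<pi> (W ! i) i) = Min (fibre p \<zeta> \<pi> (W ! Suc i) (Suc i)))"

definition clr_word :: "nat \<Rightarrow> nat list \<Rightarrow> (nat \<Rightarrow> nat) \<Rightarrow> (nat \<Rightarrow> nat \<Rightarrow> nat) set" where
  "clr_word n W p =
     (if (\<Sum>a=1..n. p a) < word_deg n W then {}
      else let p' = (\<Sum>a=1..n. p a) - word_deg n W in
        {\<zeta> \<in> (\<Pi>\<^sub>E a\<in>{1..n}. {0..p a} \<rightarrow>\<^sub>E {0..p'}).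
          (\<forall>a\<in>{1..n}. strict_mono_on {0..p a} (\<zeta> a)) \<and>
          (\<Union>a\<in>{1..n}. \<zeta> a ` {0..p a}) = {0..p'} \<and>
          (\<exists>\<pi>. occurrence_map n W p \<zeta> \<pi>)})"


section \<open>Signs\<close>

text \<open>\<open>Ver a i\<close> and \<open>Hor a i\<close> are the vertical and the horizontal letters of the vertex \<open>a\<close>.\<close>

datatype letter = Ver nat nat | Hor nat nat

definition initial_word :: "nat \<Rightarrow> (nat \<Rightarrow> nat) \<Rightarrow> (nat \<Rightarrow> nat) \<Rightarrow> letter list" where
  "initial_word n p q = concat (map (\<lambda>a. map (Ver a) [0..<p a] @ map (Hor a) [1..<q a]) [1..<Suc n])"

text \<open>
  Since \<^const>\<open>remdups\<close> keeps last occurrences, \<open>remdups (rev W)\<close> lists the vertices in the reverse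
  of the order of their first occurrences in \<open>W\<close>.
\<close>

definition interposed_letters :: "nat list \<Rightarrow> letter list" where
  "interposed_letters W = map (\<lambda>a. Ver a 0) (filter (interposed W) (remdups (rev W)))"

definition vertical_letters ::
  "nat \<Rightarrow> nat list \<Rightarrow> (nat \<Rightarrow> nat) \<Rightarrow> (nat \<Rightarrow> nat \<Rightarrow> nat) \<Rightarrow> letter list" where
  "vertical_letters n W p \<zeta> =
     map (\<lambda>j. THE x. \<exists>a i. x = Ver a i \<and> a \<in> {1..n} \<and> i < p a \<and> (interposed W a \<longrightarrow> 1 \<le> i) \<and> \<zeta> a i = j)
       [0..<(\<Sum>a=1..n. p a) - word_deg n W]"

text \<open>
  The recursion argument of \<open>corner_word\<close> (and of similar functions below) bounds the height
  of the subtree above the vertex; on a tree with \<open>n\<close> vertices the bound \<open>n\<close> is never exhausted.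
\<close>

primrec corner_word :: "tree \<Rightarrow> nat \<Rightarrow> nat \<Rightarrow> nat list" where
  "corner_word T 0 v = []"
| "corner_word T (Suc k) v = v # concat (map (\<lambda>c. corner_word T k c @ [v]) (children T v))"

text \<open>
  \<open>nx a\<close> is the index of the next unused horizontal letter of \<open>a\<close>.
\<close>

fun horizontal_fill ::
  "(nat \<Rightarrow> nat) \<Rightarrow> (nat \<times> nat \<Rightarrow> nat) \<Rightarrow> (nat \<Rightarrow> nat) \<Rightarrow> nat list \<Rightarrow> letter list" where
  "horizontal_fill q I nx [] = []"
| "horizontal_fill q I nx (a # w) =
     (let m = (if a \<in> set w then I (a, hd w) else q a)
      in map (Hor a) [nx a..<m] @ horizontal_fill q I (nx(a := m)) w)"

definition horizontal_letters ::
  "nat \<Rightarrow> tree \<Rightarrow> (nat \<Rightarrow> nat) \<Rightarrow> (nat \<times> nat \<Rightarrow> nat) \<Rightarrow> letter list" where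
  "horizontal_letters n T q I = horizontal_fill q I (\<lambda>_. 1) (corner_word T n (tree_root n T))"

definition shuffled_word ::
  "nat \<Rightarrow> quilt \<Rightarrow> (nat \<Rightarrow> nat) \<Rightarrow> (nat \<Rightarrow> nat) \<Rightarrow> (nat \<Rightarrow> nat \<Rightarrow> nat) \<Rightarrow> (nat \<times> nat \<Rightarrow> nat) \<Rightarrow> letter list"
  where
  "shuffled_word n Q p q \<zeta> I =
     interposed_letters (fst Q) @ vertical_letters n (fst Q) p \<zeta> @ horizontal_letters n (snd Q) q I"

definition rearrangement_sign :: "'x list \<Rightarrow> 'x list \<Rightarrow> int" where
  "rearrangement_sign xs ys = sign (THE \<sigma>. \<sigma> permutes {..<length xs} \<and> permute_list \<sigma> xs = ys)"

text \<open>The coloring called \<open>E\<close> in the definition of the sign, for the occurrence \<open>i\<close> of \<open>W ! i\<close>.\<close>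

definition extend_coloring ::
  "nat \<Rightarrow> nat list \<Rightarrow> nat \<Rightarrow> (nat \<Rightarrow> nat) \<times> (nat \<Rightarrow> nat \<Rightarrow> nat) \<Rightarrow> (nat \<Rightarrow> nat) \<times> (nat \<Rightarrow> nat \<Rightarrow> nat)"
  where
  "extend_coloring n W i = (\<lambda>(p, \<zeta>).
     let \<pi> = (THE \<pi>. occurrence_map n W p \<zeta> \<pi>);
         p2 = p(W ! i := Suc (p (W ! i)));
         J = (\<lambda>b. {\<zeta> b k | k. k \<le> p b \<and> \<pi> b k \<le> i} \<union> {1 + \<zeta> b k | k. k \<le> p b \<and> i \<le> \<pi> b k})
     in (p2, \<lambda>b\<in>{1..n}. \<lambda>k\<in>{0..p2 b}. sorted_list_of_set (J b) ! k))"

text \<open>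
  If all interposed vertices have \<open>p a \<ge> 1\<close> and all \<open>q a \<ge> 1\<close>, then \<open>p2 = p\<close>, \<open>q2 = q\<close>,
  \<open>\<zeta>2 = \<zeta>\<close>.
\<close>

definition coloring_sign ::
  "nat \<Rightarrow> quilt \<Rightarrow> (nat \<Rightarrow> nat) \<Rightarrow> (nat \<Rightarrow> nat) \<Rightarrow> (nat \<Rightarrow> nat \<Rightarrow> nat) \<Rightarrow> (nat \<times> nat \<Rightarrow> nat) \<Rightarrow> int" where
  "coloring_sign n Q p q \<zeta> I =
     (let W = fst Q;
          q2 = (\<lambda>a. if q a = 0 then 2 else q a);
          (p2, \<zeta>2) = fold (\<lambda>i c. extend_coloring n W i (extend_coloring n W i c))
             (filter (\<lambda>i. interposed W (W ! i) \<and> p (W ! i) = 0) [0..<length W]) (p, \<zeta>)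
      in rearrangement_sign (initial_word n p2 q2) (shuffled_word n Q p2 q2 \<zeta>2 I))"


section \<open>Diagrams of algebras\<close>

record ('o, 'm) category =
  Ob :: "'o set"
  Ar :: "'m set"
  Dom :: "'m \<Rightarrow> 'o"
  Cod :: "'m \<Rightarrow> 'o"
  Ident :: "'o \<Rightarrow> 'm"
  Comp :: "'m \<Rightarrow> 'm \<Rightarrow> 'm"

locale small_category =
  fixes C :: "('o, 'm, 'c) category_scheme"
  assumes Dom_closed: "f \<in> Ar C \<Longrightarrow> Dom C f \<in> Ob C"
    and Cod_closed: "f \<in> Ar C \<Longrightarrow> Cod C f \<in> Ob C"
    and Id_closed: "x \<in> Ob C \<Longrightarrow> Ident C x \<in> Ar C"
    and Dom_Id: "x \<in> Ob C \<Longrightarrow> Dom C (Ident C x) = x"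
    and Cod_Id: "x \<in> Ob C \<Longrightarrow> Cod C (Ident C x) = x"
    and Comp_closed: "\<lbrakk>g \<in> Ar C; f \<in> Ar C; Dom C g = Cod C f\<rbrakk> \<Longrightarrow> Comp C g f \<in> Ar C"
    and Dom_Comp: "\<lbrakk>g \<in> Ar C; f \<in> Ar C; Dom C g = Cod C f\<rbrakk> \<Longrightarrow> Dom C (Comp C g f) = Dom C f"
    and Cod_Comp: "\<lbrakk>g \<in> Ar C; f \<in> Ar C; Dom C g = Cod C f\<rbrakk> \<Longrightarrow> Cod C (Comp C g f) = Cod C g"
    and Comp_Id: "f \<in> Ar C \<Longrightarrow> Comp C f (Ident C (Dom C f)) = f"
    and Id_Comp: "f \<in> Ar C \<Longrightarrow> Comp C (Ident C (Cod C f)) f = f"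
    and Comp_assoc: "\<lbrakk>h \<in> Ar C; g \<in> Ar C; f \<in> Ar C; Dom C h = Cod C g; Dom C g = Cod C f\<rbrakk>
      \<Longrightarrow> Comp C (Comp C h g) f = Comp C h (Comp C g f)"

text \<open>
  Associative, not necessarily unital algebras.  They are not required to be commutative either,
  which rules out the library locale \<^locale>\<open>algebra\<close>; the field \<^const>\<open>one\<close> of the record is ignored.
\<close>

locale nonunital_algebra = module R M
  for R :: "('k, 'r) ring_scheme" (structure) and M :: "('k, 'a, 'e) module_scheme" (structure) +
  assumes mult_closed:
      "\<lbrakk>a \<in> carrier M; b \<in> carrier M\<rbrakk> \<Longrightarrow> a \<otimes>\<^bsub>M\<^esub> b \<in> carrier M"
    and mult_assoc: "\<lbrakk>a \<in> carrier M; b \<in> carrier M; c \<in> carrier M\<rbrakk>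
      \<Longrightarrow> (a \<otimes>\<^bsub>M\<^esub> b) \<otimes>\<^bsub>M\<^esub> c = a \<otimes>\<^bsub>M\<^esub> (b \<otimes>\<^bsub>M\<^esub> c)"
    and mult_distrib_right: "\<lbrakk>a \<in> carrier M; b \<in> carrier M; c \<in> carrier M\<rbrakk>
      \<Longrightarrow> (a \<oplus>\<^bsub>M\<^esub> b) \<otimes>\<^bsub>M\<^esub> c = a \<otimes>\<^bsub>M\<^esub> c \<oplus>\<^bsub>M\<^esub> b \<otimes>\<^bsub>M\<^esub> c"
    and mult_distrib_left: "\<lbrakk>a \<in> carrier M; b \<in> carrier M; c \<in> carrier M\<rbrakk>
      \<Longrightarrow> a \<otimes>\<^bsub>M\<^esub> (b \<oplus>\<^bsub>M\<^esub> c) = a \<otimes>\<^bsub>M\<^esub> b \<oplus>\<^bsub>M\<^esub> a \<otimes>\<^bsub>M\<^esub> c"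
    and smult_mult_left: "\<lbrakk>r \<in> carrier R; a \<in> carrier M; b \<in> carrier M\<rbrakk>
      \<Longrightarrow> (r \<odot>\<^bsub>M\<^esub> a) \<otimes>\<^bsub>M\<^esub> b = r \<odot>\<^bsub>M\<^esub> (a \<otimes>\<^bsub>M\<^esub> b)"
    and smult_mult_right: "\<lbrakk>r \<in> carrier R; a \<in> carrier M; b \<in> carrier M\<rbrakk>
      \<Longrightarrow> a \<otimes>\<^bsub>M\<^esub> (r \<odot>\<^bsub>M\<^esub> b) = r \<odot>\<^bsub>M\<^esub> (a \<otimes>\<^bsub>M\<^esub> b)"

definition algebra_hom ::
  "('k, 'r) ring_scheme \<Rightarrow> ('k, 'a, 'd) module_scheme \<Rightarrow> ('k, 'b, 'e) module_scheme \<Rightarrow> ('a \<Rightarrow> 'b) set" where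
  "algebra_hom R M N = {h \<in> carrier M \<rightarrow> carrier N.
     (\<forall>a\<in>carrier M. \<forall>b\<in>carrier M. h (a \<oplus>\<^bsub>M\<^esub> b) = h a \<oplus>\<^bsub>N\<^esub> h b \<and> h (a \<otimes>\<^bsub>M\<^esub> b) = h a \<otimes>\<^bsub>N\<^esub> h b) \<and>
     (\<forall>r\<in>carrier R. \<forall>a\<in>carrier M. h (r \<odot>\<^bsub>M\<^esub> a) = r \<odot>\<^bsub>N\<^esub> h a)}"

text \<open>
  Linear maps out of the \<open>q\<close>-th tensor power of \<open>M\<close> are encoded as \<open>q\<close>-ary multilinear maps, that
  is, as functions on the set of lists of length \<open>q\<close>; for \<open>q = 0\<close> these are the elements of \<open>N\<close>.
\<close>

definition tuples :: "('k, 'a, 'd) module_scheme \<Rightarrow> nat \<Rightarrow> 'a list set" where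
  "tuples M q = {as. length as = q \<and> set as \<subseteq> carrier M}"

definition multilinear_maps ::
  "('k, 'r) ring_scheme \<Rightarrow> ('k, 'a, 'd) module_scheme \<Rightarrow> ('k, 'b, 'e) module_scheme \<Rightarrow> nat
    \<Rightarrow> ('k, 'a list \<Rightarrow> 'b) module" where
  "multilinear_maps R M N q = \<lparr>
     carrier = {g \<in> tuples M q \<rightarrow>\<^sub>E carrier N. \<forall>as\<in>tuples M q. \<forall>i<q.
       (\<forall>a\<in>carrier M. \<forall>b\<in>carrier M. g (as[i := a \<oplus>\<^bsub>M\<^esub> b]) = g (as[i := a]) \<oplus>\<^bsub>N\<^esub> g (as[i := b])) \<and>
       (\<forall>r\<in>carrier R. \<forall>a\<in>carrier M. g (as[i := r \<odot>\<^bsub>M\<^esub> a]) = r \<odot>\<^bsub>N\<^esub> g (as[i := a]))},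
     monoid.mult = undefined, one = undefined,
     zero = (\<lambda>as\<in>tuples M q. \<zero>\<^bsub>N\<^esub>),
     add = (\<lambda>g h. \<lambda>as\<in>tuples M q. g as \<oplus>\<^bsub>N\<^esub> h as),
     smult = (\<lambda>r g. \<lambda>as\<in>tuples M q. r \<odot>\<^bsub>N\<^esub> g as)\<rparr>"

definition module_iso ::
  "('k, 'r) ring_scheme \<Rightarrow> ('k, 'a, 'd) module_scheme \<Rightarrow> ('k, 'b, 'e) module_scheme \<Rightarrow> ('a \<Rightarrow> 'b) set" where
  "module_iso R M N = {h. bij_betw h (carrier M) (carrier N) \<and>
     (\<forall>a\<in>carrier M. \<forall>b\<in>carrier M. h (a \<oplus>\<^bsub>M\<^esub> b) = h a \<oplus>\<^bsub>N\<^esub> h b) \<and>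
     (\<forall>r\<in>carrier R. \<forall>a\<in>carrier M. h (r \<odot>\<^bsub>M\<^esub> a) = r \<odot>\<^bsub>N\<^esub> h a)}"

text \<open>
  The quotient of the subspace \<open>Z\<close> of \<open>M\<close> by its subspace \<open>B\<close>.  Adding \<open>B\<close> in the scalar
  multiplication is needed for the scalar 0, where \<open>r \<odot> X\<close> would be a single point.
\<close>

definition quotient_module :: "('k, 'a, 'd) module_scheme \<Rightarrow> 'a set \<Rightarrow> 'a set \<Rightarrow> ('k, 'a set) module" where
  "quotient_module M Z B = \<lparr>
     carrier = (\<lambda>z. B +>\<^bsub>M\<^esub> z) ` Z,
     monoid.mult = undefined, one = undefined,
     zero = B,
     add = (\<lambda>X Y. X <+>\<^bsub>M\<^esub> Y),
     smult = (\<lambda>r X. B <+>\<^bsub>M\<^esub> ((\<lambda>x. r \<odot>\<^bsub>M\<^esub> x) ` X))\<rparr>"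

text \<open>
  A string \<open>x\<^sub>0 \<leftarrow> x\<^sub>1 \<leftarrow> \<dots> \<leftarrow> x\<^sub>p\<close> is encoded as the pair of the object \<open>x\<^sub>0\<close> and the list of its \<open>p\<close>
  morphisms; the \<open>k\<close>-th morphism (from 1) is the list entry \<open>k - 1\<close>.  Keeping \<open>x\<^sub>0\<close>, which is
  redundant for \<open>p \<ge> 1\<close>, makes strings with \<open>p = 0\<close> the objects.
\<close>

type_synonym ('o, 'm) nerve_string = "'o \<times> 'm list"

type_synonym ('o, 'm, 'a) cochain = "('o, 'm) nerve_string \<Rightarrow> 'a list \<Rightarrow> 'a"

type_synonym ('o, 'm, 'a) total_cochain = "nat \<Rightarrow> nat \<Rightarrow> ('o, 'm, 'a) cochain"

text \<open>\<open>input_child T I u i\<close> is the child of \<open>u\<close> that is inserted into the \<open>i\<close>-th input of \<open>u\<close>, if any.\<close>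

definition input_child :: "tree \<Rightarrow> (nat \<times> nat \<Rightarrow> nat) \<Rightarrow> nat \<Rightarrow> nat \<Rightarrow> nat option" where
  "input_child T I u i =
     (if \<exists>b. (u, b) \<in> edges T \<and> I (u, b) = i
      then Some (THE b. (u, b) \<in> edges T \<and> I (u, b) = i) else None)"

text \<open>
  The inputs \<open>(v, i)\<close> of the vertices \<open>v\<close> above \<open>u\<close> that are not used by an edge, in planar order.
\<close>

primrec free_inputs ::
  "tree \<Rightarrow> (nat \<times> nat \<Rightarrow> nat) \<Rightarrow> (nat \<Rightarrow> nat) \<Rightarrow> nat \<Rightarrow> nat \<Rightarrow> (nat \<times> nat) list" where
  "free_inputs T I q 0 u = []"
| "free_inputs T I q (Suc k) u = concat (map
     (\<lambda>i. case input_child T I u i of None \<Rightarrow> [(u, i)] | Some b \<Rightarrow> free_inputs T I q k b)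
     [1..<Suc (q u)])"

text \<open>\<open>coface i\<close> is the strictly increasing map that omits \<open>i\<close>.\<close>

definition coface :: "nat \<Rightarrow> nat \<Rightarrow> nat" where
  "coface i j = (if j < i then j else Suc j)"

text \<open>
  The multidegrees \<open>(p, q)\<close> with \<open>p' = \<Sum>p a - d\<close> and \<open>q' = 1 + \<Sum>(q a - 1)\<close>; there are finitely many.
\<close>

definition bidegrees :: "nat \<Rightarrow> nat \<Rightarrow> nat \<Rightarrow> nat \<Rightarrow> ((nat \<Rightarrow> nat) \<times> (nat \<Rightarrow> nat)) set" where
  "bidegrees n d p' q' = {(p, q). p \<in> {1..n} \<rightarrow>\<^sub>E UNIV \<and> q \<in> {1..n} \<rightarrow>\<^sub>E UNIV \<and>
     p' + d = (\<Sum>a=1..n. p a) \<and> q' + n = 1 + (\<Sum>a=1..n. q a)}"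

definition quilt_B :: quilt where
  "quilt_B = ([1, 2], \<lparr>edges = {(1, 2)}, planar = {(1, 1), (2, 2)}\<rparr>)"

definition quilt_B' :: quilt where
  "quilt_B' = ([2, 1], \<lparr>edges = {(2, 1)}, planar = {(1, 1), (2, 2)}\<rparr>)"

locale algebra_diagram = small_category C + field R
  for C :: "('o, 'm, 'c) category_scheme" and R :: "('k, 'r) ring_scheme" +
  fixes A :: "'o \<Rightarrow> ('k, 'a, 'e) module_scheme"
    and Am :: "'m \<Rightarrow> 'a \<Rightarrow> 'a"
  assumes A_algebra: "x \<in> Ob C \<Longrightarrow> nonunital_algebra R (A x)"
    and Am_hom: "f \<in> Ar C \<Longrightarrow> Am f \<in> algebra_hom R (A (Dom C f)) (A (Cod C f))"
    and Am_Id: "\<lbrakk>x \<in> Ob C; a \<in> carrier (A x)\<rbrakk> \<Longrightarrow> Am (Ident C x) a = a"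
    and Am_Comp: "\<lbrakk>g \<in> Ar C; f \<in> Ar C; Dom C g = Cod C f; a \<in> carrier (A (Dom C f))\<rbrakk>
      \<Longrightarrow> Am (Comp C g f) a = Am g (Am f a)"
begin

subsection \<open>Strings and cochains\<close>

definition vert :: "('o, 'm) nerve_string \<Rightarrow> nat \<Rightarrow> 'o" where
  "vert \<phi> k = (if k = 0 then fst \<phi> else Dom C (snd \<phi> ! (k - 1)))"

definition strings :: "nat \<Rightarrow> ('o, 'm) nerve_string set" where
  "strings p = {\<phi>. fst \<phi> \<in> Ob C \<and> length (snd \<phi>) = p \<and> set (snd \<phi>) \<subseteq> Ar C \<and>
     (\<forall>k<p. Cod C (snd \<phi> ! k) = vert \<phi> k)}"

text \<open>\<open>segment \<phi> k l\<close> is the composite \<open>\<phi>\<^sub>k\<^sub>,\<^sub>l\<close> from \<open>x\<^sub>l\<close> to \<open>x\<^sub>k\<close>.\<close>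

definition segment :: "('o, 'm) nerve_string \<Rightarrow> nat \<Rightarrow> nat \<Rightarrow> 'm" where
  "segment \<phi> k l = foldr (Comp C) (map (\<lambda>i. snd \<phi> ! i) [k..<l]) (Ident C (vert \<phi> l))"

definition pull :: "nat \<Rightarrow> (nat \<Rightarrow> nat) \<Rightarrow> ('o, 'm) nerve_string \<Rightarrow> ('o, 'm) nerve_string" where
  "pull p \<zeta> \<phi> = (vert \<phi> (\<zeta> 0), map (\<lambda>i. segment \<phi> (\<zeta> i) (\<zeta> (Suc i))) [0..<p])"

definition maps_at :: "nat \<Rightarrow> nat \<Rightarrow> ('o, 'm) nerve_string \<Rightarrow> ('k, 'a list \<Rightarrow> 'a) module" where
  "maps_at p q \<phi> = multilinear_maps R (A (vert \<phi> p)) (A (vert \<phi> 0)) q"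

definition cochains :: "nat \<Rightarrow> nat \<Rightarrow> ('k, ('o, 'm, 'a) cochain) module" where
  "cochains p q = \<lparr>
     carrier = (\<Pi>\<^sub>E \<phi>\<in>strings p. carrier (maps_at p q \<phi>)),
     monoid.mult = undefined, one = undefined,
     zero = (\<lambda>\<phi>\<in>strings p. \<zero>\<^bsub>maps_at p q \<phi>\<^esub>),
     add = (\<lambda>f g. \<lambda>\<phi>\<in>strings p. f \<phi> \<oplus>\<^bsub>maps_at p q \<phi>\<^esub> g \<phi>),
     smult = (\<lambda>r f. \<lambda>\<phi>\<in>strings p. r \<odot>\<^bsub>maps_at p q \<phi>\<^esub> f \<phi>)\<rparr>"

text \<open>The direct sum of all \<^term>\<open>cochains p q\<close>.\<close>

definition Tot :: "('k, ('o, 'm, 'a) total_cochain) module" where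
  "Tot = \<lparr>
     carrier = {F. (\<forall>p q. F p q \<in> carrier (cochains p q)) \<and> finite {(p, q). F p q \<noteq> \<zero>\<^bsub>cochains p q\<^esub>}},
     monoid.mult = undefined, one = undefined,
     zero = (\<lambda>p q. \<zero>\<^bsub>cochains p q\<^esub>),
     add = (\<lambda>F G p q. F p q \<oplus>\<^bsub>cochains p q\<^esub> G p q),
     smult = (\<lambda>r F p q. r \<odot>\<^bsub>cochains p q\<^esub> F p q)\<rparr>"

definition mhat :: "('o, 'm, 'a) total_cochain" where
  "mhat = (\<lambda>p q. if p = 0 \<and> q = 2
     then \<lambda>\<phi>\<in>strings 0. \<lambda>as\<in>tuples (A (vert \<phi> 0)) 2. (as ! 0) \<otimes>\<^bsub>A (vert \<phi> 0)\<^esub> (as ! 1)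
     else \<zero>\<^bsub>cochains p q\<^esub>)"


subsection \<open>The action of quilts\<close>

text \<open>
  The output at the vertex \<open>u\<close> of the composite along the subtree above \<open>u\<close>, where \<open>env\<close> assigns
  arguments to the unused inputs.
\<close>

primrec eval_at ::
  "tree \<Rightarrow> (nat \<times> nat \<Rightarrow> nat) \<Rightarrow> (nat \<Rightarrow> nat) \<Rightarrow> (nat \<Rightarrow> nat) \<Rightarrow> (nat \<Rightarrow> nat \<Rightarrow> nat)
    \<Rightarrow> (nat \<Rightarrow> ('o, 'm, 'a) cochain) \<Rightarrow> ('o, 'm) nerve_string \<Rightarrow> (nat \<times> nat \<Rightarrow> 'a) \<Rightarrow> nat \<Rightarrow> nat \<Rightarrow> 'a" where
  "eval_at T I p q \<zeta> f \<phi> env 0 u = undefined"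
| "eval_at T I p q \<zeta> f \<phi> env (Suc k) u = f u (pull (p u) (\<zeta> u) \<phi>) (map
     (\<lambda>i. case input_child T I u i of
            None \<Rightarrow> Am (segment \<phi> (\<zeta> u (p u)) (length (snd \<phi>))) (env (u, i))
          | Some b \<Rightarrow> Am (segment \<phi> (\<zeta> u (p u)) (\<zeta> b 0)) (eval_at T I p q \<zeta> f \<phi> env k b))
     [1..<Suc (q u)])"

definition coloring_action ::
  "nat \<Rightarrow> tree \<Rightarrow> (nat \<Rightarrow> nat) \<Rightarrow> (nat \<Rightarrow> nat) \<Rightarrow> (nat \<Rightarrow> nat \<Rightarrow> nat) \<Rightarrow> (nat \<times> nat \<Rightarrow> nat)
    \<Rightarrow> (nat \<Rightarrow> ('o, 'm, 'a) cochain) \<Rightarrow> ('o, 'm) nerve_string \<Rightarrow> 'a list \<Rightarrow> 'a" where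
  "coloring_action n T p q \<zeta> I f \<phi> as =
     (let r = tree_root n T;
          env = (\<lambda>x. the (map_of (zip (free_inputs T I q n r) as) x))
      in Am (segment \<phi> 0 (\<zeta> r 0)) (eval_at T I p q \<zeta> f \<phi> env n r))"

text \<open>
  \<open>quilt_op n Q p q f\<close> is the operation of \<open>Q\<close> on \<open>f a\<close> of bidegrees \<open>(p a, q a)\<close>.  The truncated
  subtractions matter only if one of the index sets of the sum is empty, and then the value is not
  used in \<open>total_op\<close>.
\<close>

definition quilt_op ::
  "nat \<Rightarrow> quilt \<Rightarrow> (nat \<Rightarrow> nat) \<Rightarrow> (nat \<Rightarrow> nat) \<Rightarrow> (nat \<Rightarrow> ('o, 'm, 'a) cochain) \<Rightarrow> ('o, 'm, 'a) cochain" where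
  "quilt_op n Q p q f =
     (let p' = (\<Sum>a=1..n. p a) - word_deg n (fst Q);
          q' = 1 + (\<Sum>a=1..n. q a) - n
      in (\<lambda>\<phi>\<in>strings p'. \<lambda>as\<in>tuples (A (vert \<phi> p')) q'.
        \<Oplus>\<^bsub>A (vert \<phi> 0)\<^esub>\<zeta>\<in>clr_word n (fst Q) p. \<Oplus>\<^bsub>A (vert \<phi> 0)\<^esub>I\<in>clr_tree (snd Q) q.
          [coloring_sign n Q p q \<zeta> I] \<cdot>\<^bsub>A (vert \<phi> 0)\<^esub> coloring_action n (snd Q) p q \<zeta> I f \<phi> as))"

text \<open>The multilinear extension of \<^const>\<open>quilt_op\<close> to the total complex.\<close>

definition total_op ::
  "nat \<Rightarrow> quilt \<Rightarrow> (nat \<Rightarrow> ('o, 'm, 'a) total_cochain) \<Rightarrow> ('o, 'm, 'a) total_cochain" where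
  "total_op n Q F = (\<lambda>p' q'. finsum (cochains p' q')
     (\<lambda>(p, q). quilt_op n Q p q (\<lambda>a. F a (p a) (q a)))
     (bidegrees n (word_deg n (fst Q)) p' q'))"


subsection \<open>Differentials and cohomology\<close>

definition delta_S_comp :: "nat \<Rightarrow> nat \<Rightarrow> nat \<Rightarrow> ('o, 'm, 'a) cochain \<Rightarrow> ('o, 'm, 'a) cochain" where
  "delta_S_comp p q i f = (\<lambda>\<phi>\<in>strings (Suc p). \<lambda>as\<in>tuples (A (vert \<phi> (Suc p))) q.
     Am (segment \<phi> 0 (coface i 0))
       (f (pull p (coface i) \<phi>) (map (Am (segment \<phi> (coface i p) (Suc p))) as)))"

definition delta_S :: "('o, 'm, 'a) total_cochain \<Rightarrow> ('o, 'm, 'a) total_cochain" where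
  "delta_S F = (\<lambda>p q. case p of
       0 \<Rightarrow> \<zero>\<^bsub>cochains 0 q\<^esub>
     | Suc p0 \<Rightarrow> \<Oplus>\<^bsub>cochains p q\<^esub>i\<in>{0..p}. [((-1 :: int) ^ i)] \<cdot>\<^bsub>cochains p q\<^esub> delta_S_comp p0 q i (F p0 q))"

definition delta_H :: "('o, 'm, 'a) total_cochain \<Rightarrow> ('o, 'm, 'a) total_cochain" where
  "delta_H F = total_op 2 quilt_B (\<lambda>a. if a = 1 then mhat else F)
     \<ominus>\<^bsub>Tot\<^esub> total_op 2 quilt_B' (\<lambda>a. if a = 1 then mhat else F)"

definition delta :: "('o, 'm, 'a) total_cochain \<Rightarrow> ('o, 'm, 'a) total_cochain" where
  "delta F = delta_S F \<oplus>\<^bsub>Tot\<^esub> delta_H F"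

definition asimplicial :: "('o, 'm, 'a) total_cochain set" where
  "asimplicial = {F \<in> carrier Tot. \<forall>p. F p 0 = \<zero>\<^bsub>cochains p 0\<^esub>}"

definition reduced_cochains :: "nat \<Rightarrow> nat \<Rightarrow> ('o, 'm, 'a) cochain set" where
  "reduced_cochains p q = {f \<in> carrier (cochains p q). \<forall>\<phi>\<in>strings p.
     (\<exists>k<p. \<exists>x\<in>Ob C. snd \<phi> ! k = Ident C x) \<longrightarrow> f \<phi> = \<zero>\<^bsub>maps_at p q \<phi>\<^esub>}"

definition reduced :: "('o, 'm, 'a) total_cochain set" where
  "reduced = {F \<in> carrier Tot. \<forall>p q. F p q \<in> reduced_cochains p q}"

text \<open>Degrees are integers, so that there are coboundaries (namely 0) in degree 0.\<close>

definition homogeneous :: "int \<Rightarrow> ('o, 'm, 'a) total_cochain \<Rightarrow> bool" where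
  "homogeneous m F \<longleftrightarrow> (\<forall>p q. int (p + q) \<noteq> m \<longrightarrow> F p q = \<zero>\<^bsub>cochains p q\<^esub>)"

definition component :: "int \<Rightarrow> ('o, 'm, 'a) total_cochain \<Rightarrow> ('o, 'm, 'a) total_cochain" where
  "component m F = (\<lambda>p q. if int (p + q) = m then F p q else \<zero>\<^bsub>cochains p q\<^esub>)"

text \<open>
  The suspension only shifts the grading by one, so it does not affect which subspaces are graded.
\<close>

definition graded_subspace :: "('o, 'm, 'a) total_cochain set \<Rightarrow> bool" where
  "graded_subspace S \<longleftrightarrow> submodule S R Tot \<and> (\<forall>F\<in>S. \<forall>m. component m F \<in> S)"

definition mQuilt_subalgebra :: "('o, 'm, 'a) total_cochain set \<Rightarrow> bool" where
  "mQuilt_subalgebra S \<longleftrightarrow> graded_subspace S \<and> mhat \<in> S \<and>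
     (\<forall>n. \<forall>Q\<in>quilts n. \<forall>F. (\<forall>a\<in>{1..n}. F a \<in> S) \<longrightarrow> total_op n Q F \<in> S) \<and>
     (\<forall>F\<in>S. delta F \<in> S)"

definition cocycles :: "('o, 'm, 'a) total_cochain set \<Rightarrow> int \<Rightarrow> ('o, 'm, 'a) total_cochain set" where
  "cocycles S m = {F \<in> S. homogeneous m F \<and> delta F = \<zero>\<^bsub>Tot\<^esub>}"

definition coboundaries :: "('o, 'm, 'a) total_cochain set \<Rightarrow> int \<Rightarrow> ('o, 'm, 'a) total_cochain set" where
  "coboundaries S m = delta ` {F \<in> S. homogeneous (m - 1) F}"

definition cohomology ::
  "('o, 'm, 'a) total_cochain set \<Rightarrow> int \<Rightarrow> ('k, ('o, 'm, 'a) total_cochain set) module" where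
  "cohomology S m = quotient_module Tot (cocycles S m) (coboundaries S m)"

definition cohomology_class ::
  "('o, 'm, 'a) total_cochain set \<Rightarrow> int \<Rightarrow> ('o, 'm, 'a) total_cochain \<Rightarrow> ('o, 'm, 'a) total_cochain set" where
  "cohomology_class S m F = coboundaries S m +>\<^bsub>Tot\<^esub> F"

definition inclusion_induces_iso ::
  "('o, 'm, 'a) total_cochain set \<Rightarrow> ('o, 'm, 'a) total_cochain set \<Rightarrow> int \<Rightarrow> bool" where
  "inclusion_induces_iso S S' m \<longleftrightarrow> S \<subseteq> S' \<and>
     (\<exists>h \<in> module_iso R (cohomology S m) (cohomology S' m).
        \<forall>F\<in>cocycles S m. h (cohomology_class S m F) = cohomology_class S' m F)"

end

end

theory Submission
  imports Defs
begin

text \<open>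
  Fix a coloring in the action of a quilt on cochains.  The associated composite vanishes as soon as
  one factor does; since \<open>q' - 1 = \<Sum>(q\<^sub>a - 1)\<close>, a result without inputs
  (\<open>q' = 0\<close>) has a factor without inputs.  If \<open>\<phi>\<close> contains an
  identity at step \<open>k\<close>, that step lies inside a single fibre of the coloring, so the identity survives in
  the string fed to one of the factors.  This gives the subalgebra statements, for any choice of signs.

  For the cohomology, each row is a cosimplicial module and the reduced cochains are the common kernel
  of its codegeneracies \<open>s\<^sub>k\<close>.  If \<open>s\<^sub>j F = 0\<close> for all \<open>j < k\<close> and \<open>\<delta> F\<close> is reduced, then
  \<open>F - \<delta> ((-1)\<^sup>k s\<^sub>k F)\<close> is also killed by \<open>s\<^sub>k\<close>.  Codegeneracies commute with the Hochschild
  differential, whose sign \<open>(-1)\<^sup>p\<close> therefore makes the homotopy compatible with the whole of \<open>\<delta>\<close>.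
  In a fixed total degree finitely many steps suffice, and \<open>\<delta>\<^sup>2 = 0\<close> turns this into bijectivity on
  cohomology.
\<close>

section \<open>Additive maps and modules of functions\<close>

text \<open>Since \<open>delta_H\<close> is given only through the action of two quilts, the
  colorings and signs of these quilts are computed explicitly. The outcome is (-1)^p times the
  classical Hochschild differential of A(x_p) with coefficients in the bimodule A(x_0); additivity,
  linearity and the vanishing of the square of \<open>delta\<close> are read off from this formula.
  The algebras have no units, so the Hochschild direction has cofaces but no codegeneracies, and
  only the simplicial direction can be normalised. The row homotopy must still cope with
  \<open>delta_H\<close>. If \<open>delta F\<close> is reduced, then s_k turns the simplicial part
  of \<open>delta F\<close> into minus the Hochschild part, and \<open>delta_H\<close> of the
  homotopy is exactly the term (-1)^k s_k D F that the row formula needs. Asking that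
  \<open>delta F\<close> be reduced, rather than zero, also lets one normalisation serve twice: on
  cocycles it gives surjectivity on cohomology, on primitives of reduced coboundaries it gives
  injectivity.\<close>

definition additive :: "('a, 'd) ring_scheme \<Rightarrow> ('b, 'e) ring_scheme \<Rightarrow> ('a \<Rightarrow> 'b) \<Rightarrow> bool" where
  "additive M N h \<longleftrightarrow> h \<in> carrier M \<rightarrow> carrier N \<and>
     (\<forall>x\<in>carrier M. \<forall>y\<in>carrier M. h (x \<oplus>\<^bsub>M\<^esub> y) = h x \<oplus>\<^bsub>N\<^esub> h y)"

lemma additiveI:
  assumes "\<And>x. x \<in> carrier M \<Longrightarrow> h x \<in> carrier N"
    and "\<And>x y. x \<in> carrier M \<Longrightarrow> y \<in> carrier M \<Longrightarrow> h (x \<oplus>\<^bsub>M\<^esub> y) = h x \<oplus>\<^bsub>N\<^esub> h y"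
  shows "additive M N h"
  using assms by (auto simp: additive_def)

lemma additive_closed: "additive M N h \<Longrightarrow> x \<in> carrier M \<Longrightarrow> h x \<in> carrier N"
  by (auto simp: additive_def)

lemma additive_add:
  "additive M N h \<Longrightarrow> x \<in> carrier M \<Longrightarrow> y \<in> carrier M \<Longrightarrow> h (x \<oplus>\<^bsub>M\<^esub> y) = h x \<oplus>\<^bsub>N\<^esub> h y"
  by (auto simp: additive_def)

lemma additive_group_hom:
  assumes "abelian_group M" "abelian_group N" "additive M N h"
  shows "group_hom (add_monoid M) (add_monoid N) h"
  using assms
  by (auto simp: group_hom_def group_hom_axioms_def abelian_group.a_group hom_def additive_def)

lemma additive_zero:
  assumes "abelian_group M" "abelian_group N" "additive M N h"
  shows "h \<zero>\<^bsub>M\<^esub> = \<zero>\<^bsub>N\<^esub>"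
  using group_hom.hom_one[OF additive_group_hom[OF assms]] by simp

lemma additive_a_inv:
  assumes "abelian_group M" "abelian_group N" "additive M N h" "x \<in> carrier M"
  shows "h (\<ominus>\<^bsub>M\<^esub> x) = \<ominus>\<^bsub>N\<^esub> h x"
  using group_hom.hom_inv[OF additive_group_hom[OF assms(1-3)]] assms(4) by (simp add: a_inv_def)

lemma additive_a_minus:
  assumes "abelian_group M" "abelian_group N" "additive M N h" "x \<in> carrier M" "y \<in> carrier M"
  shows "h (x \<ominus>\<^bsub>M\<^esub> y) = h x \<ominus>\<^bsub>N\<^esub> h y"
  using assms by (simp add: a_minus_def additive_add additive_a_inv abelian_group.a_inv_closed)

lemma additive_int_pow:
  assumes "abelian_group M" "abelian_group N" "additive M N h" "x \<in> carrier M"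
  shows "h ([(k::int)] \<cdot>\<^bsub>M\<^esub> x) = [k] \<cdot>\<^bsub>N\<^esub> h x"
  using group_hom.hom_int_pow[OF additive_group_hom[OF assms(1-3)], of x k] assms(4)
  by (simp add: add_pow_def)

lemma additive_finsum:
  assumes "abelian_group M" "abelian_group N" "additive M N h" "f \<in> I \<rightarrow> carrier M"
  shows "h (\<Oplus>\<^bsub>M\<^esub>i\<in>I. f i) = (\<Oplus>\<^bsub>N\<^esub>i\<in>I. h (f i))"
proof -
  interpret M: abelian_group M by fact
  interpret N: abelian_group N by fact
  have hc: "\<And>x. x \<in> carrier M \<Longrightarrow> h x \<in> carrier N"
    using assms(3) by (auto simp: additive_def)
  show ?thesis
  proof (cases "finite I")
    case True
    then show ?thesis using assms(4)
    proof (induction I)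
      case empty
      then show ?case by (simp add: additive_zero[OF assms(1-3)])
    next
      case (insert x I)
      then have "f x \<in> carrier M" "f \<in> I \<rightarrow> carrier M" "(\<lambda>i. h (f i)) \<in> I \<rightarrow> carrier N"
        using hc by auto
      with insert show ?case
        by (simp add: additive_add[OF assms(3)] hc)
    qed
  next
    \<comment> \<open>A sum over an infinite index set is zero by convention, and an additive map
      preserves zero.\<close>
    case False
    then show ?thesis by (simp add: M.finsum_infinite N.finsum_infinite additive_zero[OF assms(1-3)])
  qed
qed

lemma (in abelian_group) finsum_in_carrier: "(\<And>i. i \<in> I \<Longrightarrow> f i \<in> carrier G) \<Longrightarrow> (\<Oplus>i\<in>I. f i) \<in> carrier G"
  by (intro finsum_closed) auto

lemma (in abelian_group) finsum_in_subset:
  assumes "S \<subseteq> carrier G" "\<zero> \<in> S" "\<And>x y. x \<in> S \<Longrightarrow> y \<in> S \<Longrightarrow> x \<oplus> y \<in> S"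
    and "\<And>i. i \<in> I \<Longrightarrow> f i \<in> S"
  shows "(\<Oplus>i\<in>I. f i) \<in> S"
proof (cases "finite I")
  case True
  then show ?thesis using assms(4)
  proof (induction I)
    case (insert x I)
    then show ?case using assms(1-3) by (subst finsum_insert) auto
  qed (use assms(2) in auto)
qed (use assms(2) in \<open>auto simp: finsum_infinite\<close>)

lemmas (in abelian_group) finsum_eq_zero = add.finprod_one_eqI

lemma (in abelian_group) a_inv_zero: "\<ominus> \<zero> = \<zero>"
  by (rule minus_equality) simp_all

lemma (in abelian_group) int_pow_minus_one: "x \<in> carrier G \<Longrightarrow> [(-1::int)] \<cdot> x = \<ominus> x"
  using add.int_pow_neg[of x 1] by (simp add: add.int_pow_1)

lemma (in abelian_group) sign_int_pow:
  "x \<in> carrier G \<Longrightarrow> [((-1::int) ^ i)] \<cdot> x = (if even i then x else \<ominus> x)"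
  by (simp add: int_pow_minus_one add.int_pow_1)

lemma (in abelian_group) int_pow_closed: "x \<in> carrier G \<Longrightarrow> [(k::int)] \<cdot> x \<in> carrier G"
  by (simp add: add.int_pow_closed)

lemma (in abelian_group) int_pow_zero: "[(k::int)] \<cdot> \<zero> = \<zero>"
  by (simp add: add.int_pow_one)

text \<open>Module laws are equations, so they can be tested by a jointly injective family of linear maps.\<close>

lemma module_jointly_injective:
  fixes R (structure)
  assumes cring: "cring R"
    and mod: "\<And>i. i \<in> I \<Longrightarrow> module R (M i)"
    and zero: "\<zero>\<^bsub>P\<^esub> \<in> carrier P"
    and add: "\<And>f g. f \<in> carrier P \<Longrightarrow> g \<in> carrier P \<Longrightarrow> f \<oplus>\<^bsub>P\<^esub> g \<in> carrier P"
    and smult: "\<And>r f. r \<in> carrier R \<Longrightarrow> f \<in> carrier P \<Longrightarrow> r \<odot>\<^bsub>P\<^esub> f \<in> carrier P"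
    and ev: "\<And>i f. i \<in> I \<Longrightarrow> f \<in> carrier P \<Longrightarrow> ev i f \<in> carrier (M i)"
    and ev_zero: "\<And>i. i \<in> I \<Longrightarrow> ev i \<zero>\<^bsub>P\<^esub> = \<zero>\<^bsub>M i\<^esub>"
    and ev_add: "\<And>i f g. i \<in> I \<Longrightarrow> f \<in> carrier P \<Longrightarrow> g \<in> carrier P \<Longrightarrow>
        ev i (f \<oplus>\<^bsub>P\<^esub> g) = ev i f \<oplus>\<^bsub>M i\<^esub> ev i g"
    and ev_smult: "\<And>i r f. i \<in> I \<Longrightarrow> r \<in> carrier R \<Longrightarrow> f \<in> carrier P \<Longrightarrow>
        ev i (r \<odot>\<^bsub>P\<^esub> f) = r \<odot>\<^bsub>M i\<^esub> ev i f"
    and inj: "\<And>f g. f \<in> carrier P \<Longrightarrow> g \<in> carrier P \<Longrightarrow> (\<And>i. i \<in> I \<Longrightarrow> ev i f = ev i g) \<Longrightarrow> f = g"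
  shows "module R P"
proof (rule moduleI)
  interpret R: cring R by fact
  note grp = abelian_groupE[OF module.axioms(2)[OF mod]]
  note cl = zero add smult R.add.inv_closed
  \<comment> \<open>\<open>P\<close> is not yet known to be a group, so the negative of
    \<open>f\<close> has to be named explicitly: it is the multiple of \<open>f\<close> by minus
    one.\<close>
  have neg: "\<exists>g\<in>carrier P. g \<oplus>\<^bsub>P\<^esub> f = \<zero>\<^bsub>P\<^esub>" if "f \<in> carrier P" for f
  proof (rule bexI[of _ "(\<ominus> \<one>) \<odot>\<^bsub>P\<^esub> f"])
    show "(\<ominus> \<one>) \<odot>\<^bsub>P\<^esub> f \<oplus>\<^bsub>P\<^esub> f = \<zero>\<^bsub>P\<^esub>"
    proof (rule inj)
      fix i assume i: "i \<in> I"
      interpret module R "M i" using i by (rule mod)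
      show "ev i ((\<ominus> \<one>) \<odot>\<^bsub>P\<^esub> f \<oplus>\<^bsub>P\<^esub> f) = ev i \<zero>\<^bsub>P\<^esub>"
        using that i cl by (simp add: ev_add ev_smult ev_zero smult_l_minus ev M.l_neg)
    qed (use that cl in auto)
  qed (use that cl in auto)
  show "abelian_group P"
  proof (rule abelian_groupI)
    show "x \<oplus>\<^bsub>P\<^esub> y = y \<oplus>\<^bsub>P\<^esub> x" if "x \<in> carrier P" "y \<in> carrier P" for x y
    proof (rule inj)
      fix i assume "i \<in> I"
      then show "ev i (x \<oplus>\<^bsub>P\<^esub> y) = ev i (y \<oplus>\<^bsub>P\<^esub> x)"
        using that by (simp add: ev_add grp(4)[of i "ev i x"] ev)
    qed (use that cl in auto)
  qed (use cl neg in \<open>auto intro!: inj simp: ev_add ev ev_zero grp(1,2,3,5)\<close>)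
  show "cring R" by fact
  show "(a \<oplus> b) \<odot>\<^bsub>P\<^esub> x = a \<odot>\<^bsub>P\<^esub> x \<oplus>\<^bsub>P\<^esub> b \<odot>\<^bsub>P\<^esub> x"
    if "a \<in> carrier R" "b \<in> carrier R" "x \<in> carrier P" for a b x
    by (rule inj) (use that cl in \<open>auto simp: ev_add ev_smult ev module.smult_l_distr[OF mod]\<close>)
  show "a \<odot>\<^bsub>P\<^esub> (x \<oplus>\<^bsub>P\<^esub> y) = a \<odot>\<^bsub>P\<^esub> x \<oplus>\<^bsub>P\<^esub> a \<odot>\<^bsub>P\<^esub> y"
    if "a \<in> carrier R" "x \<in> carrier P" "y \<in> carrier P" for a x y
    by (rule inj) (use that cl in \<open>auto simp: ev_add ev_smult ev module.smult_r_distr[OF mod]\<close>)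
  show "a \<otimes> b \<odot>\<^bsub>P\<^esub> x = a \<odot>\<^bsub>P\<^esub> (b \<odot>\<^bsub>P\<^esub> x)"
    if "a \<in> carrier R" "b \<in> carrier R" "x \<in> carrier P" for a b x
    by (rule inj) (use that cl in \<open>auto simp: ev_add ev_smult ev module.smult_assoc1[OF mod]\<close>)
  show "\<one> \<odot>\<^bsub>P\<^esub> x = x" if "x \<in> carrier P" for x
    by (rule inj) (use that cl in \<open>auto simp: ev_add ev_smult ev module.smult_one[OF mod]\<close>)
qed (rule smult)

section \<open>Linear maps between modules given as records\<close>

definition linear_on :: "('k, 'r) ring_scheme \<Rightarrow> ('k, 'a, 'd) module_scheme \<Rightarrow> ('k, 'b, 'e) module_scheme
    \<Rightarrow> ('a \<Rightarrow> 'b) \<Rightarrow> bool" where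
  "linear_on R M N h \<longleftrightarrow> additive M N h \<and> (\<forall>r\<in>carrier R. \<forall>x\<in>carrier M. h (r \<odot>\<^bsub>M\<^esub> x) = r \<odot>\<^bsub>N\<^esub> h x)"

lemma linear_on_smult: "linear_on R M N h \<Longrightarrow> r \<in> carrier R \<Longrightarrow> x \<in> carrier M \<Longrightarrow> h (r \<odot>\<^bsub>M\<^esub> x) = r \<odot>\<^bsub>N\<^esub> h x"
  by (auto simp: linear_on_def)

lemma linear_on_additive: "linear_on R M N h \<Longrightarrow> additive M N h"
  by (auto simp: linear_on_def)

text \<open>Linearity only looks at the carrier, and the module laws keep sums and multiples there.
  This lets the restricted functions that encode cochains be replaced by unrestricted
  formulas.\<close>

lemma linear_on_cong:
  assumes "module R M" "linear_on R M N h" "\<And>x. x \<in> carrier M \<Longrightarrow> h x = h' x"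
  shows "linear_on R M N h'"
proof -
  interpret module R M by fact
  show ?thesis
    using assms(2) unfolding linear_on_def additive_def
    by (simp add: Pi_iff flip: assms(3))
qed

lemma linear_on_compose: "linear_on R M N h \<Longrightarrow> linear_on R N P k \<Longrightarrow> linear_on R M P (\<lambda>x. k (h x))"
  by (simp add: linear_on_def additive_def Pi_iff)

subsection \<open>Multilinear maps\<close>

lemma tuples_update: "as \<in> tuples M q \<Longrightarrow> a \<in> carrier M \<Longrightarrow> as[i := a] \<in> tuples M q"
  using set_update_subset_insert[of as i a] by (auto simp: tuples_def)

lemma tuples_map: "as \<in> tuples M q \<Longrightarrow> h \<in> carrier M \<rightarrow> carrier N \<Longrightarrow> map h as \<in> tuples N q"
  by (auto simp: tuples_def)

text \<open>With one linear map per slot, composing multilinear maps with linear ones becomes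
  composition of linear maps, and no equation has to be checked by hand.\<close>

lemma multilinear_iff:
  "g \<in> carrier (multilinear_maps R M N q) \<longleftrightarrow> g \<in> tuples M q \<rightarrow>\<^sub>E carrier N \<and>
     (\<forall>as\<in>tuples M q. \<forall>i<q. linear_on R M N (\<lambda>a. g (as[i := a])))"
proof -
  have "linear_on R M N (\<lambda>a. g (as[i := a])) \<longleftrightarrow>
     (\<forall>a\<in>carrier M. \<forall>b\<in>carrier M. g (as[i := a \<oplus>\<^bsub>M\<^esub> b]) = g (as[i := a]) \<oplus>\<^bsub>N\<^esub> g (as[i := b])) \<and>
       (\<forall>r\<in>carrier R. \<forall>a\<in>carrier M. g (as[i := r \<odot>\<^bsub>M\<^esub> a]) = r \<odot>\<^bsub>N\<^esub> g (as[i := a]))"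
    if "g \<in> tuples M q \<rightarrow>\<^sub>E carrier N" "as \<in> tuples M q" for as i
    using that tuples_update[OF that(2)] by (auto simp: linear_on_def additive_def)
  then show ?thesis by (auto simp: multilinear_maps_def)
qed

lemma multilinear_closed:
  "g \<in> carrier (multilinear_maps R M N q) \<Longrightarrow> as \<in> tuples M q \<Longrightarrow> g as \<in> carrier N"
  by (auto simp: multilinear_iff)

lemma multilinear_linear:
  "g \<in> carrier (multilinear_maps R M N q) \<Longrightarrow> as \<in> tuples M q \<Longrightarrow> i < q \<Longrightarrow>
    linear_on R M N (\<lambda>a. g (as[i := a]))"
  by (auto simp: multilinear_iff)

lemma multilinear_eqI:
  assumes "g \<in> carrier (multilinear_maps R M N q)" "h \<in> carrier (multilinear_maps R M N q)"
    and "\<And>as. as \<in> tuples M q \<Longrightarrow> g as = h as"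
  shows "g = h"
  using assms by (intro PiE_ext[of g "tuples M q" "\<lambda>_. carrier N"]) (auto simp: multilinear_iff)

text \<open>The tuple equals its own update at \<open>i\<close>, so the entry becomes the argument
  of an additive map.\<close>

lemma multilinear_zero_arg:
  assumes "module R M" "module R N" "g \<in> carrier (multilinear_maps R M N q)" "as \<in> tuples M q" "i < q"
    "as ! i = \<zero>\<^bsub>M\<^esub>"
  shows "g as = \<zero>\<^bsub>N\<^esub>"
proof -
  have "additive M N (\<lambda>a. g (as[i := a]))"
    using multilinear_linear[OF assms(3-5)] by (rule linear_on_additive)
  from additive_zero[OF module.axioms(2)[OF assms(1)] module.axioms(2)[OF assms(2)] this]
  show ?thesis using assms(6) by (metis list_update_id)
qed

text \<open>The evaluations at all tuples are jointly injective linear maps into \<open>N\<close>,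
  so only closure under the operations needs an argument.\<close>

lemma module_multilinear_maps:
  fixes R (structure)
  assumes "module R M" "module R N"
  shows "module R (multilinear_maps R M N q)" (is "module R ?P")
proof -
  interpret M: module R M by fact
  interpret N: module R N by fact
  note cl = multilinear_closed[of _ R M N q]
  note upd = tuples_update[of _ M q]
  have add: "f \<oplus>\<^bsub>?P\<^esub> g = (\<lambda>as\<in>tuples M q. f as \<oplus>\<^bsub>N\<^esub> g as)" for f g
    by (simp add: multilinear_maps_def)
  have smult: "r \<odot>\<^bsub>?P\<^esub> f = (\<lambda>as\<in>tuples M q. r \<odot>\<^bsub>N\<^esub> f as)" for f r
    by (simp add: multilinear_maps_def)
  have zero: "\<zero>\<^bsub>?P\<^esub> = (\<lambda>as\<in>tuples M q. \<zero>\<^bsub>N\<^esub>)"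
    by (simp add: multilinear_maps_def)
  note D = multilinear_iff linear_on_def additive_def
  show ?thesis
  proof (rule module_jointly_injective[where I = "tuples M q" and M = "\<lambda>_. N" and ev = "\<lambda>as f. f as"])
    show "cring R" ..
    show "\<zero>\<^bsub>?P\<^esub> \<in> carrier ?P"
      by (auto simp: zero D upd)
    show "f \<oplus>\<^bsub>?P\<^esub> g \<in> carrier ?P" if "f \<in> carrier ?P" "g \<in> carrier ?P" for f g
      unfolding add D
      using that cl by (auto simp: upd N.smult_r_distr D intro!: N.M.a_ac cl)
        (simp add: N.a_ac PiE_mem upd)
    \<comment> \<open>Here the scalars must commute: \<open>r\<close> has to pass the scalar that
      multilinearity takes out of the slot.\<close>
    show "r \<odot>\<^bsub>?P\<^esub> f \<in> carrier ?P" if "r \<in> carrier R" "f \<in> carrier ?P" for f r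
      unfolding smult D
      using that cl by (auto simp: upd N.smult_r_distr D N.smult_assoc1[symmetric] M.m_comm)
  qed (auto simp: add smult zero assms cl intro: multilinear_eqI)
qed

text \<open>Mapping \<open>h\<close> over an updated list updates the mapped list by the image, so
  each slot is a composite of three linear maps.\<close>

lemma multilinear_compose:
  assumes M': "module R M'" and g: "g \<in> carrier (multilinear_maps R M N q)"
    and h: "linear_on R M' M h" and k: "linear_on R N N' k"
  shows "(\<lambda>as\<in>tuples M' q. k (g (map h as))) \<in> carrier (multilinear_maps R M' N' q)"
proof -
  interpret M': module R M' by fact
  have hc: "h \<in> carrier M' \<rightarrow> carrier M"
    using h by (auto simp: linear_on_def additive_def)
  note t = tuples_map[OF _ hc] and u = tuples_update
  show ?thesis
    unfolding multilinear_iff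
  proof (intro conjI ballI allI impI)
    show "(\<lambda>as\<in>tuples M' q. k (g (map h as))) \<in> tuples M' q \<rightarrow>\<^sub>E carrier N'"
      using k by (auto simp: linear_on_def additive_def intro!: multilinear_closed[OF g] t)
    fix as i assume as: "as \<in> tuples M' q" and i: "i < q"
    have "linear_on R M' N' (\<lambda>a. k (g ((map h as)[i := h a])))"
      by (intro linear_on_compose[OF _ k, where h = "\<lambda>a. g ((map h as)[i := h a])"]
            linear_on_compose[OF h multilinear_linear[OF g t[OF as] i]])
    then show "linear_on R M' N' (\<lambda>a. (\<lambda>as\<in>tuples M' q. k (g (map h as))) (as[i := a]))"
      using as by (auto simp: linear_on_def additive_def u map_update)
  qed
qed

lemma multilinear_evaluation_additive:
  "as \<in> tuples M q \<Longrightarrow> additive (multilinear_maps R M N q) N (\<lambda>g. g as)"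
  by (auto simp: additive_def multilinear_closed) (auto simp: multilinear_maps_def)

section \<open>Strings and cochains\<close>

context algebra_diagram
begin

lemma A_module: "x \<in> Ob C \<Longrightarrow> module R (A x)"
  using A_algebra nonunital_algebra_def by blast

lemma A_group: "x \<in> Ob C \<Longrightarrow> abelian_group (A x)"
  by (rule module.axioms(2)[OF A_module])

lemma R_cring: "cring R" ..

lemma Am_linear: "f \<in> Ar C \<Longrightarrow> linear_on R (A (Dom C f)) (A (Cod C f)) (Am f)"
  using Am_hom[of f] by (auto simp: algebra_hom_def linear_on_def additive_def)

lemma Am_mult: "f \<in> Ar C \<Longrightarrow> a \<in> carrier (A (Dom C f)) \<Longrightarrow> b \<in> carrier (A (Dom C f)) \<Longrightarrow>
    Am f (a \<otimes>\<^bsub>A (Dom C f)\<^esub> b) = Am f a \<otimes>\<^bsub>A (Cod C f)\<^esub> Am f b"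
  using Am_hom[of f] by (auto simp: algebra_hom_def)

lemma stringsD:
  assumes "\<phi> \<in> strings p"
  shows "fst \<phi> \<in> Ob C" "length (snd \<phi>) = p" "k < p \<Longrightarrow> snd \<phi> ! k \<in> Ar C"
    "k < p \<Longrightarrow> Cod C (snd \<phi> ! k) = vert \<phi> k" "k < p \<Longrightarrow> Dom C (snd \<phi> ! k) = vert \<phi> (Suc k)"
  using assms by (auto simp: strings_def subset_iff vert_def)

lemma vert_Ob: "\<phi> \<in> strings p \<Longrightarrow> k \<le> p \<Longrightarrow> vert \<phi> k \<in> Ob C"
  using stringsD(1,3)[of \<phi> p] by (cases k) (auto simp: vert_def Dom_closed)

lemma strings_eqI:
  assumes "\<phi> \<in> strings p" "\<psi> \<in> strings p" "vert \<phi> 0 = vert \<psi> 0"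
    "\<And>k. k < p \<Longrightarrow> snd \<phi> ! k = snd \<psi> ! k"
  shows "\<phi> = \<psi>"
  using assms stringsD(2)[OF assms(1)] stringsD(2)[OF assms(2)]
  by (auto simp: vert_def prod_eq_iff intro: nth_equalityI)

section \<open>Composites along a string and the transports they induce\<close>

lemma segment_refl: "segment \<phi> k k = Ident C (vert \<phi> k)"
  by (simp add: segment_def)

lemma segment_step: "k < l \<Longrightarrow> segment \<phi> k l = Comp C (snd \<phi> ! k) (segment \<phi> (Suc k) l)"
  by (simp add: segment_def upt_conv_Cons)

text \<open>A segment is built by peeling off its leftmost morphism, hence the induction runs
  downwards on the left end. The same holds for \<open>segment_Comp\<close> and
  \<open>pull_segment\<close>.\<close>

lemma segment_arrow:
  assumes "\<phi> \<in> strings p" "k \<le> l" "l \<le> p"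
  shows "segment \<phi> k l \<in> Ar C \<and> Dom C (segment \<phi> k l) = vert \<phi> l \<and> Cod C (segment \<phi> k l) = vert \<phi> k"
  using assms(2)
proof (induction k rule: inc_induct)
  case base
  show ?case using vert_Ob[OF assms(1,3)] by (simp add: segment_refl Id_closed Dom_Id Cod_Id)
next
  case (step k)
  then show ?case using assms stringsD[OF assms(1)]
    by (simp add: segment_step Comp_closed Dom_Comp Cod_Comp)
qed

lemma segment_Comp:
  assumes "\<phi> \<in> strings p" "k \<le> l" "l \<le> m" "m \<le> p"
  shows "Comp C (segment \<phi> k l) (segment \<phi> l m) = segment \<phi> k m"
  using assms(2)
proof (induction k rule: inc_induct)
  case base
  show ?case using segment_arrow[OF assms(1,3,4)] by (metis segment_refl Id_Comp)
next
  case (step k)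
  then show ?case
    using assms stringsD[OF assms(1)] segment_arrow[OF assms(1), of "Suc k" l] segment_arrow[OF assms(1), of l m]
    by (simp add: segment_step[of k] Comp_assoc)
qed

lemma segment_Suc:
  assumes "\<phi> \<in> strings p" "k < p"
  shows "segment \<phi> k (Suc k) = snd \<phi> ! k"
  using stringsD[OF assms(1)] assms(2) Comp_Id[of "snd \<phi> ! k"]
  by (simp add: segment_step segment_refl)

abbreviation transport :: "('o, 'm) nerve_string \<Rightarrow> nat \<Rightarrow> nat \<Rightarrow> 'a \<Rightarrow> 'a" where
  "transport \<phi> k l \<equiv> Am (segment \<phi> k l)"

lemma transport_linear:
  "\<phi> \<in> strings p \<Longrightarrow> k \<le> l \<Longrightarrow> l \<le> p \<Longrightarrow> linear_on R (A (vert \<phi> l)) (A (vert \<phi> k)) (transport \<phi> k l)"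
  using Am_linear[of "segment \<phi> k l"] segment_arrow[of \<phi> p k l] by auto

lemma transport_additive:
  "\<phi> \<in> strings p \<Longrightarrow> k \<le> l \<Longrightarrow> l \<le> p \<Longrightarrow> additive (A (vert \<phi> l)) (A (vert \<phi> k)) (transport \<phi> k l)"
  by (rule linear_on_additive) (rule transport_linear)

lemma transport_closed:
  "\<phi> \<in> strings p \<Longrightarrow> k \<le> l \<Longrightarrow> l \<le> p \<Longrightarrow> a \<in> carrier (A (vert \<phi> l)) \<Longrightarrow>
    transport \<phi> k l a \<in> carrier (A (vert \<phi> k))"
  by (rule additive_closed[OF transport_additive])

lemma transport_mult:
  assumes "\<phi> \<in> strings p" "k \<le> l" "l \<le> p" "a \<in> carrier (A (vert \<phi> l))" "b \<in> carrier (A (vert \<phi> l))"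
  shows "transport \<phi> k l (a \<otimes>\<^bsub>A (vert \<phi> l)\<^esub> b) = transport \<phi> k l a \<otimes>\<^bsub>A (vert \<phi> k)\<^esub> transport \<phi> k l b"
  using Am_mult[of "segment \<phi> k l" a b] segment_arrow[OF assms(1-3)] assms(4,5) by auto

lemma transport_transport:
  assumes "\<phi> \<in> strings p" "k \<le> l" "l \<le> m" "m \<le> p" "a \<in> carrier (A (vert \<phi> m))"
  shows "transport \<phi> k l (transport \<phi> l m a) = transport \<phi> k m a"
  using assms segment_arrow[OF assms(1), of k l] segment_arrow[OF assms(1), of l m]
  by (simp flip: segment_Comp[OF assms(1-4)] add: Am_Comp)

lemma transport_refl: "\<phi> \<in> strings p \<Longrightarrow> k \<le> p \<Longrightarrow> a \<in> carrier (A (vert \<phi> k)) \<Longrightarrow> transport \<phi> k k a = a"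
  by (simp add: segment_refl Am_Id vert_Ob)

lemma mono_on_le: "mono_on {0..p} \<zeta> \<Longrightarrow> i \<le> j \<Longrightarrow> j \<le> p \<Longrightarrow> \<zeta> i \<le> (\<zeta> j :: nat)" for i j p :: nat
  by (auto simp: mono_on_def)

text \<open>Weak monotonicity is the right generality: colorings and cofaces are strictly
  increasing, but codegeneracies are not, and pulling back along those inserts identities.\<close>

lemma pull_vert: 
  assumes "\<phi> \<in> strings p'" "mono_on {0..p} \<zeta>" "\<zeta> p \<le> p'" "k \<le> p"
  shows "vert (pull p \<zeta> \<phi>) k = vert \<phi> (\<zeta> k)"
proof (cases k)
  case (Suc j)
  have "\<zeta> j \<le> \<zeta> (Suc j)" "\<zeta> (Suc j) \<le> \<zeta> p"
    using assms Suc by (auto intro: mono_on_le)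
  then show ?thesis using Suc assms segment_arrow[OF assms(1), of "\<zeta> j" "\<zeta> (Suc j)"]
    by (auto simp: pull_def vert_def)
qed (simp add: pull_def vert_def)

lemma pull_nth: "k < p \<Longrightarrow> snd (pull p \<zeta> \<phi>) ! k = segment \<phi> (\<zeta> k) (\<zeta> (Suc k))"
  by (simp add: pull_def)

lemma pull_strings:
  assumes "\<phi> \<in> strings p'" "mono_on {0..p} \<zeta>" "\<zeta> p \<le> p'"
  shows "pull p \<zeta> \<phi> \<in> strings p"
proof -
  have *: "\<zeta> k \<le> \<zeta> (Suc k) \<and> \<zeta> (Suc k) \<le> \<zeta> p" if "k < p" for k
    using assms(2) that by (auto intro: mono_on_le)
  note ar = segment_arrow[OF assms(1)]
  have "segment \<phi> (\<zeta> k) (\<zeta> (Suc k)) \<in> Ar C \<and> Cod C (segment \<phi> (\<zeta> k) (\<zeta> (Suc k))) = vert \<phi> (\<zeta> k)" if "k < p" for k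
    using *[OF that] ar[of "\<zeta> k" "\<zeta> (Suc k)"] assms(3) by auto
  moreover have "\<zeta> 0 \<le> p'"
    using mono_on_le[OF assms(2), of 0 p] assms(3) by auto
  ultimately show ?thesis
    using pull_vert[OF assms] vert_Ob[OF assms(1)]
    by (auto simp: strings_def pull_nth in_set_conv_nth) (auto simp: pull_def)
qed

lemma pull_segment:
  assumes "\<phi> \<in> strings p'" "mono_on {0..p} \<zeta>" "\<zeta> p \<le> p'" "k \<le> l" "l \<le> p"
  shows "segment (pull p \<zeta> \<phi>) k l = segment \<phi> (\<zeta> k) (\<zeta> l)"
  using assms(4)
proof (induction k rule: inc_induct)
  case base
  show ?case using assms by (simp add: segment_refl pull_vert)
next
  case (step k)
  have "\<zeta> k \<le> \<zeta> (Suc k)" "\<zeta> (Suc k) \<le> \<zeta> l" "\<zeta> l \<le> \<zeta> p"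
    using assms step by (auto intro: mono_on_le)
  with step show ?case using assms
    by (simp add: segment_step[of k] pull_nth segment_Comp[OF assms(1)])
qed

lemma mono_on_compose:
  "mono_on {0..p} \<eta> \<Longrightarrow> mono_on {0..p'} \<zeta> \<Longrightarrow> \<eta> p \<le> (p'::nat) \<Longrightarrow> mono_on {0..p::nat} (\<lambda>k. \<zeta> (\<eta> k) :: nat)"
proof (rule mono_onI)
  fix r s assume *: "mono_on {0..p} \<eta>" "mono_on {0..p'} \<zeta>" "\<eta> p \<le> p'" "r \<in> {0..p}" "s \<in> {0..p}" "r \<le> s"
  then have "\<eta> r \<le> \<eta> s" "\<eta> s \<le> \<eta> p" by (auto intro: mono_on_le)
  with * show "\<zeta> (\<eta> r) \<le> \<zeta> (\<eta> s)" by (auto intro: mono_on_le)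
qed

lemma pull_pull:
  assumes "\<phi> \<in> strings p''" "mono_on {0..p'} \<zeta>" "\<zeta> p' \<le> p''" "mono_on {0..p} \<eta>" "\<eta> p \<le> p'"
  shows "pull p \<eta> (pull p' \<zeta> \<phi>) = pull p (\<lambda>k. \<zeta> (\<eta> k)) \<phi>"
proof -
  have "\<eta> k \<le> p'" if "k \<le> p" for k
    using mono_on_le[OF assms(4), of k p] that assms(5) by auto
  moreover have "\<eta> k \<le> \<eta> (Suc k)" if "k < p" for k
    using mono_on_le[OF assms(4), of k "Suc k"] that by auto
  ultimately show ?thesis
    using assms by (simp add: pull_def[of p] pull_vert pull_segment)
qed

lemma pull_cong: "(\<And>k. k \<le> p \<Longrightarrow> \<zeta> k = \<eta> k) \<Longrightarrow> pull p \<zeta> \<phi> = pull p \<eta> \<phi>"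
  by (simp add: pull_def)

lemma pull_ident: 
  assumes "\<phi> \<in> strings p"
  shows "pull p (\<lambda>k. k) \<phi> = \<phi>"
  using assms pull_strings[OF assms, of p "\<lambda>k. k"] segment_Suc[OF assms]
  by (intro strings_eqI[of _ p]) (auto simp: pull_nth pull_vert[OF assms] mono_on_def)

subsection \<open>The modules of cochains\<close>

lemma maps_at_module: "\<phi> \<in> strings p \<Longrightarrow> module R (maps_at p q \<phi>)"
  by (simp add: maps_at_def module_multilinear_maps A_module vert_Ob)

lemma maps_at_group: "\<phi> \<in> strings p \<Longrightarrow> abelian_group (maps_at p q \<phi>)"
  by (rule module.axioms(2)[OF maps_at_module])

lemma cochains_carrier:
  "f \<in> carrier (cochains p q) \<longleftrightarrow> f \<in> (\<Pi>\<^sub>E \<phi>\<in>strings p. carrier (maps_at p q \<phi>))"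
  by (simp add: cochains_def)

lemma cochain_at: "f \<in> carrier (cochains p q) \<Longrightarrow> \<phi> \<in> strings p \<Longrightarrow> f \<phi> \<in> carrier (maps_at p q \<phi>)"
  by (auto simp: cochains_carrier)

lemma cochain_value:
  "f \<in> carrier (cochains p q) \<Longrightarrow> \<phi> \<in> strings p \<Longrightarrow> as \<in> tuples (A (vert \<phi> p)) q \<Longrightarrow>
    f \<phi> as \<in> carrier (A (vert \<phi> 0))"
  using cochain_at[of f p q \<phi>] by (auto simp: maps_at_def intro: multilinear_closed)

lemma cochain_eqI:
  assumes "f \<in> carrier (cochains p q)" "g \<in> carrier (cochains p q)"
    "\<And>\<phi> as. \<phi> \<in> strings p \<Longrightarrow> as \<in> tuples (A (vert \<phi> p)) q \<Longrightarrow> f \<phi> as = g \<phi> as"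
  shows "f = g"
proof (rule PiE_ext[of f "strings p" "\<lambda>\<phi>. carrier (maps_at p q \<phi>)"])
  fix \<phi> assume "\<phi> \<in> strings p"
  then show "f \<phi> = g \<phi>"
    using cochain_at[of f p q \<phi>] cochain_at[of g p q \<phi>] assms
    unfolding maps_at_def by (blast intro: multilinear_eqI)
qed (use assms in \<open>auto simp: cochains_carrier\<close>)

lemma cochains_module: "module R (cochains p q)"
proof (rule module_jointly_injective[where I = "strings p" and M = "maps_at p q" and ev = "\<lambda>\<phi> f. f \<phi>"])
  note cl = abelian_groupE(1,2)[OF maps_at_group] module.smult_closed[OF maps_at_module]
  show "\<zero>\<^bsub>cochains p q\<^esub> \<in> carrier (cochains p q)"
    using cl by (auto simp: cochains_def)
  show "f \<oplus>\<^bsub>cochains p q\<^esub> g \<in> carrier (cochains p q)"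
    if "f \<in> carrier (cochains p q)" "g \<in> carrier (cochains p q)" for f g
    using that cl by (auto simp: cochains_def PiE_iff)
  show "r \<odot>\<^bsub>cochains p q\<^esub> f \<in> carrier (cochains p q)"
    if "r \<in> carrier R" "f \<in> carrier (cochains p q)" for f r
    using that cl by (auto simp: cochains_def PiE_iff)
  show "f = g" if "f \<in> carrier (cochains p q)" "g \<in> carrier (cochains p q)"
    "\<And>\<phi>. \<phi> \<in> strings p \<Longrightarrow> f \<phi> = g \<phi>" for f g
    using that by (intro PiE_ext[of f "strings p" "\<lambda>\<phi>. carrier (maps_at p q \<phi>)"])
      (auto simp: cochains_carrier)
qed (auto simp: cochains_def R_cring maps_at_module)

lemma cochains_group: "abelian_group (cochains p q)"
  by (rule module.axioms(2)[OF cochains_module])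

text \<open>Through this map, finite sums, signs and negatives of cochains turn into the same
  operations in a single algebra, where equations between cochains are checked.\<close>

lemma cochain_evaluation_additive:
  assumes "\<phi> \<in> strings p" "as \<in> tuples (A (vert \<phi> p)) q"
  shows "additive (cochains p q) (A (vert \<phi> 0)) (\<lambda>f. f \<phi> as)"
proof (rule additiveI)
  show "f \<phi> as \<in> carrier (A (vert \<phi> 0))" if "f \<in> carrier (cochains p q)" for f
    using that assms by (rule cochain_value)
  show "(f \<oplus>\<^bsub>cochains p q\<^esub> g) \<phi> as = f \<phi> as \<oplus>\<^bsub>A (vert \<phi> 0)\<^esub> g \<phi> as" for f g
    using assms by (simp add: cochains_def maps_at_def multilinear_maps_def)
qed

lemma cochain_zero_at: "\<phi> \<in> strings p \<Longrightarrow> \<zero>\<^bsub>cochains p q\<^esub> \<phi> = \<zero>\<^bsub>maps_at p q \<phi>\<^esub>"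
  by (simp add: cochains_def)

lemma maps_at_zero_value: "as \<in> tuples (A (vert \<phi> p)) q \<Longrightarrow> \<zero>\<^bsub>maps_at p q \<phi>\<^esub> as = \<zero>\<^bsub>A (vert \<phi> 0)\<^esub>"
  by (simp add: maps_at_def multilinear_maps_def)

lemma cochain_zero_value:
  "\<phi> \<in> strings p \<Longrightarrow> as \<in> tuples (A (vert \<phi> p)) q \<Longrightarrow> \<zero>\<^bsub>cochains p q\<^esub> \<phi> as = \<zero>\<^bsub>A (vert \<phi> 0)\<^esub>"
  by (simp add: cochain_zero_at maps_at_zero_value)

lemma cochain_smult_at:
  "\<phi> \<in> strings p \<Longrightarrow> (r \<odot>\<^bsub>cochains p q\<^esub> f) \<phi> = r \<odot>\<^bsub>maps_at p q \<phi>\<^esub> f \<phi>"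
  by (simp add: cochains_def)

lemma cochain_add_at:
  "\<phi> \<in> strings p \<Longrightarrow> (f \<oplus>\<^bsub>cochains p q\<^esub> g) \<phi> = f \<phi> \<oplus>\<^bsub>maps_at p q \<phi>\<^esub> g \<phi>"
  by (simp add: cochains_def)

lemma cochain_ops_value:
  assumes "\<phi> \<in> strings p" "as \<in> tuples (A (vert \<phi> p)) q"
  shows "f \<in> I \<rightarrow> carrier (cochains p q) \<Longrightarrow>
      (\<Oplus>\<^bsub>cochains p q\<^esub>i\<in>I. f i) \<phi> as = (\<Oplus>\<^bsub>A (vert \<phi> 0)\<^esub>i\<in>I. f i \<phi> as)"
    and "g \<in> carrier (cochains p q) \<Longrightarrow> ([(k::int)] \<cdot>\<^bsub>cochains p q\<^esub> g) \<phi> as = [k] \<cdot>\<^bsub>A (vert \<phi> 0)\<^esub> g \<phi> as"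
    and "g \<in> carrier (cochains p q) \<Longrightarrow> (\<ominus>\<^bsub>cochains p q\<^esub> g) \<phi> as = \<ominus>\<^bsub>A (vert \<phi> 0)\<^esub> g \<phi> as"
proof -
  note hom = cochains_group A_group[OF vert_Ob[OF assms(1) le0]] cochain_evaluation_additive[OF assms]
  show "f \<in> I \<rightarrow> carrier (cochains p q) \<Longrightarrow>
      (\<Oplus>\<^bsub>cochains p q\<^esub>i\<in>I. f i) \<phi> as = (\<Oplus>\<^bsub>A (vert \<phi> 0)\<^esub>i\<in>I. f i \<phi> as)"
    by (rule additive_finsum[OF hom])
  show "g \<in> carrier (cochains p q) \<Longrightarrow> ([(k::int)] \<cdot>\<^bsub>cochains p q\<^esub> g) \<phi> as = [k] \<cdot>\<^bsub>A (vert \<phi> 0)\<^esub> g \<phi> as"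
    by (rule additive_int_pow[OF hom])
  show "g \<in> carrier (cochains p q) \<Longrightarrow> (\<ominus>\<^bsub>cochains p q\<^esub> g) \<phi> as = \<ominus>\<^bsub>A (vert \<phi> 0)\<^esub> g \<phi> as"
    by (rule additive_a_inv[OF hom])
qed

subsection \<open>The total complex as a module\<close>

lemma Tot_carrier: "F \<in> carrier Tot \<longleftrightarrow>
    (\<forall>p q. F p q \<in> carrier (cochains p q)) \<and> finite {(p, q). F p q \<noteq> \<zero>\<^bsub>cochains p q\<^esub>}"
  by (simp add: Tot_def)

lemma Tot_at: "F \<in> carrier Tot \<Longrightarrow> F p q \<in> carrier (cochains p q)"
  by (simp add: Tot_carrier)

lemma Tot_ops: "(F \<oplus>\<^bsub>Tot\<^esub> G) p q = F p q \<oplus>\<^bsub>cochains p q\<^esub> G p q"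
  "(r \<odot>\<^bsub>Tot\<^esub> F) p q = r \<odot>\<^bsub>cochains p q\<^esub> F p q"
  "\<zero>\<^bsub>Tot\<^esub> p q = \<zero>\<^bsub>cochains p q\<^esub>"
  by (simp_all add: Tot_def)

lemma Tot_module: "module R Tot"
proof (rule module_jointly_injective[where I = UNIV and M = "\<lambda>(p, q). cochains p q"
      and ev = "\<lambda>(p, q) F. F p q"])
  note grp = abelian_groupE(1,2)[OF cochains_group] abelian_monoid.l_zero[OF abelian_group.axioms(1)[OF cochains_group]]
    module.smult_closed[OF cochains_module]
  show "F \<oplus>\<^bsub>Tot\<^esub> G \<in> carrier Tot" if "F \<in> carrier Tot" "G \<in> carrier Tot" for F G
    unfolding Tot_carrier
  proof
    show "finite {(p, q). (F \<oplus>\<^bsub>Tot\<^esub> G) p q \<noteq> \<zero>\<^bsub>cochains p q\<^esub>}"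
      by (rule finite_subset[of _ "{(p, q). F p q \<noteq> \<zero>\<^bsub>cochains p q\<^esub>} \<union> {(p, q). G p q \<noteq> \<zero>\<^bsub>cochains p q\<^esub>}"])
        (use that grp in \<open>auto simp: Tot_carrier Tot_ops\<close>)
  qed (use that grp in \<open>auto simp: Tot_carrier Tot_ops\<close>)
  show "r \<odot>\<^bsub>Tot\<^esub> F \<in> carrier Tot" if "r \<in> carrier R" "F \<in> carrier Tot" for r F
    unfolding Tot_carrier
  proof
    show "finite {(p, q). (r \<odot>\<^bsub>Tot\<^esub> F) p q \<noteq> \<zero>\<^bsub>cochains p q\<^esub>}"
      by (rule finite_subset[of _ "{(p, q). F p q \<noteq> \<zero>\<^bsub>cochains p q\<^esub>}"])
        (use that in \<open>auto simp: Tot_carrier Tot_ops module.smult_r_null[OF cochains_module]\<close>)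
  qed (use that grp in \<open>auto simp: Tot_carrier Tot_ops\<close>)
qed (auto simp: R_cring cochains_module Tot_carrier Tot_ops abelian_groupE(2)[OF cochains_group] fun_eq_iff)

lemma Tot_group: "abelian_group Tot"
  by (rule module.axioms(2)[OF Tot_module])

lemma Tot_at_additive: "additive Tot (cochains p q) (\<lambda>F. F p q)"
  by (auto simp: additive_def Tot_at Tot_ops)

lemma Tot_a_minus_at:
  "F \<in> carrier Tot \<Longrightarrow> G \<in> carrier Tot \<Longrightarrow> (F \<ominus>\<^bsub>Tot\<^esub> G) p q = F p q \<ominus>\<^bsub>cochains p q\<^esub> G p q"
  by (rule additive_a_minus[OF Tot_group cochains_group Tot_at_additive])

lemma Tot_eqI:
  "F \<in> carrier Tot \<Longrightarrow> G \<in> carrier Tot \<Longrightarrow> (\<And>p q. F p q = G p q) \<Longrightarrow> F = G"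
  by auto

subsection \<open>Pushing cochains forward along monotone maps\<close>

text \<open>
  Cofaces and codegeneracies are both instances of one functorial operation, so the cosimplicial
  identities reduce to identities between maps of natural numbers.
\<close>

definition push :: "nat \<Rightarrow> nat \<Rightarrow> (nat \<Rightarrow> nat) \<Rightarrow> nat \<Rightarrow> ('o, 'm, 'a) cochain \<Rightarrow> ('o, 'm, 'a) cochain" where
  "push p p' \<theta> q f = (\<lambda>\<phi>\<in>strings p'. \<lambda>as\<in>tuples (A (vert \<phi> p')) q.
     transport \<phi> 0 (\<theta> 0) (f (pull p \<theta> \<phi>) (map (transport \<phi> (\<theta> p) p') as)))"

lemma delta_S_comp_push: "delta_S_comp p q i = push p (Suc p) (coface i) q"
  by (simp add: delta_S_comp_def push_def fun_eq_iff)

lemma push_value: 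
  "\<phi> \<in> strings p' \<Longrightarrow> as \<in> tuples (A (vert \<phi> p')) q \<Longrightarrow>
    push p p' \<theta> q f \<phi> as = transport \<phi> 0 (\<theta> 0) (f (pull p \<theta> \<phi>) (map (transport \<phi> (\<theta> p) p') as))"
  by (simp add: push_def)

lemma push_closed:
  assumes \<theta>: "mono_on {0..p} \<theta>" "\<theta> p \<le> p'" and f: "f \<in> carrier (cochains p q)"
  shows "push p p' \<theta> q f \<in> carrier (cochains p' q)"
proof -
  have "(\<lambda>as\<in>tuples (A (vert \<phi> p')) q. transport \<phi> 0 (\<theta> 0) (f (pull p \<theta> \<phi>) (map (transport \<phi> (\<theta> p) p') as)))
     \<in> carrier (maps_at p' q \<phi>)" if "\<phi> \<in> strings p'" for \<phi>
    unfolding maps_at_def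
  proof (rule multilinear_compose[where g = "f (pull p \<theta> \<phi>)" and h = "transport \<phi> (\<theta> p) p'"
          and k = "transport \<phi> 0 (\<theta> 0)"])
    have le: "\<theta> 0 \<le> p'" using \<theta> mono_on_le[of p \<theta> 0 p] by auto
    show "module R (A (vert \<phi> p'))" using that by (simp add: A_module vert_Ob)
    show "f (pull p \<theta> \<phi>) \<in> carrier (multilinear_maps R (A (vert \<phi> (\<theta> p))) (A (vert \<phi> (\<theta> 0))) q)"
      using cochain_at[OF f pull_strings[OF that \<theta>]] pull_vert[OF that \<theta>] by (simp add: maps_at_def)
    show "linear_on R (A (vert \<phi> p')) (A (vert \<phi> (\<theta> p))) (transport \<phi> (\<theta> p) p')"
      using that \<theta> by (simp add: transport_linear)
    show "linear_on R (A (vert \<phi> (\<theta> 0))) (A (vert \<phi> 0)) (transport \<phi> 0 (\<theta> 0))"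
      using that le by (simp add: transport_linear)
  qed
  then show ?thesis by (auto simp: push_def cochains_carrier)
qed

lemma tuples_transport:
  "\<phi> \<in> strings p \<Longrightarrow> k \<le> l \<Longrightarrow> l \<le> p \<Longrightarrow> as \<in> tuples (A (vert \<phi> l)) q \<Longrightarrow>
    map (transport \<phi> k l) as \<in> tuples (A (vert \<phi> k)) q"
  by (auto intro!: tuples_map transport_closed)

lemma push_additive:
  assumes \<theta>: "mono_on {0..p} \<theta>" "\<theta> p \<le> p'"
  shows "additive (cochains p q) (cochains p' q) (push p p' \<theta> q)"
proof (rule additiveI)
  have le: "\<theta> 0 \<le> p'" using \<theta> mono_on_le[of p \<theta> 0 p] by auto
  note cl = push_closed[OF \<theta>]
  note plus = abelian_groupE(1)[OF cochains_group]
  show "push p p' \<theta> q (f \<oplus>\<^bsub>cochains p q\<^esub> g) = push p p' \<theta> q f \<oplus>\<^bsub>cochains p' q\<^esub> push p p' \<theta> q g"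
    if f: "f \<in> carrier (cochains p q)" and g: "g \<in> carrier (cochains p q)" for f g
  proof (rule cochain_eqI)
    fix \<phi> as assume \<phi>: "\<phi> \<in> strings p'" and as: "as \<in> tuples (A (vert \<phi> p')) q"
    have t: "map (transport \<phi> (\<theta> p) p') as \<in> tuples (A (vert (pull p \<theta> \<phi>) p)) q"
      using \<phi> as \<theta> by (simp add: tuples_transport pull_vert)
    note ps = pull_strings[OF \<phi> \<theta>]
    have v: "vert (pull p \<theta> \<phi>) 0 = vert \<phi> (\<theta> 0)" using pull_vert[OF \<phi> \<theta>] by simp
    note ev = additive_add[OF cochain_evaluation_additive[OF ps t]] additive_add[OF cochain_evaluation_additive[OF \<phi> as]]
      cochain_value[OF _ ps t]
    show "push p p' \<theta> q (f \<oplus>\<^bsub>cochains p q\<^esub> g) \<phi> as = (push p p' \<theta> q f \<oplus>\<^bsub>cochains p' q\<^esub> push p p' \<theta> q g) \<phi> as"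
      using f g by (simp add: ev cl push_value[OF \<phi> as])
        (simp add: v additive_add[OF transport_additive[OF \<phi> _ le]] ev(3)[unfolded v])
  qed (use f g cl plus in auto)
qed (rule push_closed[OF \<theta>])

lemma push_cong: "(\<And>k. k \<le> p \<Longrightarrow> \<theta> k = \<eta> k) \<Longrightarrow> push p p' \<theta> q f = push p p' \<eta> q f"
  using pull_cong[of p \<theta> \<eta>] by (simp add: push_def)

text \<open>Segments of the pulled-back string are segments of \<phi>, and on the input side as well
  as on the output side two consecutive transports compose to one.\<close>

lemma push_push:
  assumes \<theta>: "mono_on {0..p'} \<theta>" "\<theta> p' \<le> p''" and \<eta>: "mono_on {0..p} \<eta>" "\<eta> p \<le> p'"
    and f: "f \<in> carrier (cochains p q)"
  shows "push p' p'' \<theta> q (push p p' \<eta> q f) = push p p'' (\<lambda>k. \<theta> (\<eta> k)) q f"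
proof (rule cochain_eqI)
  have \<theta>\<eta>: "mono_on {0..p} (\<lambda>k. \<theta> (\<eta> k))" "\<theta> (\<eta> p) \<le> \<theta> p'" "\<theta> (\<eta> p) \<le> p''" 
    "\<theta> 0 \<le> \<theta> (\<eta> 0)" "\<theta> (\<eta> 0) \<le> \<theta> (\<eta> p)"
    using mono_on_compose[OF \<eta>(1) \<theta>(1) \<eta>(2)] mono_on_le[OF \<theta>(1), of "\<eta> p" p'] \<theta>(2) \<eta> 
     mono_on_le[OF \<theta>(1), of 0 "\<eta> 0"] mono_on_le[OF \<eta>(1), of 0 p] mono_on_le[OF \<theta>(1), of "\<eta> 0" "\<eta> p"]
    by auto
  show "push p' p'' \<theta> q (push p p' \<eta> q f) \<in> carrier (cochains p'' q)"
    by (intro push_closed \<theta> \<eta> f)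
  show "push p p'' (\<lambda>k. \<theta> (\<eta> k)) q f \<in> carrier (cochains p'' q)"
    by (intro push_closed \<theta>\<eta> f)
  fix \<phi> as assume \<phi>: "\<phi> \<in> strings p''" and as: "as \<in> tuples (A (vert \<phi> p'')) q"
  note ps = pull_strings[OF \<phi> \<theta>]
  note pv = pull_vert[OF \<phi> \<theta>] 
  have t: "map (transport \<phi> (\<theta> p') p'') as \<in> tuples (A (vert (pull p' \<theta> \<phi>) p')) q"
    using \<phi> as \<theta> by (simp add: tuples_transport pull_vert)
  have t2: "map (transport \<phi> (\<theta> (\<eta> p)) p'') as \<in> tuples (A (vert \<phi> (\<theta> (\<eta> p)))) q"
    using \<phi> as \<theta>\<eta> by (simp add: tuples_transport pull_vert)
  have "\<And>x. x \<in> set as \<Longrightarrow> x \<in> carrier (A (vert \<phi> p''))"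
    using as by (auto simp: tuples_def)
  then have *: "map (transport \<phi> (\<theta> (\<eta> p)) (\<theta> p')) (map (transport \<phi> (\<theta> p') p'') as) = map (transport \<phi> (\<theta> (\<eta> p)) p'') as"
    using \<theta>\<eta> \<theta> by (simp add: transport_transport[OF \<phi>])
  have f': "f (pull p (\<lambda>k. \<theta> (\<eta> k)) \<phi>) (map (transport \<phi> (\<theta> (\<eta> p)) p'') as) \<in> carrier (A (vert \<phi> (\<theta> (\<eta> 0))))"
    using cochain_value[OF f pull_strings[OF \<phi> \<theta>\<eta>(1,3)]] pull_vert[OF \<phi> \<theta>\<eta>(1,3)] t2 by simp
  show "push p' p'' \<theta> q (push p p' \<eta> q f) \<phi> as = push p p'' (\<lambda>k. \<theta> (\<eta> k)) q f \<phi> as"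
    using \<theta>\<eta> \<eta> mono_on_le[OF \<eta>(1), of 0 p]
    by (simp add: push_value[OF \<phi> as] push_value[OF ps t] pull_pull[OF \<phi> \<theta> \<eta>] pull_segment[OF \<phi> \<theta>] * 
       transport_transport[OF \<phi> _ _ _ f'] del: map_map)
qed

lemma push_ident:
  assumes f: "f \<in> carrier (cochains p q)"
  shows "push p p (\<lambda>k. k) q f = f"
proof (rule cochain_eqI)
  show "push p p (\<lambda>k. k) q f \<in> carrier (cochains p q)"
    by (intro push_closed f) (auto simp: mono_on_def)
  fix \<phi> as assume \<phi>: "\<phi> \<in> strings p" and as: "as \<in> tuples (A (vert \<phi> p)) q"
  have "map (transport \<phi> p p) as = as"
    using as \<phi> by (auto simp: tuples_def transport_refl subset_iff intro: map_idI)
  then show "push p p (\<lambda>k. k) q f \<phi> as = f \<phi> as"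
    using cochain_value[OF f \<phi> as] by (simp add: push_value[OF \<phi> as] pull_ident[OF \<phi>] transport_refl[OF \<phi>])
qed (rule f)

end

section \<open>Trees and colorings\<close>

lemma exactly_one_five:
  "exactly_one [a, b, c, d, e] \<longleftrightarrow> 
    (a \<and> \<not> b \<and> \<not> c \<and> \<not> d \<and> \<not> e) \<or> (\<not> a \<and> b \<and> \<not> c \<and> \<not> d \<and> \<not> e) \<or> (\<not> a \<and> \<not> b \<and> c \<and> \<not> d \<and> \<not> e) \<or>
    (\<not> a \<and> \<not> b \<and> \<not> c \<and> d \<and> \<not> e) \<or> (\<not> a \<and> \<not> b \<and> \<not> c \<and> \<not> d \<and> e)"
  by (cases a; cases b; cases c; cases d; cases e) (simp_all add: exactly_one_def)

text \<open>The cardinality of this set bounds the height of the subtree. It is compared with the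
  recursion argument of \<open>free_inputs\<close> and \<open>eval_at\<close> in every induction
  along the tree.\<close>

definition desc :: "tree \<Rightarrow> nat \<Rightarrow> nat set" where
  "desc T u = {v. tree_le T u v}"

locale planar_tree =
  fixes n :: nat and T :: tree
  assumes tree: "T \<in> trees n"
begin

lemma edges_subset: "edges T \<subseteq> {1..n} \<times> {1..n}"
  and no_loop: "(u, u) \<notin> edges T"
  and antisym_le: "antisym ((edges T)\<^sup>*)"
  and unique_root: "\<exists>!r. is_root n T r"
  and covering: "(u, v) \<in> edges T \<Longrightarrow> \<not> (tree_less T u t \<and> tree_less T t v)"
  using tree by (auto simp: trees_def)

lemma comparison: "u \<in> {1..n} \<Longrightarrow> v \<in> {1..n} \<Longrightarrow> exactly_one
    [u = v, tree_less T u v, tree_less T v u, planar_less T u v, planar_less T v u]"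
  using tree unfolding trees_def by blast

lemma planar_above: "u \<in> {1..n} \<Longrightarrow> v \<in> {1..n} \<Longrightarrow> u' \<in> {1..n} \<Longrightarrow> v' \<in> {1..n} \<Longrightarrow>
    planar_less T u v \<Longrightarrow> tree_le T u u' \<Longrightarrow> tree_le T v v' \<Longrightarrow> planar_less T u' v'"
  using tree unfolding trees_def by blast

lemma edge_vertices: "(u, v) \<in> edges T \<Longrightarrow> u \<in> {1..n} \<and> v \<in> {1..n}"
  using edges_subset by auto

lemma edge_less: "(u, v) \<in> edges T \<Longrightarrow> tree_less T u v"
  using no_loop by (auto simp: tree_less_def tree_le_def)

lemma le_refl: "tree_le T u u"
  by (simp add: tree_le_def)

lemma le_trans: "tree_le T u v \<Longrightarrow> tree_le T v w \<Longrightarrow> tree_le T u w"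
  by (auto simp: tree_le_def)

lemma le_antisym: "tree_le T u v \<Longrightarrow> tree_le T v u \<Longrightarrow> u = v"
  using antisym_le by (auto simp: tree_le_def antisym_def)

lemma le_vertices: "tree_le T u v \<Longrightarrow> u \<in> {1..n} \<longleftrightarrow> v \<in> {1..n}"
  unfolding tree_le_def by (induction rule: rtrancl_induct) (use edge_vertices in auto)

lemma desc_subset: "u \<in> {1..n} \<Longrightarrow> desc T u \<subseteq> {1..n}"
  using le_vertices[of u] unfolding desc_def by blast

lemma desc_self: "u \<in> desc T u"
  by (simp add: desc_def le_refl)

lemma desc_finite: "u \<in> {1..n} \<Longrightarrow> finite (desc T u)"
  using desc_subset finite_subset by blast

text \<open>If two children of \<open>u\<close> were vertically comparable, the lower one would lie
  strictly between \<open>u\<close> and the other, which an edge forbids. Only the planar order is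
  left.\<close>

lemma siblings_planar:
  assumes "(u, b) \<in> edges T" "(u, c) \<in> edges T" "b \<noteq> c"
  shows "planar_less T b c \<or> planar_less T c b"
proof -
  have "\<not> tree_less T b c" "\<not> tree_less T c b"
    using covering edge_less assms by blast+
  then show ?thesis
    using comparison[of b c] edge_vertices[OF assms(1)] edge_vertices[OF assms(2)] assms(3)
    by (auto simp: exactly_one_five)
qed

text \<open>A common descendant would have to lie strictly to the planar side of itself.\<close>

lemma siblings_disjoint:
  assumes "(u, b) \<in> edges T" "(u, c) \<in> edges T" "b \<noteq> c"
  shows "desc T b \<inter> desc T c = {}"
proof -
  have bc: "b \<in> {1..n}" "c \<in> {1..n}" using assms edge_vertices by auto
  { fix v assume v: "tree_le T b v" "tree_le T c v"
    then have "v \<in> {1..n}" using le_vertices bc by blast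
    then have "planar_less T v v"
      using siblings_planar[OF assms] planar_above bc v by blast
    then have False by (simp add: planar_less_def) }
  then show ?thesis by (auto simp: desc_def)
qed

lemma desc_unfold: "desc T u = insert u (\<Union>b\<in>{b. (u, b) \<in> edges T}. desc T b)"
  unfolding desc_def tree_le_def by (auto elim: converse_rtranclE)

lemma not_desc_child: "(u, b) \<in> edges T \<Longrightarrow> u \<notin> desc T b"
  using edge_less le_antisym by (auto simp: desc_def tree_less_def)

lemma desc_child_subset: "(u, b) \<in> edges T \<Longrightarrow> desc T b \<subset> desc T u"
  using not_desc_child desc_unfold[of u] by blast

lemma desc_child_card: "(u, b) \<in> edges T \<Longrightarrow> card (desc T b) < card (desc T u)"
  using desc_child_subset desc_finite edge_vertices by (meson psubset_card_mono)

lemma root_is_root: "is_root n T (tree_root n T)"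
  unfolding tree_root_def using unique_root by (rule theI')

lemma root_vertex: "tree_root n T \<in> {1..n}"
  using root_is_root by (simp add: is_root_def)

text \<open>A vertex other than the unique minimal one has something strictly below it; the number
  of vertices below decreases, so the descent ends at the root.\<close>

lemma root_below: "v \<in> {1..n} \<Longrightarrow> tree_le T (tree_root n T) v"
proof (induction "card {u. tree_le T u v}" arbitrary: v rule: less_induct)
  case less
  show ?case
  proof (cases "is_root n T v")
    case True
    then show ?thesis using root_is_root unique_root le_refl by blast
  next
    case False
    then obtain w where w: "w \<in> {1..n}" "tree_less T w v"
      using less.prems by (auto simp: is_root_def)
    have "v \<notin> {u. tree_le T u w}" "v \<in> {u. tree_le T u v}" "{u. tree_le T u w} \<subseteq> {u. tree_le T u v}"
      using w le_trans le_antisym le_refl by (auto simp: tree_less_def)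
    then have "{u. tree_le T u w} \<subset> {u. tree_le T u v}" by blast
    moreover have "finite {u. tree_le T u v}"
      by (rule finite_subset[of _ "{1..n}"]) (use less.prems le_vertices in auto)
    ultimately have "card {u. tree_le T u w} < card {u. tree_le T u v}"
      by (intro psubset_card_mono)
    from less.hyps[OF this w(1)] show ?thesis
      using w le_trans by (auto simp: tree_less_def)
  qed
qed

lemma desc_root: "desc T (tree_root n T) = {1..n}"
  using desc_subset[OF root_vertex] root_below by (auto simp: desc_def)

end

section \<open>Free inputs of a colored tree\<close>

locale colored_tree = planar_tree +
  fixes q :: "nat \<Rightarrow> nat" and I :: "nat \<times> nat \<Rightarrow> nat"
  assumes clr: "I \<in> clr_tree T q"
begin

lemma clr_range: "(u, v) \<in> edges T \<Longrightarrow> 1 \<le> I (u, v) \<and> I (u, v) \<le> q u"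
  using clr by (auto simp: clr_tree_def)

text \<open>Siblings are comparable in the planar order and a coloring is strictly increasing on
  them. This justifies the definite description in \<open>input_child\<close>.\<close>

lemma clr_inj: "(u, b) \<in> edges T \<Longrightarrow> (u, c) \<in> edges T \<Longrightarrow> I (u, b) = I (u, c) \<Longrightarrow> b = c"
  using siblings_planar[of u b c] clr unfolding clr_tree_def
  by (metis (mono_tags, lifting) mem_Collect_eq nat_neq_iff)

lemma input_child_Some: "input_child T I u i = Some b \<longleftrightarrow> (u, b) \<in> edges T \<and> I (u, b) = i"
proof -
  have "(THE b. (u, b) \<in> edges T \<and> I (u, b) = i) = c" if "(u, c) \<in> edges T" "I (u, c) = i" for c
    using that clr_inj by (intro the_equality) auto
  then show ?thesis by (auto simp: input_child_def)
qed

lemma free_inputs_desc: "(v, i) \<in> set (free_inputs T I q k u) \<Longrightarrow> v \<in> desc T u"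
proof (induction k arbitrary: u)
  case (Suc k)
  then obtain j where j: "(v, i) \<in> set (case input_child T I u j of None \<Rightarrow> [(u, j)] | Some b \<Rightarrow> free_inputs T I q k b)"
    by auto
  show ?case
  proof (cases "input_child T I u j")
    case None
    then show ?thesis using j desc_self by auto
  next
    case (Some b)
    then have "v \<in> desc T b" using j Suc.IH by simp
    moreover have "(u, b) \<in> edges T" using Some by (simp add: input_child_Some)
    ultimately show ?thesis using desc_unfold[of u] by blast
  qed
qed simp

abbreviation inputs_at :: "nat \<Rightarrow> nat \<Rightarrow> nat \<Rightarrow> (nat \<times> nat) list" where
  "inputs_at k u j \<equiv> case input_child T I u j of None \<Rightarrow> [(u, j)] | Some b \<Rightarrow> free_inputs T I q k b"

text \<open>Different inputs of \<open>u\<close> lead to \<open>u\<close> itself or to the disjoint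
  subtrees of different children, and a free input remembers its vertex.\<close>

lemma inputs_at_disjoint: "i \<noteq> j \<Longrightarrow> set (inputs_at k u i) \<inter> set (inputs_at k u j) = {}"
proof -
  assume ij: "i \<noteq> j"
  have *: "fst x \<in> desc T b" if "x \<in> set (free_inputs T I q k b)" for x b
    using free_inputs_desc[of "fst x" "snd x"] that by simp
  have u: "u \<notin> desc T b" if "input_child T I u i = Some b" for b i
    using that not_desc_child by (simp add: input_child_Some)
  show ?thesis
  proof (cases "input_child T I u i"; cases "input_child T I u j")
    fix b assume "input_child T I u i = None" "input_child T I u j = Some b"
    then show ?thesis using *[of "(u, i)" b] u[of j b] by auto
  next
    fix b assume "input_child T I u i = Some b" "input_child T I u j = None"
    then show ?thesis using *[of "(u, j)" b] u[of i b] by auto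
  next
    fix b c assume b: "input_child T I u i = Some b" "input_child T I u j = Some c"
    then have "desc T b \<inter> desc T c = {}"
      using ij by (intro siblings_disjoint[of u]) (auto simp: input_child_Some)
    then show ?thesis using b *[of _ b] *[of _ c] by (simp add: disjoint_iff) blast
  qed (use ij in simp)
qed

text \<open>Distinctness is what makes the assignment of arguments to inputs by \<open>zip\<close>
  well defined.\<close>

lemma free_inputs_distinct: "distinct (free_inputs T I q k u)"
proof (induction k arbitrary: u)
  case (Suc k)
  have "distinct (inputs_at k u j)" for j
    using Suc.IH by (auto split: option.split)
  moreover have "distinct (concat (map f is))"
    if "distinct is" "\<And>j. distinct (f j)" "\<And>i j. i \<noteq> j \<Longrightarrow> set (f i) \<inter> set (f j) = {}"
    for "is" :: "nat list" and f :: "nat \<Rightarrow> (nat \<times> nat) list"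
    using that(1)
  proof (induction "is")
    case (Cons a "is")
    then have "\<forall>i\<in>set is. set (f a) \<inter> set (f i) = {}"
      using that(3) by (metis distinct.simps(2))
    with Cons show ?case using that(2) by auto
  qed simp
  ultimately show ?case using inputs_at_disjoint by simp
qed simp

text \<open>\<open>g b\<close> stands for the excess over 1 of the inputs contributed by the subtree
  of \<open>b\<close>. Injectivity of the coloring reindexes the occupied inputs by the
  children.\<close>

lemma sum_children_inputs:
  fixes g :: "nat \<Rightarrow> int"
  shows "(\<Sum>i\<in>{1..q u}. case input_child T I u i of None \<Rightarrow> 1 | Some b \<Rightarrow> 1 + g b) =
    int (q u) + (\<Sum>b\<in>{b. (u, b) \<in> edges T}. g b)"
proof -
  have fin: "finite {b. (u, b) \<in> edges T}"
    by (rule finite_subset[of _ "{1..n}"]) (use edge_vertices in auto)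
  have "(\<Sum>i\<in>{1..q u}. case input_child T I u i of None \<Rightarrow> 1 | Some b \<Rightarrow> 1 + g b) =
    (\<Sum>i\<in>{1..q u}. 1 + (case input_child T I u i of None \<Rightarrow> 0 | Some b \<Rightarrow> g b))"
    by (intro sum.cong) (auto split: option.split)
  also have "\<dots> = int (q u) + (\<Sum>i\<in>{1..q u}. case input_child T I u i of None \<Rightarrow> 0 | Some b \<Rightarrow> g b)"
    by (simp add: sum.distrib)
  also have "(\<Sum>i\<in>{1..q u}. case input_child T I u i of None \<Rightarrow> 0 | Some b \<Rightarrow> g b) =
     (\<Sum>i\<in>(\<lambda>b. I (u, b)) ` {b. (u, b) \<in> edges T}. case input_child T I u i of None \<Rightarrow> 0 | Some b \<Rightarrow> g b)"
    using clr_range by (intro sum.mono_neutral_right) (auto split: option.split simp: input_child_Some)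
  also have "\<dots> = (\<Sum>b\<in>{b. (u, b) \<in> edges T}. case input_child T I u (I (u, b)) of None \<Rightarrow> 0 | Some b \<Rightarrow> g b)"
    using clr_inj by (subst sum.reindex) (auto simp: inj_on_def)
  also have "\<dots> = (\<Sum>b\<in>{b. (u, b) \<in> edges T}. g b)"
  proof (intro sum.cong refl)
    fix b assume "b \<in> {b. (u, b) \<in> edges T}"
    then have "input_child T I u (I (u, b)) = Some b" by (simp add: input_child_Some)
    then show "(case input_child T I u (I (u, b)) of None \<Rightarrow> 0 | Some b \<Rightarrow> g b) = g b" by simp
  qed
  finally show ?thesis .
qed

text \<open>The number of inputs minus one is additive over the vertices, because attaching a
  subtree uses up one input of its parent. The count is in the integers since a vertex without
  inputs contributes -1.\<close>

lemma length_free_inputs: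
  assumes "u \<in> {1..n}" "card (desc T u) \<le> k"
  shows "int (length (free_inputs T I q k u)) = 1 + (\<Sum>v\<in>desc T u. int (q v) - 1)"
  using assms
proof (induction k arbitrary: u)
  \<comment> \<open>A vertex is its own descendant, so the bound 0 is contradictory.\<close>
  case 0
  then show ?case using desc_self[of u] desc_finite[of u] by auto
next
  case (Suc k)
  have ch: "b \<in> {1..n} \<and> card (desc T b) \<le> k" if "(u, b) \<in> edges T" for b
    using Suc.prems desc_child_card[OF that] edge_vertices[OF that] by auto
  have fin: "finite {b. (u, b) \<in> edges T}"
    by (rule finite_subset[of _ "{1..n}"]) (use edge_vertices in auto)
  have "int (length (free_inputs T I q (Suc k) u)) = (\<Sum>i\<in>{1..q u}. int (length (inputs_at k u i)))"
    by (simp add: length_concat comp_def interv_sum_list_conv_sum_set_nat atLeastLessThanSuc_atLeastAtMost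
        del: upt_Suc)
  also have "\<dots> = (\<Sum>i\<in>{1..q u}. case input_child T I u i of None \<Rightarrow> 1
       | Some b \<Rightarrow> 1 + (\<Sum>v\<in>desc T b. int (q v) - 1))"
  proof (intro sum.cong refl)
    fix i
    show "int (length (inputs_at k u i)) = (case input_child T I u i of None \<Rightarrow> 1
       | Some b \<Rightarrow> 1 + (\<Sum>v\<in>desc T b. int (q v) - 1))"
    proof (cases "input_child T I u i")
      case (Some b)
      then have "(u, b) \<in> edges T" by (simp add: input_child_Some)
      then show ?thesis using Suc.IH[of b] ch[of b] Some by simp
    qed simp
  qed
  also have "\<dots> = int (q u) + (\<Sum>b\<in>{b. (u, b) \<in> edges T}. \<Sum>v\<in>desc T b. int (q v) - 1)"
    by (rule sum_children_inputs)
  also have "(\<Sum>b\<in>{b. (u, b) \<in> edges T}. \<Sum>v\<in>desc T b. int (q v) - 1) =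
     (\<Sum>v\<in>(\<Union>b\<in>{b. (u, b) \<in> edges T}. desc T b). int (q v) - 1)"
    using fin desc_finite edge_vertices siblings_disjoint
    by (intro sum.UNION_disjoint[symmetric]) auto
  also have "int (q u) + \<dots> = 1 + (\<Sum>v\<in>desc T u. int (q v) - 1)"
  proof -
    have "finite (\<Union>b\<in>{b. (u, b) \<in> edges T}. desc T b)" "u \<notin> (\<Union>b\<in>{b. (u, b) \<in> edges T}. desc T b)"
      using fin desc_finite edge_vertices not_desc_child by auto
    then show ?thesis by (simp add: desc_unfold[of u])
  qed
  finally show ?case .
qed

lemma length_root_inputs:
  "length (free_inputs T I q n (tree_root n T)) + n = 1 + (\<Sum>a=1..n. q a)"
proof -
  have "int (length (free_inputs T I q n (tree_root n T))) = 1 + (\<Sum>v\<in>{1..n}. int (q v) - 1)"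
    using length_free_inputs[OF root_vertex] by (simp add: desc_root)
  then have "int (length (free_inputs T I q n (tree_root n T)) + n) = int (1 + (\<Sum>a=1..n. q a))"
    by (simp add: sum_subtractf)
  then show ?thesis by (simp only: of_nat_eq_iff)
qed

end

subsection \<open>Colorings of words\<close>

lemma clr_wordD:
  assumes "\<zeta> \<in> clr_word n W p"
  obtains \<pi> p' where "p' + word_deg n W = (\<Sum>a=1..n. p a)"
    "\<And>a. a \<in> {1..n} \<Longrightarrow> \<zeta> a \<in> {0..p a} \<rightarrow> {0..p'}"
    "\<And>a. a \<in> {1..n} \<Longrightarrow> strict_mono_on {0..p a} (\<zeta> a)"
    "(\<Union>a\<in>{1..n}. \<zeta> a ` {0..p a}) = {0..p'}" "occurrence_map n W p \<zeta> \<pi>"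
proof -
  let ?p' = "(\<Sum>a=1..n. p a) - word_deg n W"
  have *: "\<not> (\<Sum>a=1..n. p a) < word_deg n W"
    using assms by (auto simp: clr_word_def split: if_splits)
  then have "\<zeta> \<in> (\<Pi>\<^sub>E a\<in>{1..n}. {0..p a} \<rightarrow>\<^sub>E {0..?p'})"
    "(\<forall>a\<in>{1..n}. strict_mono_on {0..p a} (\<zeta> a))" "(\<Union>a\<in>{1..n}. \<zeta> a ` {0..p a}) = {0..?p'}"
    "\<exists>\<pi>. occurrence_map n W p \<zeta> \<pi>"
    using assms by (simp_all add: clr_word_def Let_def)
  with * that[of ?p'] show ?thesis
    by (force simp: PiE_iff)
qed

locale colored_word =
  fixes n :: nat and W :: "nat list" and p :: "nat \<Rightarrow> nat" and \<zeta> \<pi> :: "nat \<Rightarrow> nat \<Rightarrow> nat" and p' :: nat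
  assumes word: "W \<in> F2S n"
    and \<zeta>_range: "a \<in> {1..n} \<Longrightarrow> \<zeta> a \<in> {0..p a} \<rightarrow> {0..p'}"
    and \<zeta>_mono: "a \<in> {1..n} \<Longrightarrow> strict_mono_on {0..p a} (\<zeta> a)"
    and \<zeta>_surj: "(\<Union>a\<in>{1..n}. \<zeta> a ` {0..p a}) = {0..p'}"
    and occ: "occurrence_map n W p \<zeta> \<pi>"
begin

abbreviation fib :: "nat \<Rightarrow> nat set" where
  "fib i \<equiv> fibre p \<zeta> \<pi> (W ! i) i"

lemma letter: "i < length W \<Longrightarrow> W ! i \<in> {1..n}"
  using word by (auto simp: F2S_def)

lemma occurrence: "a \<in> {1..n} \<Longrightarrow> k \<le> p a \<Longrightarrow> \<pi> a k < length W \<and> W ! (\<pi> a k) = a"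
proof -
  assume a: "a \<in> {1..n}" and k: "k \<le> p a"
  have "\<pi> a ` {0..p a} = occurrences W a" using occ a by (simp add: occurrence_map_def)
  moreover have "\<pi> a k \<in> \<pi> a ` {0..p a}" using k by simp
  ultimately show ?thesis by (simp add: occurrences_def)
qed

lemma fib_interval: 
  assumes "i < length W"
  shows "finite (fib i)" "fib i \<noteq> {}" "\<exists>l u. fib i = {l..u}"
proof -
  have "i \<in> \<pi> (W ! i) ` {0..p (W ! i)}"
    using occ letter[OF assms] assms by (auto simp: occurrence_map_def occurrences_def)
  then show "fib i \<noteq> {}" by (auto simp: fibre_def)
  show "finite (fib i)" by (simp add: fibre_def)
  show "\<exists>l u. fib i = {l..u}"
    using occ letter[OF assms] assms by (auto simp: occurrence_map_def occurrences_def)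
qed

lemma fib_linked: "Suc i < length W \<Longrightarrow> Max (fib i) = Min (fib (Suc i))"
  using occ by (simp add: occurrence_map_def)

text \<open>Neighbouring fibres share an end point and every fibre is nonempty, so the ends increase
  along the word. The inequality is weak because a fibre may be a single point.\<close>

lemma fib_mono: "i < j \<Longrightarrow> j < length W \<Longrightarrow> Max (fib i) \<le> Min (fib j)"
proof (induction j)
  case (Suc j)
  show ?case
  proof (cases "i = j")
    case True
    then show ?thesis using fib_linked Suc.prems by simp
  next
    case False
    then have "Max (fib i) \<le> Min (fib j)" using Suc by simp
    also have "\<dots> \<le> Max (fib j)" using fib_interval[of j] Suc.prems by (intro Min_le_iff[THEN iffD2]) auto
    also have "\<dots> = Min (fib (Suc j))" using fib_linked Suc.prems by simp
    finally show ?thesis .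
  qed
qed simp

lemma \<zeta>_in_fib: "a \<in> {1..n} \<Longrightarrow> k \<le> p a \<Longrightarrow> \<zeta> a k \<in> fib (\<pi> a k)"
  using occurrence[of a k] by (auto simp: fibre_def)

lemma \<zeta>_le:
  assumes "a \<in> {1..n}" "b \<in> {1..n}" "k \<le> p a" "l \<le> p b" "\<pi> a k < \<pi> b l"
  shows "\<zeta> a k \<le> \<zeta> b l"
proof -
  have "\<zeta> a k \<le> Max (fib (\<pi> a k))" "Min (fib (\<pi> b l)) \<le> \<zeta> b l"
    using Max_ge[OF fib_interval(1) \<zeta>_in_fib[OF assms(1,3)]] Min_le[OF fib_interval(1) \<zeta>_in_fib[OF assms(2,4)]]
      occurrence[OF assms(1,3)] occurrence[OF assms(2,4)] by blast+
  moreover have "Max (fib (\<pi> a k)) \<le> Min (fib (\<pi> b l))"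
    using assms occurrence by (intro fib_mono) auto
  ultimately show ?thesis by linarith
qed

text \<open>
  The fibres form a chain of intervals covering \<open>[p']\<close>, each starting where the previous one ends,
  so every step of \<open>[p']\<close> is a step of a single vertex.
\<close>

lemma step_in_fibre:
  assumes "k < p'"
  obtains i where "i < length W" "k \<in> fib i" "Suc k \<in> fib i"
proof -
  have ex: "\<exists>i<length W. j \<in> fib i" if "j \<le> p'" for j
  proof -
    have "j \<in> (\<Union>a\<in>{1..n}. \<zeta> a ` {0..p a})" unfolding \<zeta>_surj using that by simp
    then obtain a l where "a \<in> {1..n}" "l \<le> p a" "j = \<zeta> a l" by auto
    then show ?thesis using \<zeta>_in_fib[of a l] occurrence[of a l] by auto
  qed
  \<comment> \<open>The first fibre that contains \<open>Suc k\<close> also contains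
    \<open>k\<close>: otherwise \<open>Suc k\<close> would be its left end, and so the right end of
    the fibre before it.\<close>
  define i where "i = (LEAST i. i < length W \<and> Suc k \<in> fib i)"
  have i: "i < length W" "Suc k \<in> fib i"
    using LeastI_ex[OF ex[of "Suc k"]] assms by (auto simp: i_def)
  have least: "Suc k \<notin> fib j" if "j < i" for j
    using not_less_Least[of j "\<lambda>i. i < length W \<and> Suc k \<in> fib i"] that i(1) by (auto simp: i_def)
  show thesis
  proof (cases "k \<in> fib i")
    case True
    then show ?thesis using that i by blast
  next
    case False
    have "Min (fib i) = Suc k"
    proof -
      obtain l u where lu: "fib i = {l..u}" using fib_interval[OF i(1)] by blast
      have "l = Suc k" using i(2) False unfolding lu by auto
      with lu i(2) fib_interval(1)[OF i(1)] show ?thesis by (intro Min_eqI) simp_all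
    qed
    \<comment> \<open>Some fibre contains \<open>k\<close>. It cannot come after fibre
      \<open>i\<close>, so \<open>i\<close> is not the first position and has a predecessor.\<close>
    obtain j where j: "j < length W" "k \<in> fib j" using ex[of k] assms by auto
    have kj: "Min (fib j) \<le> k" "k \<le> Max (fib j)" using j fib_interval[of j] by auto
    have "\<not> i < j"
    proof
      assume "i < j"
      then have "Max (fib i) \<le> Min (fib j)" using fib_mono j by blast
      then have "Suc k \<le> k" using kj i fib_interval[of i] Max_ge[of "fib i" "Suc k"] by linarith
      then show False by simp
    qed
    then have "j < i" using j False by (cases "i = j") auto
    then obtain i' where i': "i = Suc i'" by (cases i) auto
    then have "Max (fib i') = Suc k" using fib_linked i \<open>Min (fib i) = Suc k\<close> by simp
    then have "Suc k \<in> fib i'" using Max_in[of "fib i'"] fib_interval[of i'] i i' by auto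
    then show ?thesis using least i' by blast
  qed
qed

text \<open>Both points lie in the image of one strictly increasing map, where neighbouring values
  have neighbouring arguments. Consequently each morphism of a string reappears unchanged in the
  string fed to some vertex.\<close>

lemma consecutive:
  assumes "k < p'"
  obtains a l where "a \<in> {1..n}" "l < p a" "\<zeta> a l = k" "\<zeta> a (Suc l) = Suc k"
proof -
  obtain i where i: "i < length W" "k \<in> fib i" "Suc k \<in> fib i"
    using step_in_fibre[OF assms] .
  let ?a = "W ! i"
  obtain l m where l: "l \<le> p ?a" "m \<le> p ?a" "\<zeta> ?a l = k" "\<zeta> ?a m = Suc k"
    using i(2,3) by (auto simp: fibre_def)
  have a: "?a \<in> {1..n}" using letter i by blast
  note mono = strict_mono_onD[OF \<zeta>_mono[OF a]]
  have "l < m"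
  proof (rule ccontr)
    assume "\<not> l < m"
    then have "\<zeta> ?a m \<le> \<zeta> ?a l" using mono[of m l] l by (cases "l = m") auto
    then show False using l by simp
  qed
  moreover have "\<not> Suc l < m"
  proof
    assume "Suc l < m"
    then have "\<zeta> ?a l < \<zeta> ?a (Suc l)" "\<zeta> ?a (Suc l) < \<zeta> ?a m"
      using l mono[of l "Suc l"] mono[of "Suc l" m] by auto
    then show False using l by simp
  qed
  ultimately have "m = Suc l" by simp
  then show ?thesis using that[of ?a l] a l by simp
qed

end

text \<open>In a quilt no occurrence of a child precedes one of its parent, and order in the word
  becomes order of values. Without this the transport along an edge would have no segment to
  use.\<close>

lemma colored_word_edge:
  assumes "colored_word n W p \<zeta> \<pi> p'" "(W, T) \<in> quilts n" "(a, b) \<in> edges T"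
  shows "\<zeta> a (p a) \<le> \<zeta> b 0"
proof -
  interpret colored_word n W p \<zeta> \<pi> p' by fact
  interpret planar_tree n T using assms(2) by unfold_locales (auto simp: quilts_def)
  have ab: "a \<in> {1..n}" "b \<in> {1..n}" "a \<noteq> b" "tree_less T a b"
    using edge_vertices[OF assms(3)] no_loop assms(3) edge_less by auto
  have o: "\<pi> a (p a) < length W" "W ! \<pi> a (p a) = a" "\<pi> b 0 < length W" "W ! \<pi> b 0 = b"
    using occurrence ab by auto
  have "\<not> \<pi> b 0 < \<pi> a (p a)" "\<pi> b 0 \<noteq> \<pi> a (p a)"
    using assms(2) o ab by (force simp: quilts_def)+
  then show ?thesis using ab by (intro \<zeta>_le) auto
qed

section \<open>Evaluation of colorings\<close>

text \<open>Of the coloring of the word only monotonicity, the bound by \<open>p'\<close> and the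
  inequality along edges are retained; the composite along the tree does not see the fibres.\<close>

locale evaluation = algebra_diagram C R A Am + colored_tree n T q I
  for C :: "('o, 'm, 'c) category_scheme" and R :: "('k, 'r) ring_scheme"
    and A :: "'o \<Rightarrow> ('k, 'a, 'e) module_scheme" and Am :: "'m \<Rightarrow> 'a \<Rightarrow> 'a"
    and n :: nat and T :: tree and q :: "nat \<Rightarrow> nat" and I :: "nat \<times> nat \<Rightarrow> nat" +
  fixes p :: "nat \<Rightarrow> nat" and \<zeta> :: "nat \<Rightarrow> nat \<Rightarrow> nat" and f :: "nat \<Rightarrow> ('o, 'm, 'a) cochain"
    and p' :: nat and \<phi> :: "('o, 'm) nerve_string"
  assumes \<phi>: "\<phi> \<in> strings p'"
    and \<zeta>_mono: "a \<in> {1..n} \<Longrightarrow> mono_on {0..p a} (\<zeta> a)"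
    and \<zeta>_le: "a \<in> {1..n} \<Longrightarrow> \<zeta> a (p a) \<le> p'"
    and \<zeta>_edge: "(a, b) \<in> edges T \<Longrightarrow> \<zeta> a (p a) \<le> \<zeta> b 0"
    and f: "a \<in> {1..n} \<Longrightarrow> f a \<in> carrier (cochains (p a) (q a))"
begin

abbreviation ev :: "nat \<Rightarrow> (nat \<times> nat \<Rightarrow> 'a) \<Rightarrow> nat \<Rightarrow> 'a" where
  "ev k env u \<equiv> eval_at T I p q \<zeta> f \<phi> env k u"

definition arg :: "nat \<Rightarrow> (nat \<times> nat \<Rightarrow> 'a) \<Rightarrow> nat \<Rightarrow> nat \<Rightarrow> 'a" where
  "arg k env u i = (case input_child T I u i of
            None \<Rightarrow> transport \<phi> (\<zeta> u (p u)) p' (env (u, i))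
          | Some b \<Rightarrow> transport \<phi> (\<zeta> u (p u)) (\<zeta> b 0) (ev k env b))"

definition args :: "nat \<Rightarrow> (nat \<times> nat \<Rightarrow> 'a) \<Rightarrow> nat \<Rightarrow> 'a list" where
  "args k env u = map (arg k env u) [1..<Suc (q u)]"

lemma ev_Suc: "ev (Suc k) env u = f u (pull (p u) (\<zeta> u) \<phi>) (args k env u)"
  by (simp add: args_def arg_def[abs_def] stringsD(2)[OF \<phi>] del: upt_Suc cong: option.case_cong)

lemma length_args: "length (args k env u) = q u"
  by (simp add: args_def)

lemma nth_args: "i < q u \<Longrightarrow> args k env u ! i = arg k env u (Suc i)"
  by (simp add: args_def del: upt_Suc)

abbreviation out :: "nat \<Rightarrow> ('k, 'a, 'e) module_scheme" where
  "out u \<equiv> A (vert \<phi> (\<zeta> u 0))"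

abbreviation inp :: "nat \<Rightarrow> ('k, 'a, 'e) module_scheme" where
  "inp u \<equiv> A (vert \<phi> (\<zeta> u (p u)))"

lemma \<zeta>_0_le: "u \<in> {1..n} \<Longrightarrow> \<zeta> u 0 \<le> p'"
  using mono_on_le[OF \<zeta>_mono, of u 0 "p u"] \<zeta>_le[of u] by auto

lemma vertex_map: 
  assumes "u \<in> {1..n}"
  shows "f u (pull (p u) (\<zeta> u) \<phi>) \<in> carrier (multilinear_maps R (inp u) (out u) (q u))"
  using cochain_at[OF f[OF assms] pull_strings[OF \<phi> \<zeta>_mono[OF assms] \<zeta>_le[OF assms]]]
    pull_vert[OF \<phi> \<zeta>_mono[OF assms] \<zeta>_le[OF assms]]
  by (simp add: maps_at_def)

lemma inp_module: "u \<in> {1..n} \<Longrightarrow> module R (inp u)"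
  by (intro A_module vert_Ob[OF \<phi>] \<zeta>_le)

lemma out_module: "u \<in> {1..n} \<Longrightarrow> module R (out u)"
  by (intro A_module vert_Ob[OF \<phi>] \<zeta>_0_le)

lemma child_bound:
  assumes "u \<in> {1..n}" "card (desc T u) \<le> Suc k" "input_child T I u i = Some b"
  shows "b \<in> {1..n}" "card (desc T b) \<le> k" "(u, b) \<in> edges T"
  using assms desc_child_card[of u b] edge_vertices[of u b] by (auto simp: input_child_Some)

lemma inputs_Suc: "set (free_inputs T I q (Suc k) u) = (\<Union>j\<in>{1..q u}. set (inputs_at k u j))"
  by (simp add: atLeastLessThanSuc_atLeastAtMost del: upt_Suc)

lemma inputs_mem:
  "1 \<le> j \<Longrightarrow> j \<le> q u \<Longrightarrow> x \<in> set (inputs_at k u j) \<Longrightarrow> x \<in> set (free_inputs T I q (Suc k) u)"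
  unfolding inputs_Suc by (rule UN_I[of j]) simp_all

declare free_inputs.simps(2) [simp del]
declare eval_at.simps(2) [simp del]

text \<open>The argument tuple is recorded next to the value because the later inductions work with
  one multilinear map at this tuple.\<close>

lemma ev_closed:
  assumes "u \<in> {1..n}" "card (desc T u) \<le> k"
    "\<And>x. x \<in> set (free_inputs T I q k u) \<Longrightarrow> env x \<in> carrier (A (vert \<phi> p'))"
  shows "ev k env u \<in> carrier (out u)"
    and "k = Suc l \<Longrightarrow> args l env u \<in> tuples (inp u) (q u)"
proof -
  have "ev k env u \<in> carrier (out u) \<and> (\<forall>l. k = Suc l \<longrightarrow> args l env u \<in> tuples (inp u) (q u))"
    using assms
  proof (induction k arbitrary: u)
    case 0
    then show ?case using desc_self[of u] desc_finite[of u] by auto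
  next
    case (Suc k)
    have "arg k env u i \<in> carrier (inp u)" if i: "1 \<le> i" "i \<le> q u" for i
    proof (cases "input_child T I u i")
      case None
      then have "env (u, i) \<in> carrier (A (vert \<phi> p'))"
        using inputs_mem[OF i, of "(u, i)" k] Suc.prems(3) by simp
      then show ?thesis using None Suc.prems(1) \<zeta>_le by (simp add: arg_def transport_closed[OF \<phi>])
    next
      case (Some b)
      note b = child_bound[OF Suc.prems(1,2) Some]
      have "ev k env b \<in> carrier (out b)"
        using inputs_mem[OF i, of _ k] Suc.prems(3) Suc.IH[OF b(1,2)] Some by simp
      then show ?thesis using Some \<zeta>_edge[OF b(3)] \<zeta>_0_le[OF b(1)] by (simp add: arg_def transport_closed[OF \<phi>])
    qed
    then have "args k env u \<in> tuples (inp u) (q u)"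
      by (auto simp: tuples_def length_args) (auto simp: args_def simp del: upt_Suc)
    then show ?case using vertex_map[OF Suc.prems(1)] by (auto simp: ev_Suc multilinear_closed)
  qed
  then show "ev k env u \<in> carrier (out u)" "k = Suc l \<Longrightarrow> args l env u \<in> tuples (inp u) (q u)"
    by auto
qed

lemma ev_cong:
  assumes "\<And>x. x \<in> set (free_inputs T I q k u) \<Longrightarrow> env x = env' x"
  shows "ev k env u = ev k env' u"
  using assms
proof (induction k arbitrary: u)
  case (Suc k)
  have "arg k env u i = arg k env' u i" if i: "1 \<le> i" "i \<le> q u" for i
    using inputs_mem[OF i, of _ k] Suc.prems Suc.IH
    by (cases "input_child T I u i") (simp_all add: arg_def)
  then have "args k env u = args k env' u"
    by (simp add: args_def del: upt_Suc)
  then show ?case by (simp add: ev_Suc)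
qed simp

text \<open>At \<open>v\<close> the multilinear map itself is zero. From there the zero travels down
  to \<open>u\<close>: transports preserve it, and a multilinear map with a zero argument
  vanishes.\<close>

lemma ev_zero:
  assumes "u \<in> {1..n}" "card (desc T u) \<le> k"
    "\<And>x. x \<in> set (free_inputs T I q k u) \<Longrightarrow> env x \<in> carrier (A (vert \<phi> p'))"
    "v \<in> desc T u" "f v (pull (p v) (\<zeta> v) \<phi>) = \<zero>\<^bsub>maps_at (p v) (q v) (pull (p v) (\<zeta> v) \<phi>)\<^esub>"
  shows "ev k env u = \<zero>\<^bsub>out u\<^esub>"
  using assms(1-4)
proof (induction k arbitrary: u)
  case 0
  then show ?case using desc_self[of u] desc_finite[of u] by auto
next
  case (Suc k)
  have args: "args k env u \<in> tuples (inp u) (q u)"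
    by (rule ev_closed(2)[OF Suc.prems(1-3) refl])
  note u = Suc.prems(1)
  show ?case
  proof (cases "v = u")
    case True
    then show ?thesis
      using args pull_vert[OF \<phi> \<zeta>_mono[OF u] \<zeta>_le[OF u]] assms(5)
      by (simp add: ev_Suc maps_at_zero_value)
  next
    case False
    then obtain b where ub: "(u, b) \<in> edges T" and vb: "v \<in> desc T b"
      using Suc.prems(4) desc_unfold[of u] by blast
    let ?i = "I (u, b)"
    have i: "1 \<le> ?i" "?i \<le> q u" and ib: "input_child T I u ?i = Some b"
      using clr_range[OF ub] ub by (auto simp: input_child_Some)
    note b = child_bound[OF u Suc.prems(2) ib]
    have "ev k env b = \<zero>\<^bsub>out b\<^esub>"
    proof (rule Suc.IH[OF b(1,2) _ vb])
      fix x assume "x \<in> set (free_inputs T I q k b)"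
      then show "env x \<in> carrier (A (vert \<phi> p'))"
        using Suc.prems(3) inputs_mem[OF i, of x k] ib by simp
    qed
    then have "args k env u ! (?i - 1) = \<zero>\<^bsub>inp u\<^esub>"
      using i ib additive_zero[OF _ _ transport_additive[OF \<phi> \<zeta>_edge[OF ub] \<zeta>_0_le[OF b(1)]]]
        module.axioms(2)[OF inp_module[OF u]] module.axioms(2)[OF out_module[OF b(1)]]
      by (simp add: nth_args arg_def)
    then show ?thesis
      using multilinear_zero_arg[OF inp_module[OF u] out_module[OF u] vertex_map[OF u] args, of "?i - 1"] i
      by (simp add: ev_Suc)
  qed
qed

text \<open>The free input \<open>x\<close> belongs to exactly one of the arguments at
  \<open>u\<close>, by disjointness. That argument depends linearly on it, the others stay fixed,
  and the map at \<open>u\<close> is linear in each slot.\<close>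

lemma ev_linear:
  assumes "u \<in> {1..n}" "card (desc T u) \<le> k"
    "\<And>x. x \<in> set (free_inputs T I q k u) \<Longrightarrow> env x \<in> carrier (A (vert \<phi> p'))"
    "x \<in> set (free_inputs T I q k u)"
  shows "linear_on R (A (vert \<phi> p')) (out u) (\<lambda>a. ev k (env(x := a)) u)"
  using assms
proof (induction k arbitrary: u)
  case (Suc k)
  note u = Suc.prems(1)
  obtain j where j: "1 \<le> j" "j \<le> q u" "x \<in> set (inputs_at k u j)"
    using Suc.prems(4) unfolding inputs_Suc by auto
  define h where "h a = arg k (env(x := a)) u j" for a
  have "linear_on R (A (vert \<phi> p')) (inp u) h"
  proof (cases "input_child T I u j")
    case None
    then have "h = transport \<phi> (\<zeta> u (p u)) p'"
      using j by (auto simp: h_def arg_def)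
    then show ?thesis using \<zeta>_le[OF u] by (simp add: transport_linear[OF \<phi>])
  next
    case (Some b)
    note b = child_bound[OF u Suc.prems(2) Some]
    have "linear_on R (A (vert \<phi> p')) (out b) (\<lambda>a. ev k (env(x := a)) b)"
    proof (rule Suc.IH[OF b(1,2)])
      show "env y \<in> carrier (A (vert \<phi> p'))" if "y \<in> set (free_inputs T I q k b)" for y
        using that Suc.prems(3) inputs_mem[OF j(1,2), of y k] Some by simp
      show "x \<in> set (free_inputs T I q k b)" using j Some by simp
    qed
    then have "linear_on R (A (vert \<phi> p')) (inp u) (\<lambda>a. transport \<phi> (\<zeta> u (p u)) (\<zeta> b 0) (ev k (env(x := a)) b))"
      by (rule linear_on_compose) (rule transport_linear[OF \<phi> \<zeta>_edge[OF b(3)] \<zeta>_0_le[OF b(1)]])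
    moreover have "h = (\<lambda>a. transport \<phi> (\<zeta> u (p u)) (\<zeta> b 0) (ev k (env(x := a)) b))"
      by (simp add: h_def arg_def Some fun_eq_iff)
    ultimately show ?thesis by simp
  qed
  moreover have args: "args k (env(x := a)) u = (args k env u)[j - 1 := h a]" for a
  proof (rule nth_equalityI)
    fix i assume "i < length (args k (env(x := a)) u)"
    then have i: "i < q u" by (simp add: length_args)
    show "args k (env(x := a)) u ! i = (args k env u)[j - 1 := h a] ! i"
    proof (cases "i = j - 1")
      case True
      then show ?thesis using i j by (simp add: nth_args h_def length_args)
    next
      case False
      then have "x \<notin> set (inputs_at k u (Suc i))"
      proof -
        have "j \<noteq> Suc i" using False by auto
        then have "set (inputs_at k u j) \<inter> set (inputs_at k u (Suc i)) = {}" by (rule inputs_at_disjoint)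
        then show ?thesis using j(3) by blast
      qed
      then have "arg k (env(x := a)) u (Suc i) = arg k env u (Suc i)"
        unfolding arg_def by (auto split: option.splits intro!: arg_cong[of _ _ "Am _"] ev_cong)
      then show ?thesis using False i by (simp add: nth_args length_args)
    qed
  qed (simp add: length_args)
  moreover have "linear_on R (inp u) (out u)
      (\<lambda>b. f u (pull (p u) (\<zeta> u) \<phi>) ((args k env u)[j - 1 := b]))"
    using j by (intro multilinear_linear[OF vertex_map[OF u] ev_closed(2)[OF Suc.prems(1-3)]]) auto
  ultimately have "linear_on R (A (vert \<phi> p')) (out u)
      (\<lambda>a. f u (pull (p u) (\<zeta> u) \<phi>) ((args k env u)[j - 1 := h a]))"
    using linear_on_compose by blast
  then show ?case unfolding ev_Suc args .
qed simp

abbreviation root :: nat where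
  "root \<equiv> tree_root n T"

abbreviation inputs :: "(nat \<times> nat) list" where
  "inputs \<equiv> free_inputs T I q n root"

definition env_of :: "'a list \<Rightarrow> nat \<times> nat \<Rightarrow> 'a" where
  "env_of as x = the (map_of (zip inputs as) x)"

lemma coloring_action_ev:
  "coloring_action n T p q \<zeta> I f \<phi> as = transport \<phi> 0 (\<zeta> root 0) (ev n (env_of as) root)"
  by (simp add: coloring_action_def env_of_def[abs_def] Let_def)

lemma root_card: "card (desc T root) \<le> n"
  by (simp add: desc_root)

lemma env_of_closed:
  assumes "as \<in> tuples (A (vert \<phi> p')) (length inputs)" "x \<in> set inputs"
  shows "env_of as x \<in> carrier (A (vert \<phi> p'))"
proof -
  obtain i where "i < length inputs" "x = inputs ! i"
    using assms(2) by (auto simp: in_set_conv_nth)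
  then have "map_of (zip inputs as) x = Some (as ! i)" "as ! i \<in> set as"
    using assms(1) free_inputs_distinct by (auto simp: map_of_zip_nth tuples_def)
  then show ?thesis using assms(1) by (auto simp: env_of_def tuples_def)
qed

lemma env_of_update:
  assumes "length as = length inputs" "i < length inputs" "x \<in> set inputs"
  shows "env_of (as[i := a]) x = ((env_of as)(inputs ! i := a)) x"
proof -
  obtain j where "j < length inputs" "x = inputs ! j"
    using assms(3) by (auto simp: in_set_conv_nth)
  then show ?thesis
    using assms free_inputs_distinct[of n root]
    by (auto simp: env_of_def map_of_zip_nth nth_eq_iff_index_eq)
qed

lemma coloring_action_multilinear:
  "(\<lambda>as\<in>tuples (A (vert \<phi> p')) (length inputs). coloring_action n T p q \<zeta> I f \<phi> as) \<in> carrier (maps_at p' (length inputs) \<phi>)"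
  unfolding maps_at_def multilinear_iff
proof (intro conjI ballI allI impI)
  note r = root_vertex root_card
  interpret M: module R "A (vert \<phi> p')" by (simp add: A_module vert_Ob[OF \<phi>])
  have lin: "linear_on R (out root) (A (vert \<phi> 0)) (transport \<phi> 0 (\<zeta> root 0))"
    using transport_linear[OF \<phi>, of 0 "\<zeta> root 0"] \<zeta>_0_le[OF root_vertex] by simp
  show "(\<lambda>as\<in>tuples (A (vert \<phi> p')) (length inputs). coloring_action n T p q \<zeta> I f \<phi> as)
      \<in> tuples (A (vert \<phi> p')) (length inputs) \<rightarrow>\<^sub>E carrier (A (vert \<phi> 0))"
    using ev_closed(1)[OF r] env_of_closed additive_closed[OF linear_on_additive[OF lin]]
    by (auto simp: coloring_action_ev)
  fix as i assume as: "as \<in> tuples (A (vert \<phi> p')) (length inputs)" and i: "i < length inputs"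
  have "linear_on R (A (vert \<phi> p')) (out root) (\<lambda>a. ev n ((env_of as)(inputs ! i := a)) root)"
    using ev_linear[OF r env_of_closed[OF as]] i by auto
  from linear_on_compose[OF this lin]
  have "linear_on R (A (vert \<phi> p')) (A (vert \<phi> 0)) 
     (\<lambda>a. transport \<phi> 0 (\<zeta> root 0) (ev n ((env_of as)(inputs ! i := a)) root))" .
  moreover have "ev n ((env_of as)(inputs ! i := a)) root = ev n (env_of (as[i := a])) root" for a
    using as i by (intro ev_cong) (simp add: env_of_update tuples_def)
  ultimately show "linear_on R (A (vert \<phi> p')) (A (vert \<phi> 0))
      (\<lambda>a. (\<lambda>as\<in>tuples (A (vert \<phi> p')) (length inputs). coloring_action n T p q \<zeta> I f \<phi> as) (as[i := a]))"
    by (elim linear_on_cong[OF M.module_axioms]) (simp add: coloring_action_ev tuples_update[OF as])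
qed

lemma coloring_action_zero:
  assumes "v \<in> {1..n}" "f v (pull (p v) (\<zeta> v) \<phi>) = \<zero>\<^bsub>maps_at (p v) (q v) (pull (p v) (\<zeta> v) \<phi>)\<^esub>"
    "as \<in> tuples (A (vert \<phi> p')) (length inputs)"
  shows "coloring_action n T p q \<zeta> I f \<phi> as = \<zero>\<^bsub>A (vert \<phi> 0)\<^esub>"
proof -
  have "ev n (env_of as) root = \<zero>\<^bsub>out root\<^esub>"
    using assms by (intro ev_zero root_vertex root_card env_of_closed) (simp_all add: desc_root)
  moreover have "additive (out root) (A (vert \<phi> 0)) (transport \<phi> 0 (\<zeta> root 0))"
    using transport_additive[OF \<phi>, of 0 "\<zeta> root 0"] \<zeta>_0_le[OF root_vertex] by simp
  ultimately show ?thesis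
    using additive_zero[of "out root" "A (vert \<phi> 0)"] \<zeta>_0_le[OF root_vertex]
    by (simp add: coloring_action_ev A_group vert_Ob[OF \<phi>])
qed

end

section \<open>The action of quilts on cochains\<close>

text \<open>The pointwise sum is the evaluation of a sum formed in the module of multilinear maps,
  where closure is automatic.\<close>

lemma multilinear_finsum:
  fixes R (structure)
  assumes M: "module R M" and N: "module R N"
    and g: "\<And>i. i \<in> I \<Longrightarrow> (\<lambda>as\<in>tuples M q. g i as) \<in> carrier (multilinear_maps R M N q)"
  shows "(\<lambda>as\<in>tuples M q. \<Oplus>\<^bsub>N\<^esub>i\<in>I. g i as) \<in> carrier (multilinear_maps R M N q)"
proof -
  let ?P = "multilinear_maps R M N q"
  interpret P: module R ?P by (rule module_multilinear_maps[OF M N])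
  interpret N: module R N by fact
  let ?s = "\<Oplus>\<^bsub>?P\<^esub>i\<in>I. (\<lambda>as\<in>tuples M q. g i as)"
  have s: "?s \<in> carrier ?P" using g by (intro P.finsum_in_carrier)
  have "?s as = (\<Oplus>\<^bsub>N\<^esub>i\<in>I. g i as)" if as: "as \<in> tuples M q" for as
  proof -
    have "?s as = (\<Oplus>\<^bsub>N\<^esub>i\<in>I. (\<lambda>as\<in>tuples M q. g i as) as)"
      using g by (intro additive_finsum[OF P.abelian_group_axioms N.abelian_group_axioms
            multilinear_evaluation_additive[OF as]]) auto
    also have "\<dots> = (\<Oplus>\<^bsub>N\<^esub>i\<in>I. g i as)"
      using that by simp
    finally show ?thesis .
  qed
  then have "(\<lambda>as\<in>tuples M q. \<Oplus>\<^bsub>N\<^esub>i\<in>I. g i as) = restrict ?s (tuples M q)"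
    by (simp add: fun_eq_iff)
  also have "restrict ?s (tuples M q) = ?s"
    using s by (intro PiE_restrict[where B = "\<lambda>_. carrier N"]) (simp add: multilinear_iff)
  finally show ?thesis using s by simp
qed

lemma multilinear_int_pow:
  fixes R (structure)
  assumes M: "module R M" and N: "module R N"
    and g: "(\<lambda>as\<in>tuples M q. g as) \<in> carrier (multilinear_maps R M N q)"
  shows "(\<lambda>as\<in>tuples M q. [(k::int)] \<cdot>\<^bsub>N\<^esub> g as) \<in> carrier (multilinear_maps R M N q)"
proof -
  let ?P = "multilinear_maps R M N q"
  interpret P: module R ?P by (rule module_multilinear_maps[OF M N])
  interpret N: module R N by fact
  let ?s = "[k] \<cdot>\<^bsub>?P\<^esub> (\<lambda>as\<in>tuples M q. g as)"
  have s: "?s \<in> carrier ?P" using g by (rule P.int_pow_closed)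
  have "?s as = [k] \<cdot>\<^bsub>N\<^esub> g as" if as: "as \<in> tuples M q" for as
    using additive_int_pow[OF P.abelian_group_axioms N.abelian_group_axioms
            multilinear_evaluation_additive[OF as] g, of k] as by simp
  then have "(\<lambda>as\<in>tuples M q. [k] \<cdot>\<^bsub>N\<^esub> g as) = restrict ?s (tuples M q)"
    by (simp add: fun_eq_iff)
  also have "restrict ?s (tuples M q) = ?s"
    using s by (intro PiE_restrict[where B = "\<lambda>_. carrier N"]) (simp add: multilinear_iff)
  finally show ?thesis using s by simp
qed

context algebra_diagram
begin

lemma evaluation_of_quilt:
  assumes Q: "(W, T) \<in> quilts n" and \<zeta>: "\<zeta> \<in> clr_word n W p" and I: "I \<in> clr_tree T q"
    and f: "\<And>a. a \<in> {1..n} \<Longrightarrow> f a \<in> carrier (cochains (p a) (q a))"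
    and p': "p' + word_deg n W = (\<Sum>a=1..n. p a)" and \<phi>: "\<phi> \<in> strings p'"
  shows "evaluation C R A Am n T q I p \<zeta> f p' \<phi>"
    and "\<exists>\<pi>. colored_word n W p \<zeta> \<pi> p'"
proof -
  obtain \<pi> p'' where *: "p'' + word_deg n W = (\<Sum>a=1..n. p a)"
    "\<And>a. a \<in> {1..n} \<Longrightarrow> \<zeta> a \<in> {0..p a} \<rightarrow> {0..p''}"
    "\<And>a. a \<in> {1..n} \<Longrightarrow> strict_mono_on {0..p a} (\<zeta> a)"
    "(\<Union>a\<in>{1..n}. \<zeta> a ` {0..p a}) = {0..p''}" "occurrence_map n W p \<zeta> \<pi>"
    by (rule clr_wordD[OF \<zeta>]) (rule that)
  have "p'' = p'" using *(1) p' by simp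
  then have cw: "colored_word n W p \<zeta> \<pi> p'"
    using * Q by unfold_locales (auto simp: quilts_def)
  then show "\<exists>\<pi>. colored_word n W p \<zeta> \<pi> p'" by blast
  show "evaluation C R A Am n T q I p \<zeta> f p' \<phi>"
  proof unfold_locales
    show "T \<in> trees n" using Q by (simp add: quilts_def)
    show "mono_on {0..p a} (\<zeta> a)" if "a \<in> {1..n}" for a
      using *(3)[OF that] by (rule strict_mono_on_imp_mono_on)
    show "\<zeta> a (p a) \<le> p'" if "a \<in> {1..n}" for a
      using *(2)[OF that] \<open>p'' = p'\<close> by auto
  qed (use I \<phi> f colored_word_edge[OF cw Q] in auto)
qed

text \<open>Every integer multiple of a multilinear map is multilinear, whatever the sign is; what
  remains is that the number of free inputs agrees with \<open>q'\<close>.\<close>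

lemma quilt_op_closed:
  assumes Q: "(W, T) \<in> quilts n" 
    and f: "\<And>a. a \<in> {1..n} \<Longrightarrow> f a \<in> carrier (cochains (p a) (q a))"
    and p': "p' + word_deg n W = (\<Sum>a=1..n. p a)" and q': "q' + n = 1 + (\<Sum>a=1..n. q a)"
  shows "quilt_op n (W, T) p q f \<in> carrier (cochains p' q')"
proof -
  have pq: "(\<Sum>a=1..n. p a) - word_deg n W = p'" "1 + (\<Sum>a=1..n. q a) - n = q'"
    using p' q' by auto
  have "(\<lambda>as\<in>tuples (A (vert \<phi> p')) q'.
        \<Oplus>\<^bsub>A (vert \<phi> 0)\<^esub>\<zeta>\<in>clr_word n W p. \<Oplus>\<^bsub>A (vert \<phi> 0)\<^esub>I\<in>clr_tree T q.
          [coloring_sign n (W, T) p q \<zeta> I] \<cdot>\<^bsub>A (vert \<phi> 0)\<^esub> coloring_action n T p q \<zeta> I f \<phi> as) \<in> carrier (maps_at p' q' \<phi>)"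
    if \<phi>: "\<phi> \<in> strings p'" for \<phi>
    unfolding maps_at_def
  proof (intro multilinear_finsum multilinear_int_pow)
    fix \<zeta> I assume \<zeta>: "\<zeta> \<in> clr_word n W p" and I: "I \<in> clr_tree T q"
    interpret evaluation C R A Am n T q I p \<zeta> f p' \<phi>
      using Q \<zeta> I f p' \<phi> by (rule evaluation_of_quilt)
    have "length inputs = q'" using length_root_inputs q' by simp
    then show "(\<lambda>as\<in>tuples (A (vert \<phi> p')) q'. coloring_action n T p q \<zeta> I f \<phi> as)
        \<in> carrier (multilinear_maps R (A (vert \<phi> p')) (A (vert \<phi> 0)) q')"
      using coloring_action_multilinear by (simp add: maps_at_def)
  qed (simp_all add: A_module vert_Ob[OF \<phi>])
  then show ?thesis
    unfolding quilt_op_def Let_def fst_conv snd_conv pq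
    by (auto simp: cochains_carrier)
qed

text \<open>The vanishing vertex may depend on the coloring, and vanishing is tested only at the
  string fed to it. In this form the lemma covers both a factor that is zero and a string containing
  an identity.\<close>

lemma quilt_op_zero_at:
  assumes Q: "(W, T) \<in> quilts n" 
    and f: "\<And>a. a \<in> {1..n} \<Longrightarrow> f a \<in> carrier (cochains (p a) (q a))"
    and p': "p' + word_deg n W = (\<Sum>a=1..n. p a)" and q': "q' + n = 1 + (\<Sum>a=1..n. q a)"
    and \<phi>: "\<phi> \<in> strings p'"
    and vanish: "\<And>\<zeta> I. \<zeta> \<in> clr_word n W p \<Longrightarrow> I \<in> clr_tree T q \<Longrightarrow>
        \<exists>v\<in>{1..n}. f v (pull (p v) (\<zeta> v) \<phi>) = \<zero>\<^bsub>maps_at (p v) (q v) (pull (p v) (\<zeta> v) \<phi>)\<^esub>"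
  shows "quilt_op n (W, T) p q f \<phi> = \<zero>\<^bsub>maps_at p' q' \<phi>\<^esub>"
proof -
  have pq: "(\<Sum>a=1..n. p a) - word_deg n W = p'" "1 + (\<Sum>a=1..n. q a) - n = q'"
    using p' q' by auto
  interpret X: abelian_group "A (vert \<phi> 0)" by (simp add: A_group vert_Ob[OF \<phi>])
  have "coloring_action n T p q \<zeta> I f \<phi> as = \<zero>\<^bsub>A (vert \<phi> 0)\<^esub>"
    if \<zeta>: "\<zeta> \<in> clr_word n W p" and I: "I \<in> clr_tree T q" and as: "as \<in> tuples (A (vert \<phi> p')) q'" for \<zeta> I as
  proof -
    interpret evaluation C R A Am n T q I p \<zeta> f p' \<phi>
      using Q \<zeta> I f p' \<phi> by (rule evaluation_of_quilt)
    have "length inputs = q'" using length_root_inputs q' by simp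
    then show ?thesis using vanish[OF \<zeta> I] coloring_action_zero as by auto
  qed
  then have "(\<Oplus>\<^bsub>A (vert \<phi> 0)\<^esub>\<zeta>\<in>clr_word n W p. \<Oplus>\<^bsub>A (vert \<phi> 0)\<^esub>I\<in>clr_tree T q.
          [coloring_sign n (W, T) p q \<zeta> I] \<cdot>\<^bsub>A (vert \<phi> 0)\<^esub> coloring_action n T p q \<zeta> I f \<phi> as) = \<zero>\<^bsub>A (vert \<phi> 0)\<^esub>"
    if "as \<in> tuples (A (vert \<phi> p')) q'" for as
    using that by (intro X.finsum_eq_zero) (simp add: X.int_pow_zero)
  then show ?thesis
    unfolding quilt_op_def Let_def fst_conv snd_conv pq
    using \<phi> by (simp add: maps_at_def multilinear_maps_def cong: restrict_cong)
qed

lemma quilt_op_zero: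
  assumes Q: "(W, T) \<in> quilts n" 
    and f: "\<And>a. a \<in> {1..n} \<Longrightarrow> f a \<in> carrier (cochains (p a) (q a))"
    and p': "p' + word_deg n W = (\<Sum>a=1..n. p a)" and q': "q' + n = 1 + (\<Sum>a=1..n. q a)"
    and v: "v \<in> {1..n}" "f v = \<zero>\<^bsub>cochains (p v) (q v)\<^esub>"
  shows "quilt_op n (W, T) p q f = \<zero>\<^bsub>cochains p' q'\<^esub>"
proof -
  have "quilt_op n (W, T) p q f \<phi> = \<zero>\<^bsub>maps_at p' q' \<phi>\<^esub>" if \<phi>: "\<phi> \<in> strings p'" for \<phi>
  proof (rule quilt_op_zero_at[OF Q f p' q' \<phi>])
    fix \<zeta> I assume "\<zeta> \<in> clr_word n W p" "I \<in> clr_tree T q"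
    then interpret evaluation C R A Am n T q I p \<zeta> f p' \<phi>
      using Q f p' \<phi> by (intro evaluation_of_quilt)
    show "\<exists>v\<in>{1..n}. f v (pull (p v) (\<zeta> v) \<phi>) = \<zero>\<^bsub>maps_at (p v) (q v) (pull (p v) (\<zeta> v) \<phi>)\<^esub>"
      using v pull_strings[OF \<phi> \<zeta>_mono \<zeta>_le] by (intro bexI[of _ v]) (simp_all add: cochain_zero_at)
  qed auto
  moreover have "quilt_op n (W, T) p q f \<in> carrier (cochains p' q')"
    using Q f p' q' by (rule quilt_op_closed)
  ultimately show ?thesis
    by (intro cochain_eqI[of _ p' q'] abelian_groupE(2)[OF cochains_group]) (simp_all add: cochain_zero_at)
qed

end

section \<open>Cosimplicial abelian groups\<close>

definition alt :: "('a, 'd) ring_scheme \<Rightarrow> nat \<Rightarrow> 'a \<Rightarrow> 'a" where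
  "alt G i x = [((-1 :: int) ^ i)] \<cdot>\<^bsub>G\<^esub> x"

lemma additive_alt:
  assumes "abelian_group M" "abelian_group N" "additive M N h" "x \<in> carrier M"
  shows "h (alt M i x) = alt N i (h x)"
  unfolding alt_def by (rule additive_int_pow[OF assms])

context abelian_group
begin

lemma alt_closed: "x \<in> carrier G \<Longrightarrow> alt G i x \<in> carrier G"
  by (simp add: alt_def int_pow_closed)

lemma alt_eq: "x \<in> carrier G \<Longrightarrow> alt G i x = (if even i then x else \<ominus> x)"
  by (simp add: alt_def sign_int_pow)

lemma alt_zero: "alt G i \<zero> = \<zero>"
  by (simp add: alt_def int_pow_zero)

lemma alt_alt: "x \<in> carrier G \<Longrightarrow> alt G i (alt G j x) = alt G (i + j) x"
  by (simp add: alt_eq minus_minus)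

lemma alt_Suc: "x \<in> carrier G \<Longrightarrow> alt G (Suc i) x = \<ominus> alt G i x"
  by (simp add: alt_eq minus_minus)

lemma alt_additive: "additive G G (alt G i)"
  by (rule additiveI) (simp_all add: alt_closed alt_eq minus_add)

lemma alt_cancel: "x \<in> carrier G \<Longrightarrow> alt G i x \<oplus> alt G (Suc i) x = \<zero>"
  by (simp add: alt_Suc alt_closed r_neg)

lemma finsum_a_inv:
  assumes "f \<in> I \<rightarrow> carrier G"
  shows "(\<Oplus>i\<in>I. \<ominus> f i) = \<ominus> (\<Oplus>i\<in>I. f i)"
proof -
  have "additive G G (\<lambda>x. \<ominus> x)" by (rule additiveI) (simp_all add: minus_add)
  then show ?thesis
    using additive_finsum[OF abelian_group_axioms abelian_group_axioms _ assms] by metis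
qed

text \<open>\<open>b\<close> is a sign-reversing matching of \<open>Y\<close> with its image; the
  double sum of a squared differential is of this form.\<close>

lemma finsum_cancel_pairs:
  assumes "finite Y" "inj_on b Y" "b ` Y \<inter> Y = {}" "t \<in> Y \<rightarrow> carrier G"
    and "\<And>y. y \<in> Y \<Longrightarrow> t (b y) = \<ominus> t y"
  shows "finsum G t (Y \<union> b ` Y) = \<zero>"
proof -
  have tc: "\<And>y. y \<in> Y \<Longrightarrow> t y \<in> carrier G" using assms(4) by auto
  have tb: "t \<in> b ` Y \<rightarrow> carrier G" using assms(5) tc by auto
  have "finsum G t (Y \<union> b ` Y) = finsum G t Y \<oplus> finsum G t (b ` Y)"
    using assms tb by (intro finsum_Un_disjoint) auto
  also have "finsum G t (b ` Y) = (\<Oplus>y\<in>Y. t (b y))"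
    using tb assms(2) by (rule finsum_reindex)
  also have "\<dots> = (\<Oplus>y\<in>Y. \<ominus> t y)"
    using assms(5) tc by (intro finsum_cong') auto
  also have "\<dots> = \<ominus> finsum G t Y" using assms(4) by (rule finsum_a_inv)
  finally show ?thesis using assms(4) by (simp add: r_neg)
qed

lemma finsum_Sigma:
  assumes "finite I" "finite J" "\<And>i j. i \<in> I \<Longrightarrow> j \<in> J \<Longrightarrow> t i j \<in> carrier G"
  shows "(\<Oplus>i\<in>I. \<Oplus>j\<in>J. t i j) = (\<Oplus>x\<in>I \<times> J. t (fst x) (snd x))"
  using assms(1,3)
proof (induction I)
  case (insert a I)
  have "insert a I \<times> J = Pair a ` J \<union> I \<times> J" by auto
  moreover have "(\<Oplus>x\<in>Pair a ` J. t (fst x) (snd x)) = (\<Oplus>j\<in>J. t a j)"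
    using insert.prems by (subst finsum_reindex) (auto simp: inj_on_def)
  ultimately have "(\<Oplus>x\<in>insert a I \<times> J. t (fst x) (snd x)) = (\<Oplus>j\<in>J. t a j) \<oplus> (\<Oplus>x\<in>I \<times> J. t (fst x) (snd x))"
    using insert assms(2) by (subst (1) \<open>insert a I \<times> J = _\<close>, subst finsum_Un_disjoint) auto
  then show ?case using insert assms(2) by (simp add: Pi_def)
qed simp

lemma finsum_subset_support:
  assumes "finite I" "J \<subseteq> I" "\<And>i. i \<in> I - J \<Longrightarrow> f i = \<zero>" "\<And>i. i \<in> J \<Longrightarrow> f i \<in> carrier G"
  shows "finsum G f I = finsum G f J"
proof -
  have "f i \<in> carrier G" if "i \<in> I" for i using assms(3,4)[of i] that by (cases "i \<in> J") auto
  then show ?thesis using assms by (intro add.finprod_mono_neutral_cong_right) auto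
qed

text \<open>This is the shape of s_j applied to an alternating sum of cofaces in which only the j-th
  and the next one survive: the two equal terms carry opposite signs.\<close>

lemma finsum_alt_pair:
  assumes "finite I" "j \<in> I" "Suc j \<in> I" "x \<in> carrier G" "\<And>i. i \<in> I \<Longrightarrow> f i = (if i = j \<or> i = Suc j then x else \<zero>)"
  shows "(\<Oplus>i\<in>I. alt G i (f i)) = \<zero>"
proof -
  have "(\<Oplus>i\<in>I. alt G i (f i)) = (\<Oplus>i\<in>{j, Suc j}. alt G i (f i))"
    using assms by (intro finsum_subset_support) (auto simp: alt_zero alt_closed)
  also have "\<dots> = alt G j x \<oplus> alt G (Suc j) x"
    using assms by (simp add: alt_closed)
  finally show ?thesis using assms(4) by (simp add: alt_cancel)
qed

end

text \<open>Codegeneracies are split off into a later locale because the Hochschild direction, for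
  algebras without unit, is an instance of this one only.\<close>

locale precosimplicial =
  fixes G :: "nat \<Rightarrow> ('x, 'y) ring_scheme" and d :: "nat \<Rightarrow> nat \<Rightarrow> 'x \<Rightarrow> 'x"
  assumes group: "abelian_group (G p)"
    and d_additive: "i \<le> Suc p \<Longrightarrow> additive (G p) (G (Suc p)) (d p i)"
    and d_d: "i < j \<Longrightarrow> j \<le> Suc (Suc p) \<Longrightarrow> x \<in> carrier (G p) \<Longrightarrow>
      d (Suc p) j (d p i x) = d (Suc p) i (d p (j - 1) x)"
begin

definition D :: "nat \<Rightarrow> 'x \<Rightarrow> 'x" where
  "D p x = (\<Oplus>\<^bsub>G (Suc p)\<^esub>i\<in>{0..Suc p}. alt (G (Suc p)) i (d p i x))"

lemma d_closed: "i \<le> Suc p \<Longrightarrow> x \<in> carrier (G p) \<Longrightarrow> d p i x \<in> carrier (G (Suc p))"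
  by (rule additive_closed[OF d_additive])

lemmas alt_closed' = abelian_group.alt_closed[OF group]

lemma D_closed: "x \<in> carrier (G p) \<Longrightarrow> D p x \<in> carrier (G (Suc p))"
  unfolding D_def by (intro abelian_group.finsum_in_carrier[OF group] alt_closed' d_closed) auto

lemma D_additive: "additive (G p) (G (Suc p)) (D p)"
proof (rule additiveI)
  interpret G: abelian_group "G (Suc p)" by (rule group)
  fix x y assume x: "x \<in> carrier (G p)" and y: "y \<in> carrier (G p)"
  have "D p (x \<oplus>\<^bsub>G p\<^esub> y) = (\<Oplus>\<^bsub>G (Suc p)\<^esub>i\<in>{0..Suc p}. alt (G (Suc p)) i (d p i x) \<oplus>\<^bsub>G (Suc p)\<^esub> alt (G (Suc p)) i (d p i y))"
    unfolding D_def using x y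
    by (intro G.finsum_cong') (auto simp: additive_add[OF d_additive] additive_add[OF G.alt_additive] d_closed alt_closed')
  also have "\<dots> = D p x \<oplus>\<^bsub>G (Suc p)\<^esub> D p y"
    unfolding D_def using x y by (intro G.finsum_addf) (auto simp: d_closed alt_closed')
  finally show "D p (x \<oplus>\<^bsub>G p\<^esub> y) = D p x \<oplus>\<^bsub>G (Suc p)\<^esub> D p y" .
qed (rule D_closed)

lemma D_D:
  assumes x: "x \<in> carrier (G p)"
  shows "D (Suc p) (D p x) = \<zero>\<^bsub>G (Suc (Suc p))\<^esub>"
proof -
  let ?H = "G (Suc (Suc p))"
  interpret H: abelian_group ?H by (rule group)
  define t where "t = (\<lambda>(j, i). alt ?H (j + i) (d (Suc p) j (d p i x)))"
  have t: "t (j, i) \<in> carrier ?H" if "j \<le> Suc (Suc p)" "i \<le> Suc p" for i j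
    using that x by (simp add: t_def alt_closed' d_closed)
  have "alt ?H j (d (Suc p) j (D p x)) = (\<Oplus>\<^bsub>?H\<^esub>i\<in>{0..Suc p}. t (j, i))" if j: "j \<le> Suc (Suc p)" for j
  proof -
    have "d (Suc p) j (D p x) = (\<Oplus>\<^bsub>?H\<^esub>i\<in>{0..Suc p}. d (Suc p) j (alt (G (Suc p)) i (d p i x)))"
      unfolding D_def using x
      by (intro additive_finsum[OF group group d_additive[OF j]]) (auto simp: alt_closed' d_closed)
    also have "\<dots> = (\<Oplus>\<^bsub>?H\<^esub>i\<in>{0..Suc p}. alt ?H i (d (Suc p) j (d p i x)))"
      using x j by (intro H.finsum_cong') (auto simp: additive_alt[OF group group d_additive[OF j]] d_closed alt_closed')
    also have "alt ?H j \<dots> = (\<Oplus>\<^bsub>?H\<^esub>i\<in>{0..Suc p}. alt ?H j (alt ?H i (d (Suc p) j (d p i x))))"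
      using x j by (intro additive_finsum[OF group group H.alt_additive]) (auto simp: alt_closed' d_closed)
    also have "\<dots> = (\<Oplus>\<^bsub>?H\<^esub>i\<in>{0..Suc p}. t (j, i))"
      using x j by (intro H.finsum_cong') (auto simp: t_def H.alt_alt alt_closed' d_closed)
    finally show ?thesis .
  qed
  then have "D (Suc p) (D p x) = (\<Oplus>\<^bsub>?H\<^esub>j\<in>{0..Suc (Suc p)}. \<Oplus>\<^bsub>?H\<^esub>i\<in>{0..Suc p}. t (j, i))"
    unfolding D_def[of "Suc p"] using t by (intro H.finsum_cong') (auto intro!: H.finsum_in_carrier)
  also have "\<dots> = (\<Oplus>\<^bsub>?H\<^esub>x\<in>{0..Suc (Suc p)} \<times> {0..Suc p}. t (fst x, snd x))"
    using t by (intro H.finsum_Sigma) auto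
  also have "\<dots> = finsum ?H t ({0..Suc (Suc p)} \<times> {0..Suc p})" by simp
  \<comment> \<open>The index (j, i) with j \<le> i is matched with (i + 1, j). The coface identity
    makes the two double cofaces equal, and the sums of indices differ by one.\<close>
  also have "{0..Suc (Suc p)} \<times> {0..Suc p} = {(j::nat, i).  j \<le> i \<and> i \<le> Suc p} \<union> (\<lambda>(j, i). (Suc i, j)) ` {(j, i). j \<le> i \<and> i \<le> Suc p}"
    (is "?A = ?Y \<union> ?b ` ?Y")
  proof (intro equalityI subsetI)
    fix x assume x: "x \<in> ?A"
    obtain j i where [simp]: "x = (j, i)" by (cases x)
    show "x \<in> ?Y \<union> ?b ` ?Y"
    proof (cases "j \<le> i")
      case False
      then have "x = ?b (i, j - 1)" "(i, j - 1) \<in> ?Y" using x by auto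
      then show ?thesis by blast
    qed (use x in auto)
  qed auto
  also have "finsum ?H t (?Y \<union> ?b ` ?Y) = \<zero>\<^bsub>?H\<^esub>"
  proof (rule H.finsum_cancel_pairs)
    show "finite ?Y" by (rule finite_subset[of _ "{0..Suc p} \<times> {0..Suc p}"]) auto
    show "inj_on ?b ?Y" by (auto simp: inj_on_def)
    show "?b ` ?Y \<inter> ?Y = {}" by auto
    show "t \<in> ?Y \<rightarrow> carrier ?H" using t by auto
    fix y assume "y \<in> ?Y"
    then show "t (?b y) = \<ominus>\<^bsub>?H\<^esub> t y"
      using x d_d[of _ "Suc _" p x]
      by (auto simp: t_def H.alt_Suc d_closed add.commute)
  qed
  finally show ?thesis .
qed

end

section \<open>Codegeneracies and the normalisation filtration\<close>

locale cosimplicial = precosimplicial G d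
  for G :: "nat \<Rightarrow> ('x, 'y) ring_scheme" and d :: "nat \<Rightarrow> nat \<Rightarrow> 'x \<Rightarrow> 'x" +
  fixes s :: "nat \<Rightarrow> nat \<Rightarrow> 'x \<Rightarrow> 'x"
  assumes s_additive: "k \<le> p \<Longrightarrow> additive (G (Suc p)) (G p) (s p k)"
    and s_d_less: "i < k \<Longrightarrow> k \<le> Suc p \<Longrightarrow> x \<in> carrier (G (Suc p)) \<Longrightarrow>
      s (Suc p) k (d (Suc p) i x) = d p i (s p (k - 1) x)"
    and s_d_same: "k \<le> p \<Longrightarrow> x \<in> carrier (G p) \<Longrightarrow> i = k \<or> i = Suc k \<Longrightarrow> s p k (d p i x) = x"
    and s_d_greater: "Suc k < i \<Longrightarrow> i \<le> Suc (Suc p) \<Longrightarrow> x \<in> carrier (G (Suc p)) \<Longrightarrow>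
      s (Suc p) k (d (Suc p) i x) = d p (i - 1) (s p k x)"
    and s_s: "j < k \<Longrightarrow> k \<le> Suc p \<Longrightarrow> x \<in> carrier (G (Suc (Suc p))) \<Longrightarrow>
      s p j (s (Suc p) k x) = s p (k - 1) (s (Suc p) j x)"
begin

text \<open>The stages of the filtration from the whole complex down to the normalised one.\<close>

definition normal :: "nat \<Rightarrow> nat \<Rightarrow> 'x \<Rightarrow> bool" where
  "normal k p x \<longleftrightarrow> x \<in> carrier (G p) \<and> (\<forall>j m. p = Suc m \<and> j < k \<and> j \<le> m \<longrightarrow> s m j x = \<zero>\<^bsub>G m\<^esub>)"

lemma s_closed: "k \<le> p \<Longrightarrow> x \<in> carrier (G (Suc p)) \<Longrightarrow> s p k x \<in> carrier (G p)"
  by (rule additive_closed[OF s_additive])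

lemmas zero_hom = additive_zero[OF group group]

text \<open>Moving s_j past d_i leaves s_(j-1) when i < j but s_j itself when i > j + 1. Stage
  \<open>k\<close> kills the latter only for j < k, so j = k is restricted to i \<le> j + 1.\<close>

lemma normal_s_d:
  assumes "normal k p x" "j \<le> p" "i \<le> Suc p" "j < k \<or> i \<le> Suc j \<and> j \<le> k"
  shows "s p j (d p i x) = (if i = j \<or> i = Suc j then x else \<zero>\<^bsub>G p\<^esub>)"
proof -
  have x: "x \<in> carrier (G p)" using assms(1) by (simp add: normal_def)
  consider "i = j \<or> i = Suc j" | "i < j" | "Suc j < i" by linarith
  then show ?thesis
  proof cases
    case 1
    then show ?thesis using s_d_same assms(2) x by auto
  next
    case 2
    then obtain m where m: "p = Suc m" using assms(2) by (cases p) auto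
    moreover have "j - 1 < k" "j - 1 \<le> m" using assms(2,4) 2 m by auto
    ultimately have "s m (j - 1) x = \<zero>\<^bsub>G m\<^esub>" using assms(1) by (simp add: normal_def)
    then show ?thesis using s_d_less[of i j m x] 2 m assms x zero_hom[OF d_additive, of i m] by simp
  next
    case 3
    then obtain m where m: "p = Suc m" using assms(3) by (cases p) auto
    have "s m j x = \<zero>\<^bsub>G m\<^esub>" using assms 3 m by (auto simp: normal_def)
    then show ?thesis using s_d_greater[of j i m x] 3 m assms x zero_hom[OF d_additive, of "i - 1" m] by simp
  qed
qed

lemma s_alt_d_sum:
  assumes "j \<le> p" "I \<subseteq> {0..Suc p}" "x \<in> carrier (G p)"
  shows "s p j (\<Oplus>\<^bsub>G (Suc p)\<^esub>i\<in>I. alt (G (Suc p)) i (d p i x)) = (\<Oplus>\<^bsub>G p\<^esub>i\<in>I. alt (G p) i (s p j (d p i x)))"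
proof -
  interpret H: abelian_group "G p" by (rule group)
  have "s p j (\<Oplus>\<^bsub>G (Suc p)\<^esub>i\<in>I. alt (G (Suc p)) i (d p i x)) = (\<Oplus>\<^bsub>G p\<^esub>i\<in>I. s p j (alt (G (Suc p)) i (d p i x)))"
    using assms by (intro additive_finsum[OF group group s_additive]) (auto simp: alt_closed' d_closed)
  also have "\<dots> = (\<Oplus>\<^bsub>G p\<^esub>i\<in>I. alt (G p) i (s p j (d p i x)))"
    using assms by (intro H.finsum_cong')
      (auto simp: additive_alt[OF group group s_additive] alt_closed' d_closed s_closed subset_iff)
  finally show ?thesis .
qed

text \<open>Cofaces below \<open>k\<close> contribute zero and the cofaces \<open>k\<close> and
  \<open>Suc k\<close> cancel. The remaining tail is what \<open>normalise\<close> matches against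
  the tail of D (s_k x).\<close>

lemma s_D:
  assumes x: "normal k p x" and k: "k \<le> p"
  shows "s p k (D p x) = (\<Oplus>\<^bsub>G p\<^esub>i\<in>{Suc (Suc k)..Suc p}. alt (G p) i (s p k (d p i x)))"
proof -
  interpret H: abelian_group "G p" by (rule group)
  have xc: "x \<in> carrier (G p)" using x by (simp add: normal_def)
  let ?t = "\<lambda>i. alt (G p) i (s p k (d p i x))"
  have cl: "?t i \<in> carrier (G p)" if "i \<le> Suc p" for i
    using that k xc by (simp add: alt_closed' s_closed d_closed)
  have "s p k (D p x) = finsum (G p) ?t {0..Suc p}"
    unfolding D_def using k xc by (intro s_alt_d_sum) auto
  also have "{0..Suc p} = {0..Suc k} \<union> {Suc (Suc k)..Suc p}" using k by auto
  also have "finsum (G p) ?t \<dots> = finsum (G p) ?t {0..Suc k} \<oplus>\<^bsub>G p\<^esub> finsum (G p) ?t {Suc (Suc k)..Suc p}"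
    using cl k by (intro H.finsum_Un_disjoint) auto
  also have "finsum (G p) ?t {0..Suc k} = \<zero>\<^bsub>G p\<^esub>"
    using normal_s_d[OF x k] k xc by (intro H.finsum_alt_pair[of _ k x]) auto
  finally show ?thesis using cl by (simp add: H.finsum_in_carrier)
qed

text \<open>When s_k x vanishes as well, so does the tail. This is why the simplicial differential
  preserves reduced cochains.\<close>

lemma s_D_zero:
  assumes x: "normal (Suc k) p x" and k: "k \<le> p"
  shows "s p k (D p x) = \<zero>\<^bsub>G p\<^esub>"
proof -
  interpret H: abelian_group "G p" by (rule group)
  have "s p k (d p i x) = \<zero>\<^bsub>G p\<^esub>" if "i \<in> {Suc (Suc k)..Suc p}" for i
    using normal_s_d[OF x k, of i] that by auto
  moreover have "normal k p x" using x by (auto simp: normal_def)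
  ultimately show ?thesis using s_D[OF _ k] by (auto simp: H.alt_zero intro!: H.finsum_eq_zero)
qed

text \<open>The homotopy \<open>(-1)\<^sup>k s\<^sub>k\<close> retracts stage \<open>k\<close> of the filtration onto stage \<open>k + 1\<close>.\<close>

lemma normalise:
  assumes x: "normal k (Suc m) x" and k: "k \<le> m"
  shows "normal (Suc k) (Suc m) (x \<ominus>\<^bsub>G (Suc m)\<^esub>
    alt (G (Suc m)) k (D m (s m k x) \<oplus>\<^bsub>G (Suc m)\<^esub> s (Suc m) k (D (Suc m) x)))"
proof -
  let ?K = "G (Suc m)"
  interpret K: abelian_group ?K by (rule group)
  interpret H: abelian_group "G m" by (rule group)
  have xc: "x \<in> carrier ?K" using x by (simp add: normal_def)
  define w where "w = s m k x"
  have wc: "w \<in> carrier (G m)" using xc k by (simp add: w_def s_closed)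
  \<comment> \<open>Stage \<open>k\<close> passes from x to s_k x because s_j s_k = s_(k-1) s_j for
    j < k.\<close>
  have w: "normal k m w"
    unfolding normal_def
  proof (intro conjI allI impI)
    fix j l assume j: "m = Suc l \<and> j < k \<and> j \<le> l"
    then have "s l j w = s l (k - 1) (s m j x)"
      unfolding w_def using s_s[of j k l x] k xc by auto
    also have "s m j x = \<zero>\<^bsub>G m\<^esub>" using x j by (auto simp: normal_def)
    finally show "s l j w = \<zero>\<^bsub>G l\<^esub>" using j k zero_hom[OF s_additive, of "k - 1" l] by auto
  qed (rule wc)
  let ?t = "\<lambda>i. alt ?K i (d m i w)"
  have tc: "?t i \<in> carrier ?K" if "i \<le> Suc m" for i
    using that wc by (simp add: alt_closed' d_closed)
  \<comment> \<open>\<open>E\<close> is all that survives of D (s_k x) + s_k (D x): the cofaces of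
    the first term beyond \<open>k\<close> reappear in the second one with index raised by one,
    hence with opposite sign.\<close>
  define E where "E = finsum ?K ?t {0..k}"
  have Ec: "E \<in> carrier ?K" unfolding E_def using tc k by (intro K.finsum_in_carrier) auto
  have rest: "finsum ?K ?t {Suc k..Suc m} \<in> carrier ?K" using tc by (intro K.finsum_in_carrier) auto
  have 1: "D m w = E \<oplus>\<^bsub>?K\<^esub> finsum ?K ?t {Suc k..Suc m}"
  proof -
    have "{0..Suc m} = {0..k} \<union> {Suc k..Suc m}" using k by auto
    then show ?thesis unfolding D_def E_def using tc k
      by (simp only:) (intro K.finsum_Un_disjoint, auto)
  qed
  have 2: "s (Suc m) k (D (Suc m) x) = \<ominus>\<^bsub>?K\<^esub> finsum ?K ?t {Suc k..Suc m}"
  proof -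
    have "s (Suc m) k (D (Suc m) x) = (\<Oplus>\<^bsub>?K\<^esub>i\<in>Suc ` {Suc k..Suc m}. alt ?K i (s (Suc m) k (d (Suc m) i x)))"
      using s_D[OF x] k by (simp add: image_Suc_atLeastAtMost)
    also have "\<dots> = (\<Oplus>\<^bsub>?K\<^esub>i\<in>{Suc k..Suc m}. alt ?K (Suc i) (s (Suc m) k (d (Suc m) (Suc i) x)))"
      using k xc by (intro K.finsum_reindex) (auto simp: alt_closed' s_closed d_closed)
    also have "\<dots> = (\<Oplus>\<^bsub>?K\<^esub>i\<in>{Suc k..Suc m}. \<ominus>\<^bsub>?K\<^esub> ?t i)"
      using k xc tc wc by (intro K.finsum_cong') (auto simp: s_d_greater K.alt_Suc w_def d_closed)
    also have "\<dots> = \<ominus>\<^bsub>?K\<^esub> finsum ?K ?t {Suc k..Suc m}"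
      using tc by (intro K.finsum_a_inv) auto
    finally show ?thesis .
  qed
  have "D m w \<oplus>\<^bsub>?K\<^esub> s (Suc m) k (D (Suc m) x) = E"
    unfolding 1 2 using Ec rest by (simp add: K.a_assoc K.r_neg)
  moreover have "normal (Suc k) (Suc m) (x \<ominus>\<^bsub>?K\<^esub> alt ?K k E)"
    unfolding normal_def
  proof (intro conjI allI impI)
    fix j m' assume "Suc m = Suc m' \<and> j < Suc k \<and> j \<le> m'"
    then have [simp]: "m' = m" and j: "j \<le> k" "j \<le> m" by auto
    have "s m j (x \<ominus>\<^bsub>?K\<^esub> alt ?K k E) = s m j x \<ominus>\<^bsub>G m\<^esub> alt (G m) k (s m j E)"
      using j xc Ec by (simp add: additive_a_minus[OF group group s_additive] additive_alt[OF group group s_additive] alt_closed')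
    also have "s m j E = (\<Oplus>\<^bsub>G m\<^esub>i\<in>{0..k}. alt (G m) i (s m j (d m i w)))"
      unfolding E_def using j k wc by (intro s_alt_d_sum) auto
    also have "s m j x \<ominus>\<^bsub>G m\<^esub> alt (G m) k \<dots> = \<zero>\<^bsub>G m\<^esub>"
    \<comment> \<open>The sum stops at \<open>k\<close>. For j < k it contains both cofaces j and j
      + 1, which cancel under s_j; for j = k it contains only the coface k, which leaves (-1)^k s_k
      x.\<close>
    proof (cases "j = k")
      case True
      have "(\<Oplus>\<^bsub>G m\<^esub>i\<in>{0..k}. alt (G m) i (s m j (d m i w))) = (\<Oplus>\<^bsub>G m\<^esub>i\<in>{k}. alt (G m) i (s m j (d m i w)))"
        using True k normal_s_d[OF w, of k] wc
        by (intro H.finsum_subset_support) (auto simp: H.alt_zero alt_closed')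
      also have "\<dots> = alt (G m) k w"
        using True k normal_s_d[OF w, of k k] wc by (simp add: alt_closed')
      finally show ?thesis using True wc
        by (simp add: H.alt_alt H.alt_eq H.minus_eq H.r_neg flip: w_def)
    next
      case False
      then have "(\<Oplus>\<^bsub>G m\<^esub>i\<in>{0..k}. alt (G m) i (s m j (d m i w))) = \<zero>\<^bsub>G m\<^esub>"
        using j k normal_s_d[OF w, of j] wc by (intro H.finsum_alt_pair[of _ j w]) auto
      moreover have "s m j x = \<zero>\<^bsub>G m\<^esub>" using x False j by (auto simp: normal_def)
      ultimately show ?thesis by (simp add: H.alt_zero H.minus_eq H.r_neg)
    qed
    finally show "s m' j (x \<ominus>\<^bsub>?K\<^esub> alt ?K k E) = \<zero>\<^bsub>G m'\<^esub>" by simp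
  qed (use xc Ec in \<open>simp add: alt_closed'\<close>)
  ultimately show ?thesis by (simp add: w_def)
qed

end

section \<open>The cosimplicial structure of the cochains\<close>

definition codegeneracy :: "nat \<Rightarrow> nat \<Rightarrow> nat" where
  "codegeneracy k j = (if j \<le> k then j else j - 1)"

lemma mono_coface: "mono_on A (coface i)"
  by (auto simp: mono_on_def coface_def)

lemma mono_codegeneracy: "mono_on A (codegeneracy k)"
  by (auto simp: mono_on_def codegeneracy_def)

lemma coface_le: "coface i p \<le> Suc p"
  by (simp add: coface_def)

lemma codegeneracy_le: "k \<le> p \<Longrightarrow> codegeneracy k (Suc p) \<le> p"
  by (simp add: codegeneracy_def)

context algebra_diagram
begin

abbreviation degen :: "nat \<Rightarrow> nat \<Rightarrow> nat \<Rightarrow> ('o, 'm, 'a) cochain \<Rightarrow> ('o, 'm, 'a) cochain" where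
  "degen q p k \<equiv> push (Suc p) p (codegeneracy k) q"

lemmas push_coface = push_push[OF mono_coface coface_le mono_coface coface_le]

lemma cosimplicial_cochains: "cosimplicial (\<lambda>p. cochains p q) (\<lambda>p. delta_S_comp p q) (degen q)"
proof (intro cosimplicial.intro precosimplicial.intro cosimplicial_axioms.intro)
  show "abelian_group (cochains p q)" for p by (rule cochains_group)
  show "additive (cochains p q) (cochains (Suc p) q) (delta_S_comp p q i)" for p i
    unfolding delta_S_comp_push by (intro push_additive mono_coface coface_le)
  show "additive (cochains (Suc p) q) (cochains p q) (degen q p k)" if "k \<le> p" for p k
    using that by (intro push_additive mono_codegeneracy codegeneracy_le)
  show "delta_S_comp (Suc p) q j (delta_S_comp p q i x) = delta_S_comp (Suc p) q i (delta_S_comp p q (j - 1) x)"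
    if "i < j" "j \<le> Suc (Suc p)" "x \<in> carrier (cochains p q)" for i j p x
    using that by (simp add: delta_S_comp_push push_coface) (rule push_cong, auto simp: coface_def)
  show "degen q (Suc p) k (delta_S_comp (Suc p) q i x) = delta_S_comp p q i (degen q p (k - 1) x)"
    if "i < k" "k \<le> Suc p" "x \<in> carrier (cochains (Suc p) q)" for i k p x
    using that by (simp add: delta_S_comp_push push_push mono_coface coface_le mono_codegeneracy codegeneracy_le)
      (rule push_cong, auto simp: coface_def codegeneracy_def)
  show "degen q p k (delta_S_comp p q i x) = x"
    if "k \<le> p" "x \<in> carrier (cochains p q)" "i = k \<or> i = Suc k" for i k p x
  proof -
    have "degen q p k (delta_S_comp p q i x) = push p p (\<lambda>j. j) q x"
      using that by (simp add: delta_S_comp_push push_push mono_coface coface_le mono_codegeneracy codegeneracy_le)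
        (rule push_cong, auto simp: coface_def codegeneracy_def)
    then show ?thesis using that by (simp add: push_ident)
  qed
  show "degen q (Suc p) k (delta_S_comp (Suc p) q i x) = delta_S_comp p q (i - 1) (degen q p k x)"
    if "Suc k < i" "i \<le> Suc (Suc p)" "x \<in> carrier (cochains (Suc p) q)" for i k p x
    using that by (simp add: delta_S_comp_push push_push mono_coface coface_le mono_codegeneracy codegeneracy_le)
      (rule push_cong, auto simp: coface_def codegeneracy_def)
  show "degen q p j (degen q (Suc p) k x) = degen q p (k - 1) (degen q (Suc p) j x)"
    if "j < k" "k \<le> Suc p" "x \<in> carrier (cochains (Suc (Suc p)) q)" for j k p x
    using that by (simp add: push_push mono_codegeneracy codegeneracy_le)
      (rule push_cong, auto simp: codegeneracy_def)
qed

sublocale S: cosimplicial "\<lambda>p. cochains p q" "\<lambda>p. delta_S_comp p q" "degen q" for q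
  by (rule cosimplicial_cochains)

lemma delta_S_Suc: "delta_S F (Suc p) q = S.D q p (F p q)"
  by (simp add: delta_S_def S.D_def alt_def)

lemma delta_S_0: "delta_S F 0 q = \<zero>\<^bsub>cochains 0 q\<^esub>"
  by (simp add: delta_S_def)

lemma delta_S_closed:
  assumes F: "F \<in> carrier Tot"
  shows "delta_S F \<in> carrier Tot"
  unfolding Tot_carrier
proof
  show "\<forall>p q. delta_S F p q \<in> carrier (cochains p q)"
  proof (intro allI)
    fix p q
    show "delta_S F p q \<in> carrier (cochains p q)"
      using Tot_at[OF F] abelian_groupE(2)[OF cochains_group]
      by (cases p) (auto simp: delta_S_Suc delta_S_0 S.D_closed)
  qed
  have "{(p, q). delta_S F p q \<noteq> \<zero>\<^bsub>cochains p q\<^esub>} \<subseteq> (\<lambda>(p, q). (Suc p, q)) ` {(p, q). F p q \<noteq> \<zero>\<^bsub>cochains p q\<^esub>}"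
  proof (intro subsetI)
    fix x assume x: "x \<in> {(p, q). delta_S F p q \<noteq> \<zero>\<^bsub>cochains p q\<^esub>}"
    obtain p q where [simp]: "x = (p, q)" by (cases x)
    obtain p0 where [simp]: "p = Suc p0" using x delta_S_0 by (cases p) auto
    have "F p0 q \<noteq> \<zero>\<^bsub>cochains p0 q\<^esub>"
      using x additive_zero[OF cochains_group cochains_group S.D_additive] by (auto simp: delta_S_Suc)
    then show "x \<in> (\<lambda>(p, q). (Suc p, q)) ` {(p, q). F p q \<noteq> \<zero>\<^bsub>cochains p q\<^esub>}" by force
  qed
  then show "finite {(p, q). delta_S F p q \<noteq> \<zero>\<^bsub>cochains p q\<^esub>}"
    using F by (auto simp: Tot_carrier intro: finite_subset)
qed

text \<open>A codegeneracy preserves both end points, so the two transports in \<open>push\<close>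
  are along identities.\<close>

lemma degen_value:
  assumes \<psi>: "\<psi> \<in> strings m" and as: "as \<in> tuples (A (vert \<psi> m)) q" and j: "j \<le> m"
    and f: "f \<in> carrier (cochains (Suc m) q)"
  shows "degen q m j f \<psi> as = f (pull (Suc m) (codegeneracy j) \<psi>) as"
proof -
  have c: "codegeneracy j (Suc m) = m" "codegeneracy j 0 = 0"
    using j by (auto simp: codegeneracy_def)
  note le = mono_codegeneracy codegeneracy_le[OF j]
  have "map (transport \<psi> m m) as = as"
    using as by (auto simp: tuples_def transport_refl[OF \<psi>] subset_iff intro: map_idI)
  moreover have "f (pull (Suc m) (codegeneracy j) \<psi>) as \<in> carrier (A (vert \<psi> 0))"
    using cochain_value[OF f pull_strings[OF \<psi> le], of as] as pull_vert[OF \<psi> le] by (simp add: c)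
  ultimately show ?thesis
    by (simp add: push_value[OF \<psi> as] c transport_refl[OF \<psi>])
qed

text \<open>The composite map sends \<open>Suc j\<close> to \<open>j\<close> and fixes everything
  else: the identity at step \<open>j\<close> is dropped and put back. Thus every string with an
  identity is degenerate.\<close>

lemma pull_identity:
  assumes \<phi>: "\<phi> \<in> strings (Suc m)" and j: "j \<le> m" and x: "x \<in> Ob C" "snd \<phi> ! j = Ident C x"
  shows "pull (Suc m) (codegeneracy j) (pull m (coface (Suc j)) \<phi>) = \<phi>"
proof -
  let ?\<rho> = "\<lambda>k. coface (Suc j) (codegeneracy j k)"
  have \<rho>: "?\<rho> k = (if k = Suc j then j else k)" for k
    by (auto simp: coface_def codegeneracy_def)
  have m: "mono_on {0..Suc m} ?\<rho>" by (auto simp: \<rho> mono_on_def)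
  have l: "?\<rho> (Suc m) \<le> Suc m" using j by (auto simp: \<rho>)
  have vx: "vert \<phi> j = x" "vert \<phi> (Suc j) = x"
    using stringsD(4,5)[OF \<phi>, of j] j x by (auto simp: Cod_Id Dom_Id)
  have "pull (Suc m) (codegeneracy j) (pull m (coface (Suc j)) \<phi>) = pull (Suc m) ?\<rho> \<phi>"
    by (intro pull_pull[OF \<phi>] mono_coface mono_codegeneracy coface_le codegeneracy_le j)
  also have "\<dots> = \<phi>"
  proof (rule strings_eqI[OF pull_strings[OF \<phi> m l] \<phi>])
    show "vert (pull (Suc m) ?\<rho> \<phi>) 0 = vert \<phi> 0"
      using pull_vert[OF \<phi> m l] by (simp add: \<rho>)
    fix k assume k: "k < Suc m"
    consider "k = j" | "k = Suc j" | "k \<noteq> j" "k \<noteq> Suc j" by blast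
    then show "snd (pull (Suc m) ?\<rho> \<phi>) ! k = snd \<phi> ! k"
    proof cases
      case 1
      then show ?thesis using k vx x by (simp add: pull_nth \<rho> segment_refl)
    next
      case 2
      have "segment \<phi> j (Suc k) = Comp C (snd \<phi> ! j) (snd \<phi> ! k)"
        using 2 k by (simp add: segment_step[of j] segment_Suc[OF \<phi>])
      also have "\<dots> = snd \<phi> ! k"
        using Id_Comp[of "snd \<phi> ! k"] stringsD(3,4)[OF \<phi> k] vx x 2 by simp
      finally show ?thesis using 2 k by (simp add: pull_nth \<rho>)
    next
      case 3
      then show ?thesis using k by (simp add: pull_nth \<rho> segment_Suc[OF \<phi>])
    qed
  qed
  finally show ?thesis .
qed

text \<open>The strings with an identity at step \<open>j\<close> are exactly the pullbacks along
  the j-th codegeneracy, and on a string \<open>degen\<close> is evaluation at its pullback.\<close>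

lemma degen_zero_iff:
  assumes f: "f \<in> carrier (cochains (Suc m) q)" and j: "j \<le> m"
  shows "degen q m j f = \<zero>\<^bsub>cochains m q\<^esub> \<longleftrightarrow>
    (\<forall>\<phi>\<in>strings (Suc m). (\<exists>x\<in>Ob C. snd \<phi> ! j = Ident C x) \<longrightarrow> f \<phi> = \<zero>\<^bsub>maps_at (Suc m) q \<phi>\<^esub>)"
proof
  assume z: "degen q m j f = \<zero>\<^bsub>cochains m q\<^esub>"
  show "\<forall>\<phi>\<in>strings (Suc m). (\<exists>x\<in>Ob C. snd \<phi> ! j = Ident C x) \<longrightarrow> f \<phi> = \<zero>\<^bsub>maps_at (Suc m) q \<phi>\<^esub>"
  proof (intro ballI impI)
    fix \<phi> assume \<phi>: "\<phi> \<in> strings (Suc m)" and "\<exists>x\<in>Ob C. snd \<phi> ! j = Ident C x"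
    then obtain x where x: "x \<in> Ob C" "snd \<phi> ! j = Ident C x" by blast
    let ?\<psi> = "pull m (coface (Suc j)) \<phi>"
    have \<psi>: "?\<psi> \<in> strings m" by (intro pull_strings[OF \<phi>] mono_coface coface_le)
    note p = pull_identity[OF \<phi> j x]
    have v: "vert \<phi> (Suc m) = vert ?\<psi> m" "vert \<phi> 0 = vert ?\<psi> 0"
      using pull_vert[OF \<psi> mono_codegeneracy codegeneracy_le[OF j], of "Suc m"]
        pull_vert[OF \<psi> mono_codegeneracy codegeneracy_le[OF j], of 0] j
      unfolding p by (simp_all add: codegeneracy_def)
    show "f \<phi> = \<zero>\<^bsub>maps_at (Suc m) q \<phi>\<^esub>"
    proof (rule multilinear_eqI)
      show "f \<phi> \<in> carrier (multilinear_maps R (A (vert \<phi> (Suc m))) (A (vert \<phi> 0)) q)"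
        using cochain_at[OF f \<phi>] by (simp add: maps_at_def)
      show "\<zero>\<^bsub>maps_at (Suc m) q \<phi>\<^esub> \<in> carrier (multilinear_maps R (A (vert \<phi> (Suc m))) (A (vert \<phi> 0)) q)"
        using abelian_groupE(2)[OF maps_at_group[OF \<phi>]] by (simp add: maps_at_def)
      fix as assume as: "as \<in> tuples (A (vert \<phi> (Suc m))) q"
      then have as': "as \<in> tuples (A (vert ?\<psi> m)) q" by (simp add: v)
      show "f \<phi> as = \<zero>\<^bsub>maps_at (Suc m) q \<phi>\<^esub> as"
        using degen_value[OF \<psi> as' j f] cochain_zero_value[OF \<psi> as'] maps_at_zero_value[OF as]
        by (simp add: z p v)
    qed
  qed
next
  assume *: "\<forall>\<phi>\<in>strings (Suc m). (\<exists>x\<in>Ob C. snd \<phi> ! j = Ident C x) \<longrightarrow> f \<phi> = \<zero>\<^bsub>maps_at (Suc m) q \<phi>\<^esub>"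
  show "degen q m j f = \<zero>\<^bsub>cochains m q\<^esub>"
  proof (rule cochain_eqI)
    show "degen q m j f \<in> carrier (cochains m q)" using j f by (rule S.s_closed)
    show "\<zero>\<^bsub>cochains m q\<^esub> \<in> carrier (cochains m q)" by (rule abelian_groupE(2)[OF cochains_group])
    fix \<psi> as assume \<psi>: "\<psi> \<in> strings m" and as: "as \<in> tuples (A (vert \<psi> m)) q"
    let ?\<phi> = "pull (Suc m) (codegeneracy j) \<psi>"
    note le = mono_codegeneracy codegeneracy_le[OF j]
    note \<phi> = pull_strings[OF \<psi> le] 
    have "snd ?\<phi> ! j = Ident C (vert \<psi> j)"
      using j by (simp add: pull_nth codegeneracy_def segment_refl)
    then have "f ?\<phi> = \<zero>\<^bsub>maps_at (Suc m) q ?\<phi>\<^esub>"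
      using * \<phi> vert_Ob[OF \<psi> j] by blast
    moreover have "vert ?\<phi> (Suc m) = vert \<psi> m" "vert ?\<phi> 0 = vert \<psi> 0"
      using pull_vert[OF \<psi> le, of "Suc m"] pull_vert[OF \<psi> le, of 0] j
      by (simp_all add: codegeneracy_def[of j 0] codegeneracy_def[of j "Suc m"])
    ultimately show "degen q m j f \<psi> as = \<zero>\<^bsub>cochains m q\<^esub> \<psi> as"
      using degen_value[OF \<psi> as j f] as by (simp add: cochain_zero_value[OF \<psi> as] maps_at_zero_value)
  qed
qed

text \<open>In simplicial degree \<open>p\<close> there are only the codegeneracies 0 to p - 1, so
  stage \<open>p\<close> of the filtration is already the last one.\<close>

lemma reduced_normal: "f \<in> reduced_cochains p q \<longleftrightarrow> S.normal q p p f"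
proof (cases "f \<in> carrier (cochains p q)")
  case True
  show ?thesis
  proof (cases p)
    case 0
    then show ?thesis using True by (auto simp: reduced_cochains_def S.normal_def)
  next
    case (Suc m)
    then have "S.normal q p p f \<longleftrightarrow> (\<forall>j\<le>m. degen q m j f = \<zero>\<^bsub>cochains m q\<^esub>)"
      using True by (auto simp: S.normal_def)
    also have "\<dots> \<longleftrightarrow> f \<in> reduced_cochains p q"
      using True Suc by (auto simp: degen_zero_iff reduced_cochains_def less_Suc_eq_le)
    finally show ?thesis by simp
  qed
qed (auto simp: reduced_cochains_def S.normal_def)

section \<open>The subalgebras\<close>

lemma quilt_term_closed:
  assumes Q: "Q \<in> quilts n" and F: "\<And>a. a \<in> {1..n} \<Longrightarrow> F a \<in> carrier Tot"
    and pq: "(p, q) \<in> bidegrees n (word_deg n (fst Q)) p' q'"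
  shows "quilt_op n Q p q (\<lambda>a. F a (p a) (q a)) \<in> carrier (cochains p' q')"
proof -
  have "(fst Q, snd Q) \<in> quilts n" using Q by simp
  then show ?thesis
    using quilt_op_closed[of "fst Q" "snd Q" n "\<lambda>a. F a (p a) (q a)" p q p' q'] F pq
    by (auto simp: bidegrees_def Tot_at)
qed

lemma quilt_term_zero:
  assumes Q: "Q \<in> quilts n" and F: "\<And>a. a \<in> {1..n} \<Longrightarrow> F a \<in> carrier Tot"
    and pq: "(p, q) \<in> bidegrees n (word_deg n (fst Q)) p' q'"
    and v: "v \<in> {1..n}" "F v (p v) (q v) = \<zero>\<^bsub>cochains (p v) (q v)\<^esub>"
  shows "quilt_op n Q p q (\<lambda>a. F a (p a) (q a)) = \<zero>\<^bsub>cochains p' q'\<^esub>"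
proof -
  have "(fst Q, snd Q) \<in> quilts n" using Q by simp
  then show ?thesis
    using quilt_op_zero[of "fst Q" "snd Q" n "\<lambda>a. F a (p a) (q a)" p q p' q' v] F pq v
    by (auto simp: bidegrees_def Tot_at)
qed

lemma total_op_at: 
  assumes Q: "Q \<in> quilts n" and F: "\<And>a. a \<in> {1..n} \<Longrightarrow> F a \<in> carrier Tot"
  shows "total_op n Q F p' q' \<in> carrier (cochains p' q')"
  unfolding total_op_def
  by (intro abelian_group.finsum_in_carrier[OF cochains_group])
    (use quilt_term_closed[OF Q F] in auto)

lemma total_op_eq_zero:
  assumes Q: "Q \<in> quilts n" and F: "\<And>a. a \<in> {1..n} \<Longrightarrow> F a \<in> carrier Tot"
    and z: "\<And>p q. (p, q) \<in> bidegrees n (word_deg n (fst Q)) p' q' \<Longrightarrow>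
       \<exists>v\<in>{1..n}. F v (p v) (q v) = \<zero>\<^bsub>cochains (p v) (q v)\<^esub>"
  shows "total_op n Q F p' q' = \<zero>\<^bsub>cochains p' q'\<^esub>"
  unfolding total_op_def
  by (intro abelian_group.finsum_eq_zero[OF cochains_group])
    (use quilt_term_zero[OF Q F] z in fastforce)

lemma total_op_closed:
  assumes Q: "Q \<in> quilts n" and F: "\<And>a. a \<in> {1..n} \<Longrightarrow> F a \<in> carrier Tot"
  shows "total_op n Q F \<in> carrier Tot"
  unfolding Tot_carrier
proof (intro conjI allI)
  show "total_op n Q F p' q' \<in> carrier (cochains p' q')" for p' q'
    by (rule total_op_at[OF Q F])
  let ?S = "\<Union>a\<in>{1..n}. {(p, q). F a p q \<noteq> \<zero>\<^bsub>cochains p q\<^esub>}"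
  have "finite ?S" using F by (auto simp: Tot_carrier)
  then have "finite (fst ` ?S \<union> snd ` ?S)" by blast
  from this[unfolded finite_nat_set_iff_bounded_le]
  obtain B where B: "\<forall>x\<in>fst ` ?S \<union> snd ` ?S. x \<le> B" ..
  have bound: "p \<le> B \<and> q \<le> B" if "a \<in> {1..n}" "F a p q \<noteq> \<zero>\<^bsub>cochains p q\<^esub>" for a p q
  proof -
    have "(p, q) \<in> ?S" using that by blast
    then have "p \<in> fst ` ?S" "q \<in> snd ` ?S" by force+
    then show ?thesis using B by blast
  qed
  \<comment> \<open>A nonzero component needs a bidegree in which every factor is nonzero. All
    entries are then at most \<open>B\<close>, and \<open>p'\<close> and \<open>q'\<close> are
    bounded by the sums over the \<open>n\<close> vertices.\<close>
  have "p' \<le> n * B \<and> q' \<le> 1 + n * B" if nz: "total_op n Q F p' q' \<noteq> \<zero>\<^bsub>cochains p' q'\<^esub>" for p' q'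
  proof -
    have "\<exists>p q. (p, q) \<in> bidegrees n (word_deg n (fst Q)) p' q' \<and>
        (\<forall>v\<in>{1..n}. F v (p v) (q v) \<noteq> \<zero>\<^bsub>cochains (p v) (q v)\<^esub>)"
    proof (rule ccontr)
      assume no: "\<not> ?thesis"
      have "total_op n Q F p' q' = \<zero>\<^bsub>cochains p' q'\<^esub>"
        by (rule total_op_eq_zero[OF Q F]) (use no in blast)+
      with nz show False ..
    qed
    then obtain p q where pq: "(p, q) \<in> bidegrees n (word_deg n (fst Q)) p' q'"
      and v: "\<And>v. v \<in> {1..n} \<Longrightarrow> F v (p v) (q v) \<noteq> \<zero>\<^bsub>cochains (p v) (q v)\<^esub>"
      by blast
    have "sum p {1..n} \<le> of_nat (card {1..n}) * B" "sum q {1..n} \<le> of_nat (card {1..n}) * B"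
      by (rule sum_bounded_above, use bound[OF _ v] in blast)+
    then show ?thesis using pq by (auto simp: bidegrees_def)
  qed
  then have "{(p, q). total_op n Q F p q \<noteq> \<zero>\<^bsub>cochains p q\<^esub>} \<subseteq> {..n * B} \<times> {..1 + n * B}"
    by auto
  then show "finite {(p, q). total_op n Q F p q \<noteq> \<zero>\<^bsub>cochains p q\<^esub>}"
    by (rule finite_subset) auto
qed

lemma total_op_asimplicial:
  assumes Q: "Q \<in> quilts n" and F: "\<And>a. a \<in> {1..n} \<Longrightarrow> F a \<in> asimplicial"
  shows "total_op n Q F \<in> asimplicial"
proof -
  have FT: "F a \<in> carrier Tot" if "a \<in> {1..n}" for a using F[OF that] by (simp add: asimplicial_def)
  have "total_op n Q F p' 0 = \<zero>\<^bsub>cochains p' 0\<^esub>" for p'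
  proof (rule total_op_eq_zero[OF Q FT])
    fix p q assume "(p, q) \<in> bidegrees n (word_deg n (fst Q)) p' 0"
    then have n: "n = 1 + (\<Sum>a=1..n. q a)" by (simp add: bidegrees_def)
    have "\<exists>v\<in>{1..n}. q v = 0"
    proof (rule ccontr)
      assume "\<not> (\<exists>v\<in>{1..n}. q v = 0)"
      then have "(\<Sum>a=1..n. 1) \<le> (\<Sum>a=1..n. q a)" by (intro sum_mono) (auto simp: Suc_le_eq)
      then show False using n by simp
    qed
    then obtain v where "v \<in> {1..n}" "q v = 0" by blast
    then show "\<exists>v\<in>{1..n}. F v (p v) (q v) = \<zero>\<^bsub>cochains (p v) (q v)\<^esub>"
      using F[of v] by (intro bexI[of _ v]) (auto simp: asimplicial_def)
  qed auto
  then show ?thesis using total_op_closed[OF Q FT] by (simp add: asimplicial_def)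
qed

section \<open>Reduced cochains under quilts and the simplicial differential\<close>

lemma reduced_cochainsD:
  "f \<in> reduced_cochains p q \<Longrightarrow> \<phi> \<in> strings p \<Longrightarrow> k < p \<Longrightarrow> x \<in> Ob C \<Longrightarrow> snd \<phi> ! k = Ident C x \<Longrightarrow>
    f \<phi> = \<zero>\<^bsub>maps_at p q \<phi>\<^esub>"
  by (auto simp: reduced_cochains_def)

lemma reduced_cochains_zero: "\<zero>\<^bsub>cochains p q\<^esub> \<in> reduced_cochains p q"
  by (auto simp: reduced_cochains_def cochain_zero_at abelian_groupE(2)[OF cochains_group])

lemma reduced_cochains_add:
  "f \<in> reduced_cochains p q \<Longrightarrow> g \<in> reduced_cochains p q \<Longrightarrow> f \<oplus>\<^bsub>cochains p q\<^esub> g \<in> reduced_cochains p q"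
  using abelian_groupE(1)[OF cochains_group, of f p q g]
    abelian_monoid.l_zero[OF abelian_group.axioms(1)[OF maps_at_group]] abelian_groupE(2)[OF maps_at_group]
  by (auto simp: reduced_cochains_def cochain_add_at)

lemma reduced_cochains_smult:
  "r \<in> carrier R \<Longrightarrow> f \<in> reduced_cochains p q \<Longrightarrow> r \<odot>\<^bsub>cochains p q\<^esub> f \<in> reduced_cochains p q"
  using module.smult_closed[OF cochains_module, of r f p q] module.smult_r_null[OF maps_at_module, of _ p r q]
  by (auto simp: reduced_cochains_def cochain_smult_at)

lemma quilt_op_reduced:
  assumes Q: "(W, T) \<in> quilts n" 
    and f: "\<And>a. a \<in> {1..n} \<Longrightarrow> f a \<in> reduced_cochains (p a) (q a)"
    and p': "p' + word_deg n W = (\<Sum>a=1..n. p a)" and q': "q' + n = 1 + (\<Sum>a=1..n. q a)"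
  shows "quilt_op n (W, T) p q f \<in> reduced_cochains p' q'"
proof -
  have fc: "f a \<in> carrier (cochains (p a) (q a))" if "a \<in> {1..n}" for a
    using f[OF that] by (simp add: reduced_cochains_def)
  have "quilt_op n (W, T) p q f \<phi> = \<zero>\<^bsub>maps_at p' q' \<phi>\<^esub>"
    if \<phi>: "\<phi> \<in> strings p'" and k: "k < p'" and x: "x \<in> Ob C" "snd \<phi> ! k = Ident C x" for \<phi> k x
  proof (rule quilt_op_zero_at[OF Q fc p' q' \<phi>])
    fix \<zeta> I assume \<zeta>I: "\<zeta> \<in> clr_word n W p" "I \<in> clr_tree T q"
    have E: "evaluation C R A Am n T q I p \<zeta> f p' \<phi>"
      by (rule evaluation_of_quilt(1)[OF Q \<zeta>I fc p' \<phi>])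
    obtain \<pi> where "colored_word n W p \<zeta> \<pi> p'"
      using evaluation_of_quilt(2)[OF Q \<zeta>I fc p' \<phi>] by blast
    then obtain a l where a: "a \<in> {1..n}" "l < p a" "\<zeta> a l = k" "\<zeta> a (Suc l) = Suc k"
      by (rule colored_word.consecutive[OF _ k]) (rule that)
    \<comment> \<open>The values at \<open>l\<close> and \<open>Suc l\<close> are \<open>k\<close>
      and \<open>Suc k\<close>, so the morphism at \<open>l\<close> of the pulled-back string is the
      identity at step \<open>k\<close> of \<phi>.\<close>
    have "snd (pull (p a) (\<zeta> a) \<phi>) ! l = Ident C x"
      using a x k by (simp add: pull_nth segment_Suc[OF \<phi>])
    then have "f a (pull (p a) (\<zeta> a) \<phi>) = \<zero>\<^bsub>maps_at (p a) (q a) (pull (p a) (\<zeta> a) \<phi>)\<^esub>"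
      using reduced_cochainsD[OF f[OF a(1)] _ a(2) x(1)]
        pull_strings[OF \<phi> evaluation.\<zeta>_mono[OF E a(1)] evaluation.\<zeta>_le[OF E a(1)]] by blast
    then show "\<exists>v\<in>{1..n}. f v (pull (p v) (\<zeta> v) \<phi>) = \<zero>\<^bsub>maps_at (p v) (q v) (pull (p v) (\<zeta> v) \<phi>)\<^esub>"
      using a by blast
  qed auto
  then show ?thesis
    using quilt_op_closed[OF Q fc p' q'] by (auto simp: reduced_cochains_def)
qed

lemma total_op_reduced:
  assumes Q: "Q \<in> quilts n" and F: "\<And>a. a \<in> {1..n} \<Longrightarrow> F a \<in> reduced"
  shows "total_op n Q F \<in> reduced"
proof -
  have FT: "F a \<in> carrier Tot" if "a \<in> {1..n}" for a using F[OF that] by (simp add: reduced_def)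
  have "total_op n Q F p' q' \<in> reduced_cochains p' q'" for p' q'
    unfolding total_op_def
  proof (rule abelian_group.finsum_in_subset[OF cochains_group _ reduced_cochains_zero reduced_cochains_add])
    show "reduced_cochains p' q' \<subseteq> carrier (cochains p' q')" by (auto simp: reduced_cochains_def)
    fix x assume x: "x \<in> bidegrees n (word_deg n (fst Q)) p' q'"
    obtain p q where [simp]: "x = (p, q)" by (cases x)
    have Q': "(fst Q, snd Q) \<in> quilts n" using Q by simp
    have "quilt_op n (fst Q, snd Q) p q (\<lambda>a. F a (p a) (q a)) \<in> reduced_cochains p' q'"
      by (rule quilt_op_reduced[OF Q']) (use F x in \<open>auto simp: reduced_def bidegrees_def\<close>)
    then show "(case x of (p, q) \<Rightarrow> quilt_op n Q p q (\<lambda>a. F a (p a) (q a))) \<in> reduced_cochains p' q'"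
      by simp
  qed
  then show ?thesis using total_op_closed[OF Q FT] by (simp add: reduced_def)
qed

lemma delta_S_reduced:
  assumes F: "F \<in> reduced"
  shows "delta_S F \<in> reduced"
proof -
  have FT: "F \<in> carrier Tot" and Fr: "\<And>p q. F p q \<in> reduced_cochains p q" using F by (auto simp: reduced_def)
  have "delta_S F p q \<in> reduced_cochains p q" for p q
  proof (cases p)
    case 0
    then show ?thesis by (simp add: delta_S_0 reduced_cochains_zero)
  next
    case (Suc m)
    have "degen q m j (S.D q m (F m q)) = \<zero>\<^bsub>cochains m q\<^esub>" if "j \<le> m" for j
    proof (rule S.s_D_zero[OF _ that])
      have n: "S.normal q m m (F m q)" using Fr by (simp flip: reduced_normal)
      \<comment> \<open>In degree \<open>m\<close> all codegeneracies have index below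
        \<open>m\<close>, so stage \<open>m\<close> implies every other stage.\<close>
      then show "S.normal q (Suc j) m (F m q)" by (auto simp: S.normal_def)
    qed
    then have "S.normal q p p (delta_S F p q)"
      using Suc Tot_at[OF FT] by (auto simp: S.normal_def delta_S_Suc S.D_closed)
    then show ?thesis by (simp add: reduced_normal)
  qed
  then show ?thesis using delta_S_closed[OF FT] by (simp add: reduced_def)
qed

lemma delta_S_asimplicial:
  assumes F: "F \<in> asimplicial"
  shows "delta_S F \<in> asimplicial"
proof -
  have "delta_S F p 0 = \<zero>\<^bsub>cochains p 0\<^esub>" for p
    using F additive_zero[OF cochains_group cochains_group S.D_additive]
    by (cases p) (auto simp: delta_S_0 delta_S_Suc asimplicial_def)
  then show ?thesis using F delta_S_closed by (simp add: asimplicial_def)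
qed

section \<open>The subcomplexes as graded submodules containing the multiplication\<close>

lemma Tot_submoduleI:
  assumes "S \<subseteq> carrier Tot" "\<zero>\<^bsub>Tot\<^esub> \<in> S" "\<And>F G. F \<in> S \<Longrightarrow> G \<in> S \<Longrightarrow> F \<oplus>\<^bsub>Tot\<^esub> G \<in> S"
    "\<And>r F. r \<in> carrier R \<Longrightarrow> F \<in> S \<Longrightarrow> r \<odot>\<^bsub>Tot\<^esub> F \<in> S"
  shows "submodule S R Tot"
proof (rule module.submoduleI[OF Tot_module])
  interpret T: module R Tot by (rule Tot_module)
  fix F assume "F \<in> S"
  then have "\<ominus>\<^bsub>Tot\<^esub> F = (\<ominus>\<^bsub>R\<^esub> \<one>\<^bsub>R\<^esub>) \<odot>\<^bsub>Tot\<^esub> F" using assms(1) by (auto simp: T.smult_l_minus)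
  then show "\<ominus>\<^bsub>Tot\<^esub> F \<in> S" using assms(4) \<open>F \<in> S\<close> by simp
qed (use assms in auto)

lemma asimplicial_submodule: "submodule asimplicial R Tot"
  using abelian_groupE(1,2)[OF Tot_group] module.smult_closed[OF Tot_module]
    abelian_monoid.l_zero[OF abelian_group.axioms(1)[OF cochains_group]] abelian_groupE(2)[OF cochains_group]
  by (intro Tot_submoduleI)
    (auto simp: asimplicial_def Tot_ops module.smult_r_null[OF cochains_module])

lemma reduced_submodule: "submodule reduced R Tot"
  using abelian_groupE(1,2)[OF Tot_group] module.smult_closed[OF Tot_module]
  by (intro Tot_submoduleI)
    (auto simp: reduced_def Tot_ops reduced_cochains_zero reduced_cochains_add reduced_cochains_smult)

lemma submodule_Int:
  assumes "submodule S R Tot" "submodule S' R Tot"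
  shows "submodule (S \<inter> S') R Tot"
  using module.submoduleE[OF Tot_module assms(1)] module.submoduleE[OF Tot_module assms(2)]
    subgroup.one_closed[OF submodule.axioms(1)[OF assms(1)]] subgroup.one_closed[OF submodule.axioms(1)[OF assms(2)]]
  by (intro Tot_submoduleI) auto

lemma component_Tot:
  assumes F: "F \<in> carrier Tot"
  shows "component m F \<in> carrier Tot"
  unfolding Tot_carrier
proof
  show "finite {(p, q). component m F p q \<noteq> \<zero>\<^bsub>cochains p q\<^esub>}"
    by (rule finite_subset[of _ "{(p, q). F p q \<noteq> \<zero>\<^bsub>cochains p q\<^esub>}"])
      (use F in \<open>auto simp: component_def Tot_carrier\<close>)
qed (use Tot_at[OF F] in \<open>auto simp: component_def abelian_groupE(2)[OF cochains_group]\<close>)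

lemma component_asimplicial: "F \<in> asimplicial \<Longrightarrow> component m F \<in> asimplicial"
  by (auto simp: asimplicial_def component_Tot) (auto simp: component_def)

lemma component_reduced: "F \<in> reduced \<Longrightarrow> component m F \<in> reduced"
  by (auto simp: reduced_def component_Tot) (auto simp: component_def reduced_cochains_zero)

lemma mhat_at: "mhat 0 2 \<in> carrier (cochains 0 2)"
proof -
  have "(\<lambda>as\<in>tuples (A x) 2. as ! 0 \<otimes>\<^bsub>A x\<^esub> as ! 1) \<in> carrier (multilinear_maps R (A x) (A x) 2)"
    if x: "x \<in> Ob C" for x
  proof -
    interpret nonunital_algebra R "A x" using x by (rule A_algebra)
    have i: "i < 2 \<longleftrightarrow> i = 0 \<or> i = 1" for i :: nat by auto
    have "as ! 0 \<in> carrier (A x) \<and> as ! 1 \<in> carrier (A x) \<and> length as = 2" if "as \<in> tuples (A x) 2" for as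
      using that by (auto simp: tuples_def subset_iff)
    then show ?thesis
      by (auto simp: multilinear_iff i linear_on_def additive_def tuples_update mult_closed
          mult_distrib_left mult_distrib_right smult_mult_left smult_mult_right)
  qed
  then show ?thesis
    by (auto simp: mhat_def cochains_carrier maps_at_def vert_Ob)
qed

lemma mhat_zero: "p \<noteq> 0 \<or> q \<noteq> 2 \<Longrightarrow> mhat p q = \<zero>\<^bsub>cochains p q\<^esub>"
  by (auto simp: mhat_def)

lemma mhat_Tot: "mhat \<in> carrier Tot"
  unfolding Tot_carrier
proof (intro conjI allI)
  show "mhat p q \<in> carrier (cochains p q)" for p q
    using mhat_at mhat_zero[of p q] abelian_groupE(2)[OF cochains_group] by (cases "p = 0 \<and> q = 2") auto
  show "finite {(p, q). mhat p q \<noteq> \<zero>\<^bsub>cochains p q\<^esub>}"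
    by (rule finite_subset[of _ "{(0, 2)}"]) (use mhat_zero in auto)
qed

lemma mhat_asimplicial: "mhat \<in> asimplicial"
  using mhat_Tot mhat_zero by (auto simp: asimplicial_def)

text \<open>The multiplication lives on strings of length 0, which contain no morphism at
  all.\<close>

lemma mhat_reduced: "mhat \<in> reduced"
proof -
  have "mhat p q \<in> reduced_cochains p q" for p q
  proof (cases p)
    case 0
    then show ?thesis using Tot_at[OF mhat_Tot, of 0 q] by (simp add: reduced_cochains_def)
  qed (simp add: mhat_zero reduced_cochains_zero)
  then show ?thesis using mhat_Tot by (simp add: reduced_def)
qed

end

text \<open>Both quilts of the Hochschild differential are a two-letter word over a one-edge tree;
  the parameters allow one computation for both.\<close>

definition two_tree :: "nat \<Rightarrow> nat \<Rightarrow> tree" where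
  "two_tree u v = \<lparr>edges = {(u, v)}, planar = {(1, 1), (2, 2)}\<rparr>"

lemma quilt_B_eq: "quilt_B = ([1, 2], two_tree 1 2)" "quilt_B' = ([2, 1], two_tree 2 1)"
  by (simp_all add: quilt_B_def quilt_B'_def two_tree_def)

context
  fixes u v :: nat
  assumes uv: "(u, v) \<in> {(1, 2), (2, 1)}"
begin

lemma uv_simps: "u \<noteq> v" "v \<noteq> u" "{1..2} = {u, v}" "{u, v} = {1, 2}"
  using uv by auto

lemma two_tree_less: "tree_less (two_tree u v) x y \<longleftrightarrow> x = u \<and> y = v"
proof -
  have "y = x \<or> x = u \<and> y = v" if "(x, y) \<in> {(u, v)}\<^sup>*"
    using that by (induction rule: rtrancl_induct) (auto simp: uv_simps)
  then show ?thesis by (auto simp: tree_less_def tree_le_def two_tree_def uv_simps)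
qed

lemma two_tree_le: "tree_le (two_tree u v) x y \<longleftrightarrow> x = y \<or> x = u \<and> y = v"
  using two_tree_less[of x y] by (auto simp: tree_less_def tree_le_def)

lemma two_tree_planar: "\<not> planar_less (two_tree u v) x y"
  by (auto simp: planar_less_def two_tree_def)

lemma two_tree_is_root: "is_root 2 (two_tree u v) r \<longleftrightarrow> r = u"
  unfolding is_root_def two_tree_less using uv by auto

lemma two_tree_trees: "two_tree u v \<in> trees 2"
proof -
  have "antisym ((edges (two_tree u v))\<^sup>*)"
    using two_tree_le by (auto simp: antisym_def tree_le_def uv_simps)
  moreover have "partial_order_on {1..2} (planar (two_tree u v))"
    by (auto simp: two_tree_def partial_order_on_def preorder_on_def refl_on_def trans_def antisym_def)
  moreover have "exactly_one [x = y, tree_less (two_tree u v) x y, tree_less (two_tree u v) y x,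
      planar_less (two_tree u v) x y, planar_less (two_tree u v) y x]"
    if "x \<in> {1..2}" "y \<in> {1..2}" for x y
  proof -
    have "x = u \<or> x = v" "y = u \<or> y = v" using that uv by auto
    then show ?thesis
      by (elim disjE) (simp_all add: exactly_one_def two_tree_less two_tree_planar uv_simps)
  qed
  moreover have "\<not> (tree_less (two_tree u v) x t \<and> tree_less (two_tree u v) t y)" for x y t
    using uv by (auto simp: two_tree_less)
  moreover have "edges (two_tree u v) \<subseteq> {1..2} \<times> {1..2}" "(x, x) \<notin> edges (two_tree u v)" for x
    using uv by (auto simp: two_tree_def)
  moreover have "\<exists>!r. is_root 2 (two_tree u v) r"
    by (simp add: two_tree_is_root)
  ultimately show ?thesis
    unfolding trees_def mem_Collect_eq using two_tree_planar by blast
qed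

lemma two_word: "[u, v] \<in> F2S 2"
  using uv_simps by (auto simp: F2S_def)

lemma two_quilt: "([u, v], two_tree u v) \<in> quilts 2"
proof -
  have "[u, v] ! i = u \<and> [u, v] ! j = v" if "i < j" "j < length [u, v]" for i j
    using that by (auto simp: less_Suc_eq)
  then show ?thesis
    using two_tree_trees two_word uv_simps by (auto simp: quilts_def two_tree_less less_Suc_eq)
qed

end

section \<open>Closure under the differential\<close>

context algebra_diagram
begin

lemma quilt_B_quilts: "quilt_B \<in> quilts 2" "quilt_B' \<in> quilts 2"
  unfolding quilt_B_eq by (rule two_quilt; simp)+

text \<open>The Hochschild part is a difference of two quilt operations with \<open>mhat\<close>
  inserted, so its closure follows from closure under quilts. The rule is applied to the whole
  complex, the reduced and the asimplicial one.\<close>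

lemma delta_closed:
  assumes S: "submodule S R Tot" and m: "mhat \<in> S" and F: "F \<in> S"
    and op: "\<And>n Q F. Q \<in> quilts n \<Longrightarrow> (\<And>a. a \<in> {1..n} \<Longrightarrow> F a \<in> S) \<Longrightarrow> total_op n Q F \<in> S"
    and dS: "delta_S F \<in> S"
  shows "delta_H F \<in> S" "delta F \<in> S"
proof -
  note E = module.submoduleE[OF Tot_module S]
  show "delta_H F \<in> S"
    unfolding delta_H_def a_minus_def using m F by (intro E op quilt_B_quilts) auto
  then show "delta F \<in> S" unfolding delta_def using dS by (intro E)
qed

lemma delta_Tot:
  assumes "F \<in> carrier Tot"
  shows "delta_H F \<in> carrier Tot" "delta F \<in> carrier Tot"
  by (rule delta_closed[OF module.carrier_is_submodule[OF Tot_module] mhat_Tot assms total_op_closed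
        delta_S_closed[OF assms]]; simp)+

lemma delta_reduced:
  assumes "F \<in> reduced"
  shows "delta_H F \<in> reduced" "delta F \<in> reduced"
  by (rule delta_closed[OF reduced_submodule mhat_reduced assms total_op_reduced delta_S_reduced[OF assms]]; simp)+

lemma delta_asimplicial:
  assumes "F \<in> asimplicial"
  shows "delta_H F \<in> asimplicial" "delta F \<in> asimplicial"
  by (rule delta_closed[OF asimplicial_submodule mhat_asimplicial assms total_op_asimplicial
        delta_S_asimplicial[OF assms]]; simp)+

lemma mQuilt_asimplicial: "mQuilt_subalgebra asimplicial"
  using asimplicial_submodule component_asimplicial mhat_asimplicial total_op_asimplicial delta_asimplicial(2)
  by (auto simp: mQuilt_subalgebra_def graded_subspace_def)

lemma mQuilt_reduced: "mQuilt_subalgebra reduced"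
  using reduced_submodule component_reduced mhat_reduced total_op_reduced delta_reduced(2)
  by (auto simp: mQuilt_subalgebra_def graded_subspace_def)

lemma mQuilt_Int: "mQuilt_subalgebra S \<Longrightarrow> mQuilt_subalgebra S' \<Longrightarrow> mQuilt_subalgebra (S \<inter> S')"
  by (auto simp: mQuilt_subalgebra_def graded_subspace_def submodule_Int)

end

section \<open>The Hochschild differential\<close>

text \<open>
  \<open>merge M i\<close> multiplies the entries \<open>i\<close> and \<open>i + 1\<close> (counted from 1); for \<open>i = 0\<close> it drops
  the first entry and for \<open>i\<close> equal to the length it drops the last one.
\<close>

definition merge :: "('k, 'a, 'd) module_scheme \<Rightarrow> nat \<Rightarrow> 'a list \<Rightarrow> 'a list" where
  "merge M i as = map (\<lambda>k. if Suc k < i then as ! k else if Suc k = i then as ! k \<otimes>\<^bsub>M\<^esub> as ! Suc k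
     else as ! Suc k) [0..<length as - 1]"

lemma length_merge: "length (merge M i as) = length as - 1"
  by (simp add: merge_def)

lemma nth_merge: "Suc k < length as \<Longrightarrow> merge M i as ! k =
  (if Suc k < i then as ! k else if Suc k = i then as ! k \<otimes>\<^bsub>M\<^esub> as ! Suc k else as ! Suc k)"
  by (simp add: merge_def)

lemma tuples_nth: "as \<in> tuples M q \<Longrightarrow> k < q \<Longrightarrow> as ! k \<in> carrier M"
  by (auto simp: tuples_def)

lemma tuples_length: "as \<in> tuples M q \<Longrightarrow> length as = q"
  by (simp add: tuples_def)

context nonunital_algebra
begin

lemma merge_tuples:
  assumes "as \<in> tuples M (Suc q)"
  shows "merge M i as \<in> tuples M q"
  using assms tuples_nth[OF assms]
  by (auto simp: tuples_def length_merge in_set_conv_nth nth_merge intro!: mult_closed)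

text \<open>For j = i + 1 the two merges meet in one entry and the claim there is associativity; in
  all other cases they act on separate positions.\<close>

lemma merge_merge:
  assumes as: "as \<in> tuples M (Suc (Suc q))" and ij: "i < j"
  shows "merge M i (merge M j as) = merge M (j - 1) (merge M i as)"
proof (rule nth_equalityI)
  fix k assume "k < length (merge M i (merge M j as))"
  then have k: "Suc (Suc k) < length as" by (simp add: length_merge)
  then have "as ! k \<in> carrier M" "as ! Suc k \<in> carrier M" "as ! Suc (Suc k) \<in> carrier M"
    using tuples_nth[OF as] tuples_length[OF as] by auto
  then show "merge M i (merge M j as) ! k = merge M (j - 1) (merge M i as) ! k"
    using k ij by (auto simp: nth_merge length_merge mult_assoc less_diff_conv)
qed (simp add: length_merge)

lemma mult_linear:
  assumes "a \<in> carrier M"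
  shows "linear_on R M M (\<lambda>x. a \<otimes>\<^bsub>M\<^esub> x)" "linear_on R M M (\<lambda>x. x \<otimes>\<^bsub>M\<^esub> a)"
  using assms by (auto simp: linear_on_def additive_def mult_closed mult_distrib_left mult_distrib_right
      smult_mult_left smult_mult_right)

lemma ident_linear: "linear_on R M M (\<lambda>x. x)"
  by (auto simp: linear_on_def additive_def)

text \<open>An entry that is not dropped enters one entry of the merged list, either as it is or
  multiplied by its neighbour, and both are linear.\<close>

lemma merge_update:
  assumes as: "as \<in> tuples M (Suc q)" and l: "l \<le> q"
    and nd: "\<not> (i = 0 \<and> l = 0)" "\<not> (i = Suc q \<and> l = q)" and i: "i \<le> Suc q"
  obtains l' h where "l' < q" "linear_on R M M h" "\<And>a. merge M i (as[l := a]) = (merge M i as)[l' := h a]"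
proof -
  note len = tuples_length[OF as]
  consider "Suc l < i" | "Suc l = i" | "l = i" | "i < l" by linarith
  then show thesis
  proof cases
    case 1
    show ?thesis
    proof (rule that[of l "\<lambda>a. a"])
      show "merge M i (as[l := a]) = (merge M i as)[l := a]" for a
        by (rule nth_equalityI) (use 1 len i in \<open>auto simp: length_merge nth_merge nth_list_update\<close>)
    qed (use 1 i ident_linear in simp_all)
  next
    case 2
    then have "i \<le> q" using nd i l by auto
    then have "as ! i \<in> carrier M" using tuples_nth[OF as] by auto
    show ?thesis
    proof (rule that[of l "\<lambda>a. a \<otimes>\<^bsub>M\<^esub> as ! i"])
      show "merge M i (as[l := a]) = (merge M i as)[l := a \<otimes>\<^bsub>M\<^esub> as ! i]" for a
        by (rule nth_equalityI) (use 2 len \<open>i \<le> q\<close> in \<open>auto simp: length_merge nth_merge nth_list_update\<close>)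
    qed (use 2 \<open>i \<le> q\<close> mult_linear \<open>as ! i \<in> carrier M\<close> in simp_all)
  next
    case 3
    then have "i \<ge> 1" using nd by auto
    then have "as ! (i - 1) \<in> carrier M" using tuples_nth[OF as] 3 l by auto
    show ?thesis
    proof (rule that[of "i - 1" "\<lambda>a. as ! (i - 1) \<otimes>\<^bsub>M\<^esub> a"])
      show "merge M i (as[l := a]) = (merge M i as)[i - 1 := as ! (i - 1) \<otimes>\<^bsub>M\<^esub> a]" for a
        by (rule nth_equalityI) (use 3 \<open>i \<ge> 1\<close> len l in \<open>auto simp: length_merge nth_merge nth_list_update\<close>)
    qed (use 3 \<open>i \<ge> 1\<close> l mult_linear(1)[OF \<open>as ! (i - 1) \<in> carrier M\<close>] in simp_all)
  next
    case 4
    show ?thesis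
    proof (rule that[of "l - 1" "\<lambda>a. a"])
      show "merge M i (as[l := a]) = (merge M i as)[l - 1 := a]" for a
        by (rule nth_equalityI) (use 4 len l in \<open>auto simp: length_merge nth_merge nth_list_update\<close>)
    qed (use 4 l ident_linear in simp_all)
  qed
qed

end

section \<open>Hochschild cofaces of cochains\<close>

context algebra_diagram
begin

text \<open>These are the classical cofaces of the Hochschild complex of A(x_p) with coefficients in
  A(x_0), which is a bimodule over A(x_p) through the transport along the whole string.\<close>

definition hoch :: "nat \<Rightarrow> nat \<Rightarrow> nat \<Rightarrow> ('o, 'm, 'a) cochain \<Rightarrow> ('o, 'm, 'a) cochain" where
  "hoch p q i f = (\<lambda>\<phi>\<in>strings p. \<lambda>as\<in>tuples (A (vert \<phi> p)) (Suc q).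
     let x = f \<phi> (merge (A (vert \<phi> p)) i as) in
       if i = 0 then transport \<phi> 0 p (as ! 0) \<otimes>\<^bsub>A (vert \<phi> 0)\<^esub> x
       else if i = Suc q then x \<otimes>\<^bsub>A (vert \<phi> 0)\<^esub> transport \<phi> 0 p (as ! q)
       else x)"

lemma hoch_value:
  assumes "\<phi> \<in> strings p" "as \<in> tuples (A (vert \<phi> p)) (Suc q)"
  shows "hoch p q i f \<phi> as = (let x = f \<phi> (merge (A (vert \<phi> p)) i as) in
       if i = 0 then transport \<phi> 0 p (as ! 0) \<otimes>\<^bsub>A (vert \<phi> 0)\<^esub> x
       else if i = Suc q then x \<otimes>\<^bsub>A (vert \<phi> 0)\<^esub> transport \<phi> 0 p (as ! q)
       else x)"
  using assms by (simp add: hoch_def)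

lemma hoch_closed:
  assumes f: "f \<in> carrier (cochains p q)" and i: "i \<le> Suc q"
  shows "hoch p q i f \<in> carrier (cochains p (Suc q))"
proof -
  have "hoch p q i f \<phi> \<in> carrier (maps_at p (Suc q) \<phi>)" if \<phi>: "\<phi> \<in> strings p" for \<phi>
    unfolding maps_at_def multilinear_iff
  proof (intro conjI ballI allI impI)
    let ?M = "A (vert \<phi> p)" and ?N = "A (vert \<phi> 0)"
    interpret M: nonunital_algebra R ?M by (rule A_algebra[OF vert_Ob[OF \<phi>]]) simp
    interpret N: nonunital_algebra R ?N by (rule A_algebra[OF vert_Ob[OF \<phi>]]) simp
    have tr: "linear_on R ?M ?N (transport \<phi> 0 p)" by (rule transport_linear[OF \<phi>]) auto
    note trc = additive_closed[OF linear_on_additive[OF tr]]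
    have fm: "f \<phi> \<in> carrier (multilinear_maps R ?M ?N q)"
      using cochain_at[OF f \<phi>] by (simp add: maps_at_def)
    have val: "hoch p q i f \<phi> as = (let x = f \<phi> (merge ?M i as) in
       if i = 0 then transport \<phi> 0 p (as ! 0) \<otimes>\<^bsub>?N\<^esub> x
       else if i = Suc q then x \<otimes>\<^bsub>?N\<^esub> transport \<phi> 0 p (as ! q)
       else x)" if "as \<in> tuples ?M (Suc q)" for as
      using \<phi> that by (rule hoch_value)
    have fc: "f \<phi> (merge ?M i as) \<in> carrier ?N" if "as \<in> tuples ?M (Suc q)" for as
      using multilinear_closed[OF fm] M.merge_tuples[OF that] by blast
    show "hoch p q i f \<phi> \<in> tuples ?M (Suc q) \<rightarrow>\<^sub>E carrier ?N"
    proof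
      fix as assume as: "as \<in> tuples ?M (Suc q)"
      then show "hoch p q i f \<phi> as \<in> carrier ?N"
        using trc tuples_nth[OF as] fc[OF as] by (auto simp: val Let_def intro!: N.mult_closed)
    next
      fix as assume "as \<notin> tuples ?M (Suc q)"
      then show "hoch p q i f \<phi> as = undefined" using \<phi> by (simp add: hoch_def)
    qed
    fix as l assume as: "as \<in> tuples ?M (Suc q)" and l: "l < Suc q"
    note upd = tuples_update[OF as]
    show "linear_on R ?M ?N (\<lambda>a. hoch p q i f \<phi> (as[l := a]))"
    \<comment> \<open>The entry dropped by an outer merge enters only through the transported
      factor; every other entry enters only through \<open>f\<close>.\<close>
    proof (cases "(i = 0 \<and> l = 0) \<or> (i = Suc q \<and> l = q)")
      case True
      have const: "merge ?M i (as[l := a]) = merge ?M i as" for a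
        by (rule nth_equalityI; use True tuples_length[OF as] in \<open>auto simp: length_merge nth_merge nth_list_update\<close>)
      show ?thesis
      proof (cases "i = 0")
        case True
        with \<open>_ \<or> _\<close> have "l = 0" by simp
        have "linear_on R ?M ?N (\<lambda>a. transport \<phi> 0 p a \<otimes>\<^bsub>?N\<^esub> f \<phi> (merge ?M i as))"
          by (rule linear_on_compose[OF tr N.mult_linear(2)[OF fc[OF as]]])
        then show ?thesis
          by (rule linear_on_cong[OF M.module_axioms])
            (subst val, erule upd, use True \<open>l = 0\<close> const tuples_length[OF as] in \<open>simp add: Let_def\<close>)
      next
        case False
        with \<open>_ \<or> _\<close> have *: "i = Suc q" "l = q" by auto
        have "linear_on R ?M ?N (\<lambda>a. f \<phi> (merge ?M i as) \<otimes>\<^bsub>?N\<^esub> transport \<phi> 0 p a)"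
          by (rule linear_on_compose[OF tr N.mult_linear(1)[OF fc[OF as]]])
        then show ?thesis
          by (rule linear_on_cong[OF M.module_axioms])
            (subst val, erule upd, use * const tuples_length[OF as] in \<open>simp add: Let_def\<close>)
      qed
    next
      case False
      obtain l' h where l': "l' < q" and h: "linear_on R ?M ?M h"
        and m: "\<And>a. merge ?M i (as[l := a]) = (merge ?M i as)[l' := h a]"
        using M.merge_update[OF as, of l i] False i l by (metis less_Suc_eq_le)
      have lin: "linear_on R ?M ?N (\<lambda>a. f \<phi> (merge ?M i (as[l := a])))"
        unfolding m by (rule linear_on_compose[OF h multilinear_linear[OF fm M.merge_tuples[OF as] l']])
      consider "i = 0" | "i = Suc q" | "i \<noteq> 0" "i \<noteq> Suc q" by blast
      then show ?thesis
      proof cases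
        case 1
        then have "l \<noteq> 0" using False by auto
        have "linear_on R ?M ?N (\<lambda>a. transport \<phi> 0 p (as ! 0) \<otimes>\<^bsub>?N\<^esub> f \<phi> (merge ?M i (as[l := a])))"
          by (rule linear_on_compose[OF lin N.mult_linear(1)[OF trc]])
            (simp add: tuples_nth[OF as])
        then show ?thesis
          by (rule linear_on_cong[OF M.module_axioms])
            (subst val, erule upd, use 1 \<open>l \<noteq> 0\<close> in \<open>simp add: Let_def\<close>)
      next
        case 2
        then have "l \<noteq> q" using False by auto
        have "linear_on R ?M ?N (\<lambda>a. f \<phi> (merge ?M i (as[l := a])) \<otimes>\<^bsub>?N\<^esub> transport \<phi> 0 p (as ! q))"
          by (rule linear_on_compose[OF lin N.mult_linear(2)[OF trc]])
            (simp add: tuples_nth[OF as])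
        then show ?thesis
          by (rule linear_on_cong[OF M.module_axioms])
            (subst val, erule upd, use 2 \<open>l \<noteq> q\<close> in \<open>simp add: Let_def\<close>)
      next
        case 3
        then show ?thesis
          by (intro linear_on_cong[OF M.module_axioms lin]) (simp add: val upd Let_def)
      qed
    qed
  qed
  moreover have "hoch p q i f \<in> extensional (strings p)" by (simp add: hoch_def)
  ultimately show ?thesis by (auto simp: cochains_carrier PiE_iff)
qed

lemma hoch_additive: 
  assumes i: "i \<le> Suc q"
  shows "additive (cochains p q) (cochains p (Suc q)) (hoch p q i)"
proof (rule additiveI)
  fix f g assume f: "f \<in> carrier (cochains p q)" and g: "g \<in> carrier (cochains p q)"
  note plus = abelian_groupE(1)[OF cochains_group]
  show "hoch p q i (f \<oplus>\<^bsub>cochains p q\<^esub> g) = hoch p q i f \<oplus>\<^bsub>cochains p (Suc q)\<^esub> hoch p q i g"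
  proof (rule cochain_eqI)
    fix \<phi> as assume \<phi>: "\<phi> \<in> strings p" and as: "as \<in> tuples (A (vert \<phi> p)) (Suc q)"
    interpret M: nonunital_algebra R "A (vert \<phi> p)" by (rule A_algebra[OF vert_Ob[OF \<phi>]]) simp
    interpret N: nonunital_algebra R "A (vert \<phi> 0)" by (rule A_algebra[OF vert_Ob[OF \<phi>]]) simp
    note m = M.merge_tuples[OF as]
    have t: "transport \<phi> 0 p (as ! 0) \<in> carrier (A (vert \<phi> 0))" "transport \<phi> 0 p (as ! q) \<in> carrier (A (vert \<phi> 0))"
      by (intro transport_closed[OF \<phi>] tuples_nth[OF as]; simp)+
    show "hoch p q i (f \<oplus>\<^bsub>cochains p q\<^esub> g) \<phi> as = (hoch p q i f \<oplus>\<^bsub>cochains p (Suc q)\<^esub> hoch p q i g) \<phi> as"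
      using f g t by (simp add: additive_add[OF cochain_evaluation_additive[OF \<phi> as]]
          additive_add[OF cochain_evaluation_additive[OF \<phi> m]] hoch_closed i hoch_value[OF \<phi> as] Let_def
          cochain_value[OF _ \<phi> m] N.mult_distrib_left N.mult_distrib_right)
  qed (use f g i hoch_closed plus in auto)
qed (use hoch_closed i in auto)

text \<open>The merges of the arguments agree by \<open>merge_merge\<close>. Where outer cofaces are
  involved, associativity in A(x_0) and multiplicativity of the transport account for the outer
  factors.\<close>

lemma hoch_hoch:
  assumes ij: "i < j" "j \<le> Suc (Suc q)" and f: "f \<in> carrier (cochains p q)"
  shows "hoch p (Suc q) j (hoch p q i f) = hoch p (Suc q) i (hoch p q (j - 1) f)"
proof (rule cochain_eqI)
  fix \<phi> as assume \<phi>: "\<phi> \<in> strings p" and as: "as \<in> tuples (A (vert \<phi> p)) (Suc (Suc q))"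
  let ?M = "A (vert \<phi> p)" and ?N = "A (vert \<phi> 0)"
  interpret M: nonunital_algebra R "A (vert \<phi> p)" by (rule A_algebra[OF vert_Ob[OF \<phi>]]) simp
  interpret N: nonunital_algebra R "A (vert \<phi> 0)" by (rule A_algebra[OF vert_Ob[OF \<phi>]]) simp
  note m = M.merge_tuples[OF as]
  define y where "y = f \<phi> (merge ?M (j - 1) (merge ?M i as))"
  have y: "y \<in> carrier ?N"
    unfolding y_def by (intro cochain_value[OF f \<phi>] M.merge_tuples as)
  have t: "as ! k \<in> carrier ?M" "transport \<phi> 0 p (as ! k) \<in> carrier ?N" if "k \<le> Suc q" for k
    using that tuples_nth[OF as, of k] by (auto intro!: transport_closed[OF \<phi>])
  have nth: "merge ?M i as ! k =
      (if Suc k < i then as ! k else if Suc k = i then as ! k \<otimes>\<^bsub>?M\<^esub> as ! Suc k else as ! Suc k)"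
    if "k \<le> q" for k i
    using that tuples_length[OF as] by (intro nth_merge) simp
  show "hoch p (Suc q) j (hoch p q i f) \<phi> as = hoch p (Suc q) i (hoch p q (j - 1) f) \<phi> as"
    unfolding hoch_value[OF \<phi> as] hoch_value[OF \<phi> m] Let_def M.merge_merge[OF as ij(1)] y_def[symmetric]
    using ij y t[of 0] t[of "Suc 0"] t[of q] t[of "Suc q"]
    by (auto simp: nth transport_mult[OF \<phi>] N.mult_assoc)
qed (use ij f hoch_closed in auto)

sublocale H: precosimplicial "\<lambda>q. cochains p q" "\<lambda>q. hoch p q" for p
  by (intro precosimplicial.intro cochains_group hoch_additive hoch_hoch)

section \<open>Compatibility of the two cosimplicial directions\<close>

lemma merge_map_transport:
  assumes \<phi>: "\<phi> \<in> strings p" and kl: "k \<le> l" "l \<le> p" and as: "as \<in> tuples (A (vert \<phi> l)) (Suc q)"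
  shows "merge (A (vert \<phi> k)) i (map (transport \<phi> k l) as) = map (transport \<phi> k l) (merge (A (vert \<phi> l)) i as)"
proof (rule nth_equalityI)
  fix j assume "j < length (merge (A (vert \<phi> k)) i (map (transport \<phi> k l) as))"
  then have j: "Suc j < length as" by (simp add: length_merge)
  then have "as ! j \<in> carrier (A (vert \<phi> l))" "as ! Suc j \<in> carrier (A (vert \<phi> l))"
    using tuples_nth[OF as] tuples_length[OF as] by auto
  then show "merge (A (vert \<phi> k)) i (map (transport \<phi> k l) as) ! j = map (transport \<phi> k l) (merge (A (vert \<phi> l)) i as) ! j"
    using j by (auto simp: nth_merge length_merge transport_mult[OF \<phi> kl])
qed (simp add: length_merge)

text \<open>Transports are multiplicative and compose, so they respect the bimodule structure.
  Applied to cofaces and codegeneracies, this makes both commute with the Hochschild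
  direction.\<close>

lemma push_hoch:
  assumes \<theta>: "mono_on {0..p} \<theta>" "\<theta> p \<le> p'" and i: "i \<le> Suc q" and f: "f \<in> carrier (cochains p q)"
  shows "push p p' \<theta> (Suc q) (hoch p q i f) = hoch p' q i (push p p' \<theta> q f)"
proof (rule cochain_eqI)
  show "push p p' \<theta> (Suc q) (hoch p q i f) \<in> carrier (cochains p' (Suc q))"
    by (intro push_closed \<theta> hoch_closed f i)
  show "hoch p' q i (push p p' \<theta> q f) \<in> carrier (cochains p' (Suc q))"
    by (intro push_closed \<theta> hoch_closed f i)
  fix \<phi> as assume \<phi>: "\<phi> \<in> strings p'" and as: "as \<in> tuples (A (vert \<phi> p')) (Suc q)"
  interpret M: nonunital_algebra R "A (vert \<phi> p')" by (rule A_algebra[OF vert_Ob[OF \<phi>]]) simp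
  note ps = pull_strings[OF \<phi> \<theta>] and pv = pull_vert[OF \<phi> \<theta>] and sg = pull_segment[OF \<phi> \<theta>]
  have le: "\<theta> 0 \<le> \<theta> p" "\<theta> 0 \<le> p'" using \<theta> mono_on_le[of p \<theta> 0 p] by auto
  have mt: "map (transport \<phi> (\<theta> p) p') as \<in> tuples (A (vert (pull p \<theta> \<phi>) p)) (Suc q)"
    using tuples_transport[OF \<phi> \<theta>(2) _ as] by (simp add: pv)
  note mas = M.merge_tuples[OF as]
  have t: "as ! k \<in> carrier (A (vert \<phi> p'))" "transport \<phi> (\<theta> 0) p' (as ! k) \<in> carrier (A (vert \<phi> (\<theta> 0)))" if "k \<le> q" for k
    using that tuples_nth[OF as, of k] le by (auto intro!: transport_closed[OF \<phi>])
  have y: "f (pull p \<theta> \<phi>) (map (transport \<phi> (\<theta> p) p') (merge (A (vert \<phi> p')) i as)) \<in> carrier (A (vert \<phi> (\<theta> 0)))" for i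
    using cochain_value[OF f ps, of "map (transport \<phi> (\<theta> p) p') (merge (A (vert \<phi> p')) i as)"]
      tuples_transport[OF \<phi> \<theta>(2) _ mas] by (simp add: pv)
  show "push p p' \<theta> (Suc q) (hoch p q i f) \<phi> as = hoch p' q i (push p p' \<theta> q f) \<phi> as"
    using t[of 0] t[of q] y le \<theta>(2) tuples_length[OF as]
    by (simp add: push_value[OF \<phi> as] push_value[OF \<phi> mas] hoch_value[OF \<phi> as] hoch_value[OF ps mt] Let_def
        pv sg merge_map_transport[OF \<phi> \<theta>(2) order_refl as] transport_transport[OF \<phi>] transport_mult[OF \<phi>])
qed

lemma push_H_D:
  assumes \<theta>: "mono_on {0..p} \<theta>" "\<theta> p \<le> p'" and f: "f \<in> carrier (cochains p q)"
  shows "push p p' \<theta> (Suc q) (H.D p q f) = H.D p' q (push p p' \<theta> q f)"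
proof -
  interpret G: abelian_group "cochains p' (Suc q)" by (rule cochains_group)
  note hom = cochains_group cochains_group push_additive[OF \<theta>, of "Suc q"]
  have "push p p' \<theta> (Suc q) (H.D p q f) =
      (\<Oplus>\<^bsub>cochains p' (Suc q)\<^esub>i\<in>{0..Suc q}. push p p' \<theta> (Suc q) (alt (cochains p (Suc q)) i (hoch p q i f)))"
    unfolding H.D_def using f by (intro additive_finsum[OF hom]) (auto intro!: H.alt_closed' hoch_closed)
  also have "\<dots> = H.D p' q (push p p' \<theta> q f)"
    unfolding H.D_def using f
    by (intro G.finsum_cong') (auto simp: additive_alt[OF hom] hoch_closed push_hoch[OF \<theta>] push_closed[OF \<theta>] intro!: G.alt_closed)
  finally show ?thesis .
qed

lemma S_D_H_D:
  assumes f: "f \<in> carrier (cochains p q)"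
  shows "S.D (Suc q) p (H.D p q f) = H.D (Suc p) q (S.D q p f)"
proof -
  interpret G: abelian_group "cochains (Suc p) (Suc q)" by (rule cochains_group)
  note hom = cochains_group cochains_group H.D_additive[of "Suc p" q]
  have comm: "delta_S_comp p (Suc q) i (H.D p q f) = H.D (Suc p) q (delta_S_comp p q i f)" for i
    using f by (simp add: delta_S_comp_push push_H_D mono_coface coface_le)
  have "H.D (Suc p) q (S.D q p f) =
    (\<Oplus>\<^bsub>cochains (Suc p) (Suc q)\<^esub>i\<in>{0..Suc p}. H.D (Suc p) q (alt (cochains (Suc p) q) i (delta_S_comp p q i f)))"
    unfolding S.D_def using f by (intro additive_finsum[OF hom]) (auto intro!: S.alt_closed' S.d_closed)
  also have "\<dots> = S.D (Suc q) p (H.D p q f)"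
    unfolding S.D_def using f
    by (intro G.finsum_cong') (auto simp: additive_alt[OF hom] S.d_closed H.D_closed comm intro!: G.alt_closed)
  finally show ?thesis by simp
qed

end

section \<open>The quilts of the Hochschild differential\<close>

subsection \<open>Signs of rotations\<close>

text \<open>In a word without repeated letters the position of each letter determines the
  permutation, so the definite description can be evaluated.\<close>

lemma rearrangement_sign_eq:
  assumes "distinct xs" "\<sigma> permutes {..<length xs}" "permute_list \<sigma> xs = ys"
  shows "rearrangement_sign xs ys = sign \<sigma>"
proof -
  have "(THE \<tau>. \<tau> permutes {..<length xs} \<and> permute_list \<tau> xs = ys) = \<sigma>"
  proof (rule the_equality)
    fix \<tau> assume \<tau>: "\<tau> permutes {..<length xs} \<and> permute_list \<tau> xs = ys"
    show "\<tau> = \<sigma>"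
    proof
      fix i show "\<tau> i = \<sigma> i"
      proof (cases "i < length xs")
        case True
        have "xs ! \<tau> i = xs ! \<sigma> i"
          using \<tau> assms(2,3) True by (metis permute_list_nth)
        moreover have "\<tau> i < length xs" "\<sigma> i < length xs"
          using \<tau> assms(2) True permutes_in_image by (metis lessThan_iff)+
        ultimately show ?thesis using assms(1) by (simp add: nth_eq_iff_index_eq)
      next
        case False
        then have "i \<notin> {..<length xs}" by simp
        then show ?thesis using \<tau> assms(2) by (metis permutes_not_in)
      qed
    qed
  qed (use assms in simp)
  then show ?thesis by (simp add: rearrangement_sign_def)
qed

text \<open>In the convention of \<open>permute_list\<close> this cycle carries the letter at
  position 0 to position \<open>k\<close>, past \<open>k\<close> other letters; it is a product of
  \<open>k\<close> adjacent transpositions.\<close>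

definition rotation :: "nat \<Rightarrow> nat \<Rightarrow> nat" where
  "rotation k i = (if i < k then Suc i else if i = k then 0 else i)"

lemma rotation_0: "rotation 0 = id"
  by (simp add: rotation_def fun_eq_iff)

lemma rotation_Suc: "rotation (Suc k) = rotation k \<circ> transpose k (Suc k)"
  by (auto simp: rotation_def fun_eq_iff transpose_def)

lemma rotation_permutes: "k < n \<Longrightarrow> rotation k permutes {..<n}"
proof (induction k)
  case (Suc k)
  then show ?case
    unfolding rotation_Suc by (intro permutes_compose permutes_swap_id) auto
qed (simp add: rotation_0 permutes_id)

lemma sign_rotation: "sign (rotation k) = (-1) ^ k"
proof (induction k)
  case (Suc k)
  have "permutation (rotation k)"
    using rotation_permutes[of k "Suc k"] permutes_imp_permutation[of "{..<Suc k}"] by simp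
  then have "sign (rotation (Suc k)) = sign (rotation k) * sign (transpose k (Suc k))"
    unfolding rotation_Suc by (intro sign_compose permutation_swap_id)
  then show ?case using Suc by (simp add: sign_swap_id)
qed (simp add: rotation_0)

text \<open>This is the only sign that the Hochschild differential requires: the multiplication
  contributes the single letter \<open>Hor 1 1\<close>, the first one of the initial word, and no
  other letters change their relative order.\<close>

lemma rearrangement_sign_rotation:
  assumes "distinct (x # xs @ ys)"
  shows "rearrangement_sign (x # xs @ ys) (xs @ x # ys) = (-1) ^ length xs"
proof -
  have "permute_list (rotation (length xs)) (x # xs @ ys) = xs @ x # ys"
  proof (rule nth_equalityI)
    fix i assume "i < length (permute_list (rotation (length xs)) (x # xs @ ys))"
    then have i: "i < Suc (length xs + length ys)" by simp
    have "permute_list (rotation (length xs)) (x # xs @ ys) ! i = (x # xs @ ys) ! rotation (length xs) i"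
      using i by (intro permute_list_nth rotation_permutes) auto
    also have "\<dots> = (xs @ x # ys) ! i"
      using i by (auto simp: rotation_def nth_append nth_Cons' Suc_diff_le)
    finally show "permute_list (rotation (length xs)) (x # xs @ ys) ! i = (xs @ x # ys) ! i" .
  qed simp
  then show ?thesis
    using rearrangement_sign_eq[OF assms rotation_permutes] by (simp add: sign_rotation)
qed

subsection \<open>Colorings of two-vertex quilts\<close>

text \<open>Induction from the left end gives k \<le> f k, induction from the right end gives f k
  \<le> k.\<close>

lemma strict_mono_on_id:
  fixes f :: "nat \<Rightarrow> nat"
  assumes f: "strict_mono_on {0..p} f" "f \<in> {0..p} \<rightarrow> {0..p}" and k: "k \<le> p"
  shows "f k = k"
proof -
  have 1: "i \<le> f i" if "i \<le> p" for i
    using that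
  proof (induction i)
    case (Suc i)
    then have "i \<le> f i" "f i < f (Suc i)" using strict_mono_onD[OF f(1), of i "Suc i"] by auto
    then show ?case by simp
  qed simp
  have 2: "f (p - i) \<le> p - i" if "i \<le> p" for i
    using that
  proof (induction i)
    case 0
    then show ?case using f(2) by auto
  next
    case (Suc i)
    then have "f (p - i) \<le> p - i" "f (p - Suc i) < f (p - i)"
      using strict_mono_onD[OF f(1), of "p - Suc i" "p - i"] by auto
    then show ?case using Suc.prems by simp
  qed
  show ?thesis using 1[OF k] 2[of "p - k"] k by simp
qed

text \<open>
  In both quilts, vertex 1 carries the multiplication, of bidegree \<open>(0, 2)\<close>, and vertex 2 a
  cochain of bidegree \<open>(p, q)\<close>.
\<close>

definition bideg :: "nat \<Rightarrow> nat \<Rightarrow> nat \<Rightarrow> nat" where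
  "bideg x y = (\<lambda>a\<in>{1..2}. if a = 1 then x else y)"

lemma bideg_simps: "bideg x y 1 = x" "bideg x y (Suc 0) = x" "bideg x y 2 = y"
  by (simp_all add: bideg_def)

lemma bideg_sum: "(\<Sum>a=1..2. bideg x y a) = x + y"
  by (simp add: bideg_def numeral_2_eq_2)

lemma bideg_sum': "sum (bideg x y) {Suc 0..2} = x + y"
  using bideg_sum by simp

lemma one_two: "{1..2} = {1, 2::nat}"
  by auto

locale two_vertex =
  fixes u v p q :: nat
  assumes uv: "(u, v) \<in> {(1, 2), (2, 1)}"
begin

abbreviation "P \<equiv> bideg 0 p"
abbreviation "Qd \<equiv> bideg 2 q"

lemma uv_cases: "u = 1 \<and> v = 2 \<or> u = 2 \<and> v = 1"
  using uv by auto

lemma uv_simps': "u \<noteq> v" "v \<noteq> u" "u \<in> {1..2}" "v \<in> {1..2}" "{1..2} = {u, v}"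
  using uv by auto

text \<open>Vertex 2 fills all of [p]. Vertex 1 has a single value, at the left end if it comes
  first in the word and at the right end if it comes last.\<close>

definition Z :: "nat \<Rightarrow> nat \<Rightarrow> nat" where
  "Z = (\<lambda>a\<in>{1..2}. \<lambda>k\<in>{0..P a}. if a = 1 then (if u = 1 then 0 else p) else k)"

lemma Z_ext: "Z \<in> (\<Pi>\<^sub>E a\<in>{1..2}. {0..P a} \<rightarrow>\<^sub>E {0..p})"
proof (rule PiE_I)
  fix a :: nat assume "a \<in> {1..2}"
  then have "a = 1 \<or> a = 2" by auto
  then show "Z a \<in> {0..P a} \<rightarrow>\<^sub>E {0..p}" by (elim disjE) (auto simp: Z_def bideg_simps)
qed (auto simp: Z_def)

lemma deg: "word_deg 2 [u, v] = 0"
  by (simp add: word_deg_def)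

lemma Z_clr: "Z \<in> clr_word 2 [u, v] P"
proof -
  \<comment> \<open>Each vertex occurs once in the word, so its occurrence map has to be
    constant.\<close>
  define \<pi> where "\<pi> = (\<lambda>a\<in>{1..2}. \<lambda>k\<in>{0..P a}. if a = u then 0 else 1::nat)"
  have o: "occurrences [u, v] a = {if a = u then 0 else 1}" if "a \<in> {1..2}" for a
    using that uv_cases by (auto simp: occurrences_def less_Suc_eq nth_Cons')
  have fib: "fibre P Z \<pi> a i = (if i = (if a = u then 0 else 1) then Z a ` {0..P a} else {})"
    if "a \<in> {1..2}" for a i
    using that by (auto simp: fibre_def \<pi>_def)
  have Z1: "Z 1 ` {0..P 1} = {if u = 1 then 0 else p}" and Z2: "Z 2 ` {0..P 2} = {0..p}"
    by (auto simp: Z_def bideg_simps)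
  have int: "\<exists>l u. Z a ` {0..P a} = {l..u}" if "a \<in> {1..2}" for a
  proof -
    have "Z 1 ` {0..P 1} = {(if u = 1 then 0 else p)..(if u = 1 then 0 else p)}" using Z1 by simp
    then show ?thesis using Z2 that unfolding one_two by blast
  qed
  have "occurrence_map 2 [u, v] P Z \<pi>"
    unfolding occurrence_map_def
  proof (intro conjI ballI allI impI)
    show "\<pi> \<in> (\<Pi>\<^sub>E a\<in>{1..2}. {0..P a} \<rightarrow>\<^sub>E {..<length [u, v]})"
      by (auto simp: \<pi>_def)
    show "\<pi> a ` {0..P a} = occurrences [u, v] a" if "a \<in> {1..2}" for a
      using that by (auto simp: o \<pi>_def image_iff)
    show "\<exists>l u. fibre P Z \<pi> a i = {l..u}" if "a \<in> {1..2}" "i \<in> occurrences [u, v] a" for a i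
      using that int by (simp add: fib o)
    fix i assume "Suc i < length [u, v]"
    then have "i = 0" by simp
    moreover have "Min {0..p} = 0" "Max {0..p} = p" by (auto intro: Min_eqI Max_eqI)
    ultimately show "Max (fibre P Z \<pi> ([u, v] ! i) i) = Min (fibre P Z \<pi> ([u, v] ! Suc i) (Suc i))"
      using uv_cases uv_simps' Z1 Z2 by (auto simp: fib)
  qed
  moreover have "strict_mono_on {0..P a} (Z a)" if "a \<in> {1..2}" for a
    using that by (cases "a = 1") (auto simp: one_two Z_def bideg_simps strict_mono_on_def)
  moreover have "(\<Union>a\<in>{1..2}. Z a ` {0..P a}) = {0..p}"
    unfolding one_two using Z1 Z2 by auto
  ultimately show ?thesis
    using Z_ext by (auto simp: clr_word_def deg bideg_sum')
qed

lemma clr_word_two: "clr_word 2 [u, v] P = {Z}"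
proof (intro equalityI subsetI)
  fix \<zeta> assume \<zeta>: "\<zeta> \<in> clr_word 2 [u, v] P"
  have ext: "\<zeta> \<in> (\<Pi>\<^sub>E a\<in>{1..2}. {0..P a} \<rightarrow>\<^sub>E {0..p})"
    using \<zeta> by (simp add: clr_word_def deg bideg_sum')
  obtain \<pi> p' where *: "p' + word_deg 2 [u, v] = (\<Sum>a=1..2. P a)"
    "\<And>a. a \<in> {1..2} \<Longrightarrow> \<zeta> a \<in> {0..P a} \<rightarrow> {0..p'}"
    "\<And>a. a \<in> {1..2} \<Longrightarrow> strict_mono_on {0..P a} (\<zeta> a)"
    "(\<Union>a\<in>{1..2}. \<zeta> a ` {0..P a}) = {0..p'}" "occurrence_map 2 [u, v] P \<zeta> \<pi>"
    by (rule clr_wordD[OF \<zeta>]) (rule that)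
  have p': "p' = p" using *(1) by (simp add: deg bideg_sum')
  have cw: "colored_word 2 [u, v] P \<zeta> \<pi> p'"
    using * two_word[OF uv] by unfold_locales auto
  have edge: "\<zeta> u (P u) \<le> \<zeta> v 0"
    by (rule colored_word_edge[OF cw two_quilt[OF uv]]) (simp add: two_tree_def)
  have 2: "\<zeta> 2 k = k" if "k \<le> p" for k
    using *(2,3)[of 2] that by (intro strict_mono_on_id[of p]) (auto simp: bideg_simps p')
  \<comment> \<open>The edge inequality bounds this value by 0 from above when the multiplication is
    the root, and by \<open>p\<close> from below when it is the child; the range does the
    rest.\<close>
  have 1: "\<zeta> 1 0 = (if u = 1 then 0 else p)"
    using edge uv_cases 2[of 0] 2[of p] *(2)[of 1] by (auto simp: bideg_simps p' Pi_iff)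
  have "\<zeta> = Z"
  proof (rule PiE_ext[OF ext])
    show "Z \<in> (\<Pi>\<^sub>E a\<in>{1..2}. {0..P a} \<rightarrow>\<^sub>E {0..p})" by (rule Z_ext)
    fix a :: nat assume a: "a \<in> {1..2}"
    show "\<zeta> a = Z a"
    proof (rule PiE_ext[of _ "{0..P a}" "\<lambda>_. {0..p}"])
      show "\<zeta> a \<in> {0..P a} \<rightarrow>\<^sub>E {0..p}" using ext a by blast
      show "Z a \<in> {0..P a} \<rightarrow>\<^sub>E {0..p}" using Z_ext a by blast
      fix k assume k: "k \<in> {0..P a}"
      have "a = 1 \<or> a = 2" using a by auto
      then show "\<zeta> a k = Z a k"
        using k 1 2 by (auto simp: Z_def bideg_simps)
    qed
  qed
  then show "\<zeta> \<in> {Z}" by simp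
qed (use Z_clr in simp)

definition J :: "nat \<Rightarrow> nat \<times> nat \<Rightarrow> nat" where
  "J i = (\<lambda>e\<in>{(u, v)}. i)"

lemma edges_two: "edges (two_tree u v) = {(u, v)}"
  by (simp add: two_tree_def)

lemma clr_tree_two: "clr_tree (two_tree u v) Qd = J ` {1..Qd u}"
proof (intro equalityI subsetI)
  fix I assume "I \<in> clr_tree (two_tree u v) Qd"
  then have I: "I \<in> {(u, v)} \<rightarrow>\<^sub>E UNIV" "1 \<le> I (u, v)" "I (u, v) \<le> Qd u"
    by (auto simp: clr_tree_def edges_two)
  have "I = J (I (u, v))"
    by (rule PiE_ext[OF I(1)]) (auto simp: J_def)
  then show "I \<in> J ` {1..Qd u}" using I(2,3) by (intro image_eqI[of _ _ "I (u, v)"]) auto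
next
  fix I assume "I \<in> J ` {1..Qd u}"
  moreover have "J i \<in> {(u, v)} \<rightarrow>\<^sub>E UNIV" "J i (u, v) = i" for i
    by (simp_all add: J_def)
  ultimately show "I \<in> clr_tree (two_tree u v) Qd"
    by (auto simp: clr_tree_def edges_two two_tree_planar[OF uv])
qed

lemma J_inj: "inj_on J A"
  by (auto simp: inj_on_def J_def fun_eq_iff)

lemma root_two: "tree_root 2 (two_tree u v) = u"
  unfolding tree_root_def by (rule the_equality) (simp_all add: two_tree_is_root[OF uv])

lemma input_child_u: "input_child (two_tree u v) (J i) u j = (if j = i then Some v else None)"
  by (auto simp: input_child_def edges_two J_def)

lemma input_child_v: "input_child (two_tree u v) (J i) v j = None"
  using uv_simps' by (auto simp: input_child_def edges_two)

lemma children_two: "children (two_tree u v) u = [v]" "children (two_tree u v) v = []"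
proof -
  have "cs = [v]" if "set cs = {v}" "sorted_wrt (planar_less (two_tree u v)) cs" for cs
  proof (cases cs)
    case (Cons x xs)
    then show ?thesis using that two_tree_planar[OF uv] by (cases xs) auto
  qed (use that in simp)
  then show "children (two_tree u v) u = [v]"
    unfolding children_def edges_two by (intro the_equality) auto
  show "children (two_tree u v) v = []"
    unfolding children_def edges_two using uv_simps' by (intro the_equality) auto
qed

text \<open>Hence the coloring is never extended in the definition of the sign, although vertex 1
  has simplicial degree 0.\<close>

lemma not_interposed: "\<not> interposed [u, v] a"
  by (auto simp: interposed_def)

lemma vertical_two: "vertical_letters 2 [u, v] P Z = map (Ver 2) [0..<p]"
proof -
  have "(THE x. \<exists>a i. x = Ver a i \<and> a \<in> {1..2} \<and> i < P a \<and> (interposed [u, v] a \<longrightarrow> 1 \<le> i) \<and> Z a i = j) = Ver 2 j"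
    if "j < p" for j
  proof (rule the_equality)
    show "\<exists>a i. Ver 2 j = Ver a i \<and> a \<in> {1..2} \<and> i < P a \<and> (interposed [u, v] a \<longrightarrow> 1 \<le> i) \<and> Z a i = j"
      using that by (simp add: not_interposed bideg_simps Z_def)
    fix x assume "\<exists>a i. x = Ver a i \<and> a \<in> {1..2} \<and> i < P a \<and> (interposed [u, v] a \<longrightarrow> 1 \<le> i) \<and> Z a i = j"
    then obtain a i where x: "x = Ver a i" "a \<in> {1..2}" "i < P a" "Z a i = j" by blast
    then have "a = 2" by (cases "a = 1") (auto simp: bideg_simps)
    then show "x = Ver 2 j" using x by (auto simp: Z_def bideg_simps)
  qed
  then show ?thesis by (simp add: vertical_letters_def deg bideg_sum')
qed

text \<open>The corner word is u, v, u, so the letters of \<open>v\<close> interrupt those of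
  \<open>u\<close> at the input that carries the edge.\<close>

lemma horizontal_two:
  "horizontal_letters 2 (two_tree u v) r (J i) = map (Hor u) [1..<i] @ map (Hor v) [1..<r v] @ map (Hor u) [i..<r u]"
proof -
  have "corner_word (two_tree u v) 2 u = [u, v, u]"
    by (simp add: numeral_2_eq_2 children_two)
  then show ?thesis
    using uv_simps'(1,2) by (simp add: horizontal_letters_def root_two Let_def J_def)
qed

text \<open>The letter of the multiplication passes the \<open>p\<close> vertical letters of the
  cochain and then a number of its horizontal letters: all of them for the first input of the root
  1, none for the second, and i - 1 of them if 2 is the root.\<close>

lemma coloring_sign_two:
  assumes i: "1 \<le> i" "i \<le> Qd u"
  shows "coloring_sign 2 ([u, v], two_tree u v) P Qd Z (J i) =
    (if u = 1 then (if i = 1 then (-1) ^ Suc (p + q) else (-1) ^ p) else (-1) ^ (p + i - 1))"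
proof -
  define r where "r a = (if Qd a = 0 then 2 else Qd a)" for a
  have r: "r 1 = 2" "r (Suc 0) = 2" "r 2 = (if q = 0 then 2 else q)" by (simp_all add: r_def bideg_simps)
  have upts: "[1..<Suc 2] = [1, 2]" and upts': "[Suc 0..<2] = [Suc 0]"
    by (simp_all add: numeral_2_eq_2)
  have init: "initial_word 2 P r = Hor 1 1 # map (Ver 2) [0..<p] @ map (Hor 2) [1..<r 2]"
    unfolding initial_word_def upts by (simp add: bideg_simps r upts')
  have "coloring_sign 2 ([u, v], two_tree u v) P Qd Z (J i) =
    rearrangement_sign (initial_word 2 P r) (shuffled_word 2 ([u, v], two_tree u v) P r Z (J i))"
    by (simp add: coloring_sign_def not_interposed r_def[abs_def] Let_def)
  also have "shuffled_word 2 ([u, v], two_tree u v) P r Z (J i) =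
      map (Ver 2) [0..<p] @ map (Hor u) [1..<i] @ map (Hor v) [1..<r v] @ map (Hor u) [i..<r u]"
    by (simp add: shuffled_word_def interposed_letters_def not_interposed vertical_two horizontal_two)
  also have "rearrangement_sign (initial_word 2 P r) \<dots> =
    (if u = 1 then (if i = 1 then (-1) ^ Suc (p + q) else (-1) ^ p) else (-1) ^ (p + i - 1))"
  proof -
    have distinct: "distinct (Hor 1 1 # (map (Ver 2) [0..<p] @ map (Hor 2) [1..<k]) @ map (Hor 2) [k..<l])"
      if "1 \<le> k" for k l
      using that by (auto simp: distinct_map inj_on_def)
    consider "u = 1" "v = 2" "i = 1" | "u = 1" "v = 2" "i = 2" | "u = 2" "v = 1"
      using uv_cases i by (auto simp: bideg_simps le_Suc_eq numeral_2_eq_2)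
    then show ?thesis
    proof cases
      case 1
      \<comment> \<open>If q = 0 is replaced by 2, one horizontal letter is present, which has the
        parity of q - 1 as required.\<close>
      have "even (p + (r 2 - 1)) \<longleftrightarrow> odd (p + q)" unfolding r by (cases q) auto
      then show ?thesis
        using rearrangement_sign_rotation[of "Hor 1 1" "map (Ver 2) [0..<p] @ map (Hor 2) [1..<r 2]" "[]"]
          distinct[of "r 2" "r 2"] 1 r
        by (simp add: init upts' minus_one_power_iff)
    next
      case 2
      show ?thesis
        using rearrangement_sign_rotation[of "Hor 1 1" "map (Ver 2) [0..<p]" "map (Hor 2) [1..<r 2]"]
          distinct[of 1 "r 2"] 2 r
        by (simp add: init upts')
    next
      case 3
      then have q: "i \<le> q" "r 2 = q" using i r by (auto simp: bideg_simps)
      have "[1..<q] = [1..<i] @ [i..<q]" using i q upt_add_eq_append[of 1 i "q - i"] by simp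
      then show ?thesis
        using rearrangement_sign_rotation[of "Hor 1 1" "map (Ver 2) [0..<p] @ map (Hor 2) [1..<i]" "map (Hor 2) [i..<q]"]
          distinct[of i q] 3 r q i
        by (simp add: init upts')
    qed
  qed
  finally show ?thesis .
qed

end

context algebra_diagram
begin

subsection \<open>The action of two-vertex quilts\<close>

lemma mhat_value:
  "\<psi> \<in> strings 0 \<Longrightarrow> x \<in> carrier (A (vert \<psi> 0)) \<Longrightarrow> y \<in> carrier (A (vert \<psi> 0)) \<Longrightarrow>
    mhat 0 2 \<psi> [x, y] = x \<otimes>\<^bsub>A (vert \<psi> 0)\<^esub> y"
  by (simp add: mhat_def tuples_def)

text \<open>In planar order the inputs are those of \<open>u\<close> before the edge, those of
  \<open>v\<close>, and those of \<open>u\<close> after it. Reading \<open>as\<close> in this order,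
  the arguments of the cochain form a merged list.\<close>

lemma coloring_action_two:
  assumes uv: "(u, v) \<in> {(1, 2), (2, 1)}" and \<phi>: "\<phi> \<in> strings p" and fc: "f \<in> carrier (cochains p q)"
    and as: "as \<in> tuples (A (vert \<phi> p)) (Suc q)" and i: "1 \<le> i" "i \<le> bideg 2 q u"
    and g: "g 1 = mhat 0 2" "g 2 = f"
  shows "coloring_action 2 (two_tree u v) (bideg 0 p) (bideg 2 q) (two_vertex.Z u p) (two_vertex.J u v i) g \<phi> as
    = hoch p q (if u = 1 then (if i = 1 then Suc q else 0) else i) f \<phi> as"
proof -
  interpret two_vertex u v p q using uv by unfold_locales
  have J: "J i \<in> clr_tree (two_tree u v) Qd" using i by (simp add: clr_tree_two)
  have fac: "g a \<in> carrier (cochains (P a) (Qd a))" if "a \<in> {1..2}" for a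
    using that fc mhat_at unfolding one_two by (auto simp: g g(1)[simplified] bideg_simps)
  interpret evaluation C R A Am 2 "two_tree u v" Qd "J i" P Z g p \<phi>
    by (rule evaluation_of_quilt(1)[OF two_quilt[OF uv] Z_clr J fac]) (simp_all add: deg bideg_sum' \<phi>)
  have Z: "Z 2 k = k" if "k \<le> p" for k using that by (simp add: Z_def bideg_simps)
  have Z1: "Z (Suc 0) 0 = (if u = 1 then 0 else p)" by (simp add: Z_def bideg_simps)
  have pull2: "pull p (Z 2) \<phi> = \<phi>"
    using pull_cong[of p "Z 2" "\<lambda>k. k" \<phi>] Z pull_ident[OF \<phi>] by simp
  have le1: "Z (Suc 0) 0 \<le> p" by (simp add: Z1)
  have m0: "mono_on {0..0} \<zeta>" for \<zeta> :: "nat \<Rightarrow> nat" by (simp add: mono_on_def)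
  have pull1: "pull 0 (Z (Suc 0)) \<phi> \<in> strings 0" "vert (pull 0 (Z (Suc 0)) \<phi>) 0 = vert \<phi> (if u = 1 then 0 else p)"
    using pull_strings[OF \<phi> m0, of "Z (Suc 0)"] pull_vert[OF \<phi> m0, of "Z (Suc 0)"] le1 Z1 by auto
  have split: "[1..<Suc (Qd u)] = [1..<i] @ i # [Suc i..<Suc (Qd u)]"
  proof -
    have "[1..<Suc (Qd u)] = [1..<i] @ [i..<Suc (Qd u)]"
      using i upt_add_eq_append[of 1 i "Suc (Qd u) - i"] by simp
    then show ?thesis using i by (simp add: upt_conv_Cons del: upt_Suc)
  qed
  have inputs: "inputs = map (Pair u) [1..<i] @ map (Pair v) [1..<Suc (Qd v)] @ map (Pair u) [Suc i..<Suc (Qd u)]"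
  proof -
    have v: "free_inputs (two_tree u v) (J i) Qd (Suc 0) v = map (Pair v) [1..<Suc (Qd v)]"
      by (simp add: free_inputs.simps(2) input_child_v del: upt_Suc)
    have "inputs = concat (map (\<lambda>j. inputs_at (Suc 0) u j) [1..<Suc (Qd u)])"
      using free_inputs.simps(2)[of "two_tree u v" "J i" Qd "Suc 0" u]
      by (simp add: root_two flip: numeral_2_eq_2)
    also have "\<dots> = concat (map (\<lambda>j. inputs_at (Suc 0) u j) [1..<i]) @ inputs_at (Suc 0) u i @ 
        concat (map (\<lambda>j. inputs_at (Suc 0) u j) [Suc i..<Suc (Qd u)])"
      unfolding split by simp
    also have "map (\<lambda>j. inputs_at (Suc 0) u j) [1..<i] = map (\<lambda>j. [(u, j)]) [1..<i]"
      by (rule map_cong[OF refl]) (auto simp: input_child_u)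
    also have "map (\<lambda>j. inputs_at (Suc 0) u j) [Suc i..<Suc (Qd u)] = map (\<lambda>j. [(u, j)]) [Suc i..<Suc (Qd u)]"
      by (rule map_cong[OF refl]) (auto simp: input_child_u simp del: upt_Suc)
    finally show ?thesis by (simp add: input_child_u v del: upt_Suc)
  qed
  have lin: "length inputs = Suc q"
    using length_root_inputs bideg_sum[of 2 q] by simp
  note len = tuples_length[OF as]
  have env: "env_of as (inputs ! k) = as ! k" if "k \<le> q" for k
    using that lin len by (simp add: env_of_def map_of_zip_nth free_inputs_distinct)
  have env_low: "env_of as (u, j) = as ! (j - 1)" if "1 \<le> j" "j < i" for j
  proof -
    have "j - 1 \<le> q" using that lin i inputs by (auto simp del: upt_Suc)
    moreover have "j - 1 < i - 1" using that by simp
    then have "inputs ! (j - 1) = (u, j)" using that by (simp add: inputs nth_append del: upt_Suc)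
    ultimately show ?thesis using env[of "j - 1"] by simp
  qed
  have env_mid: "env_of as (v, j) = as ! (i - 1 + (j - 1))" if "1 \<le> j" "j \<le> Qd v" for j
  proof -
    have "i - 1 + (j - 1) \<le> q" using that lin i inputs by (auto simp del: upt_Suc)
    moreover have "inputs ! (i - 1 + (j - 1)) = (v, j)"
    proof -
      obtain j' where "j = Suc j'" using \<open>1 \<le> j\<close> by (cases j) auto
      then show ?thesis using that by (simp add: inputs nth_append del: upt_Suc)
    qed
    ultimately show ?thesis using env[of "i - 1 + (j - 1)"] by simp
  qed
  \<comment> \<open>The position is i - 1 inputs before the edge, all inputs of \<open>v\<close>,
    and j - i - 1 further inputs of \<open>u\<close>. In the summed form the truncated subtraction
    is exact, as j is at least 2.\<close>
  have env_high: "env_of as (u, j) = as ! (Qd v + j - 2)" if "i < j" "j \<le> Qd u" for j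
  proof -
    have "Qd v + j - 2 \<le> q" using that lin i inputs by (auto simp del: upt_Suc)
    moreover have "inputs ! (Qd v + j - 2) = (u, j)"
    proof -
      obtain j' where j': "j = Suc (i + j')" using \<open>i < j\<close> by (auto simp: less_iff_Suc_add)
      have "Qd v + j - 2 = i - 1 + (Qd v + j')" using j' i by simp
      moreover have "inputs ! (i - 1 + (Qd v + j')) = (u, j)"
        using that j' by (simp add: inputs nth_append del: upt_Suc)
      ultimately show ?thesis by simp
    qed
    ultimately show ?thesis using env[of "Qd v + j - 2"] by simp
  qed
  have c: "as ! k \<in> carrier (A (vert \<phi> p))" if "k \<le> q" for k
    using that tuples_nth[OF as] by simp
  have tp: "transport \<phi> p p (as ! k) = as ! k" if "k \<le> q" for k
    using transport_refl[OF \<phi> order_refl c[OF that]] .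
  have t0: "transport \<phi> 0 p (as ! k) \<in> carrier (A (vert \<phi> 0))" if "k \<le> q" for k
    using c[OF that] by (intro transport_closed[OF \<phi>]) auto
  interpret M: nonunital_algebra R "A (vert \<phi> p)" by (rule A_algebra[OF vert_Ob[OF \<phi>]]) simp
  interpret N: nonunital_algebra R "A (vert \<phi> 0)" by (rule A_algebra[OF vert_Ob[OF \<phi>]]) simp
  have fm: "f \<phi> (merge (A (vert \<phi> p)) k as) \<in> carrier (A (vert \<phi> 0))" for k
    by (rule cochain_value[OF fc \<phi> M.merge_tuples[OF as]])
  have two_args: "args k env w = [arg k env w 1, arg k env w 2]" if "w = 1" for k env w
  proof -
    have "[1..<Suc 2] = [1, 2]" by (simp add: numeral_2_eq_2)
    then show ?thesis using that by (simp add: args_def bideg_simps del: upt_Suc)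
  qed
  have ev2: "ev 2 e x = g x (pull (P x) (Z x) \<phi>) (args 1 e x)" for e x
    using ev_Suc[of e 1 x] by (simp flip: numeral_2_eq_2)
  have ev1: "ev 1 e x = g x (pull (P x) (Z x) \<phi>) (args 0 e x)" for e x
    using ev_Suc[of e 0 x] by simp
  have t00: "transport \<phi> 0 0 x = x" if "x \<in> carrier (A (vert \<phi> 0))" for x
    using transport_refl[OF \<phi> _ that] by simp
  show ?thesis
  proof (cases "u = 1")
    case True
    then have v: "v = 2" using uv by auto
    have V: "P v = p" "Qd v = q" "g v = f" by (simp_all add: v bideg_simps g g(1)[simplified])
    have U: "P u = 0" "Qd u = 2" "g u = mhat 0 2" by (simp_all add: True bideg_simps g g(1)[simplified])
    have Zv: "Z v k = k" if "k \<le> p" for k using Z[OF that] v by simp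
    have Zu: "Z u 0 = 0" using Z1 True by simp
    have pullv: "pull p (Z v) \<phi> = \<phi>" using pull2 v by simp
    have pullu: "pull 0 (Z u) \<phi> \<in> strings 0" "vert (pull 0 (Z u) \<phi>) 0 = vert \<phi> 0"
      using pull1 True by simp_all
    have ev: "ev 1 (env_of as) v = f \<phi> (args 0 (env_of as) v)"
      by (simp only: ev1 V pullv)
    have a: "arg 0 (env_of as) v j = as ! (i - 1 + (j - 1))" if "1 \<le> j" "j \<le> q" for j
    proof -
      have "i - 1 + (j - 1) \<le> q" using that i U by simp
      then show ?thesis
        using that env_mid[of j] input_child_v[of i j] by (simp add: arg_def V Zv tp)
    qed
    have evu: "ev 2 (env_of as) u = mhat 0 2 (pull 0 (Z u) \<phi>) [arg 1 (env_of as) u 1, arg 1 (env_of as) u 2]"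
      by (simp only: ev2 U two_args[OF True])
    have act: "coloring_action 2 (two_tree u v) P Qd Z (J i) g \<phi> as = transport \<phi> 0 0 (ev 2 (env_of as) u)"
      using coloring_action_ev[of as] by (simp add: root_two Zu)
    define L where "L = args 0 (env_of as) v"
    have Ll: "length L = q" by (simp add: L_def length_args V)
    have Ln: "L ! k = as ! (i - 1 + k)" if "k < q" for k
      using a[of "Suc k"] that by (simp add: L_def nth_args V)
    consider "i = 1" | "i = 2" using i U by (auto simp: le_Suc_eq numeral_2_eq_2)
    then show ?thesis
    proof cases
      case 1
      \<comment> \<open>The first input of the product receives the cochain on all entries but the
        last, which becomes the right factor.\<close>
      have "L = merge (A (vert \<phi> p)) (Suc q) as"
        by (rule nth_equalityI) (use 1 Ll Ln len in \<open>auto simp: length_merge nth_merge\<close>)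
      then have ev': "ev 1 (env_of as) v = f \<phi> (merge (A (vert \<phi> p)) (Suc q) as)" by (simp only: ev L_def)
      have ic: "input_child (two_tree u v) (J i) u 1 = Some v" "input_child (two_tree u v) (J i) u 2 = None"
        using 1 by (simp_all add: input_child_u)
      have 11: "arg 1 (env_of as) u 1 = f \<phi> (merge (A (vert \<phi> p)) (Suc q) as)"
        unfolding arg_def ic option.case using fm by (simp only: ev' U Zu Zv[OF le0] t00)
      have "env_of as (u, 2) = as ! q" using env_high[of 2] 1 U V by simp
      then have 12: "arg 1 (env_of as) u 2 = transport \<phi> 0 p (as ! q)"
        unfolding arg_def ic option.case by (simp only: U Zu)
      have "ev 2 (env_of as) u = f \<phi> (merge (A (vert \<phi> p)) (Suc q) as) \<otimes>\<^bsub>A (vert \<phi> 0)\<^esub> transport \<phi> 0 p (as ! q)"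
        unfolding evu 11 12 using mhat_value[OF pullu(1)] fm t0[of q] pullu(2) by simp
      with act have "coloring_action 2 (two_tree u v) P Qd Z (J i) g \<phi> as =
          f \<phi> (merge (A (vert \<phi> p)) (Suc q) as) \<otimes>\<^bsub>A (vert \<phi> 0)\<^esub> transport \<phi> 0 p (as ! q)"
        using fm t0[of q] t00 by (simp add: N.mult_closed)
      then show ?thesis using True 1 by (simp add: hoch_value[OF \<phi> as])
    next
      case 2
      \<comment> \<open>Now the second input carries the cochain, and the first entry becomes the
        left factor.\<close>
      have "L = merge (A (vert \<phi> p)) 0 as"
        by (rule nth_equalityI) (use 2 Ll Ln len in \<open>auto simp: length_merge nth_merge\<close>)
      then have ev': "ev 1 (env_of as) v = f \<phi> (merge (A (vert \<phi> p)) 0 as)" by (simp only: ev L_def)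
      have ic: "input_child (two_tree u v) (J i) u 1 = None" "input_child (two_tree u v) (J i) u 2 = Some v"
        using 2 by (simp_all add: input_child_u)
      have 12: "arg 1 (env_of as) u 2 = f \<phi> (merge (A (vert \<phi> p)) 0 as)"
        unfolding arg_def ic option.case using fm by (simp only: ev' U Zu Zv[OF le0] t00)
      have "env_of as (u, 1) = as ! 0" using env_low[of 1] 2 by simp
      then have 11: "arg 1 (env_of as) u 1 = transport \<phi> 0 p (as ! 0)"
        unfolding arg_def ic option.case by (simp only: U Zu)
      have "ev 2 (env_of as) u = transport \<phi> 0 p (as ! 0) \<otimes>\<^bsub>A (vert \<phi> 0)\<^esub> f \<phi> (merge (A (vert \<phi> p)) 0 as)"
        unfolding evu 11 12 using mhat_value[OF pullu(1)] fm t0[of 0] pullu(2) by simp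
      with act have "coloring_action 2 (two_tree u v) P Qd Z (J i) g \<phi> as =
          transport \<phi> 0 p (as ! 0) \<otimes>\<^bsub>A (vert \<phi> 0)\<^esub> f \<phi> (merge (A (vert \<phi> p)) 0 as)"
        using fm t0[of 0] t00 by (simp add: N.mult_closed)
      then show ?thesis using True 2 by (simp add: hoch_value[OF \<phi> as])
    qed
  next
    case False
    then have uv2: "u = 2" "v = 1" using uv by auto
    have U: "P u = p" "Qd u = q" "g u = f" by (simp_all add: uv2 bideg_simps g g(1)[simplified])
    have V: "P v = 0" "Qd v = 2" "g v = mhat 0 2" by (simp_all add: uv2 bideg_simps g g(1)[simplified])
    have Zu: "Z u k = k" if "k \<le> p" for k using Z[OF that] uv2 by simp
    have Zv: "Z v 0 = p" using Z1 uv2 by simp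
    have pullu: "pull p (Z u) \<phi> = \<phi>" using pull2 uv2 by simp
    have pullv: "pull 0 (Z v) \<phi> \<in> strings 0" "vert (pull 0 (Z v) \<phi>) 0 = vert \<phi> p"
      using pull1 uv2 by simp_all
    have iq: "i \<le> q" using i U by simp
    have "arg 0 (env_of as) v j = as ! (i - 1 + (j - 1))" if "1 \<le> j" "j \<le> 2" for j
    proof -
      have "i - 1 + (j - 1) \<le> q" using that i iq by simp
      then show ?thesis
        using that env_mid[of j] input_child_v[of i j] by (simp add: arg_def V Zv tp)
    qed
    from this[of 1] this[of 2] have "args 0 (env_of as) v = [as ! (i - 1), as ! i]"
      using i(1) by (simp add: two_args[OF uv2(2)])
    then have ev: "ev 1 (env_of as) v = as ! (i - 1) \<otimes>\<^bsub>A (vert \<phi> p)\<^esub> as ! i"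
      using mhat_value[OF pullv(1)] pullv(2) c[of i] c[of "i - 1"] iq by (simp add: ev1 V del: One_nat_def)
    have a: "arg 1 (env_of as) u j =
        (if j < i then as ! (j - 1) else if j = i then as ! (i - 1) \<otimes>\<^bsub>A (vert \<phi> p)\<^esub> as ! i else as ! j)"
      if "1 \<le> j" "j \<le> q" for j
    proof -
      consider "j < i" | "j = i" | "i < j" by linarith
      then show ?thesis
      proof cases
        case 2
        have "input_child (two_tree u v) (J i) u j = Some v" using 2 by (simp add: input_child_u)
        then have "arg 1 (env_of as) u j = transport \<phi> p p (as ! (i - 1) \<otimes>\<^bsub>A (vert \<phi> p)\<^esub> as ! i)"
          by (simp only: arg_def option.case U Zv Zu[OF order_refl] ev)
        also have "\<dots> = as ! (i - 1) \<otimes>\<^bsub>A (vert \<phi> p)\<^esub> as ! i"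
          using c[of i] c[of "i - 1"] iq by (intro transport_refl[OF \<phi>] M.mult_closed) auto
        finally show ?thesis using 2 by simp
      qed (use that input_child_u[of i j] env_low[of j] env_high[of j] tp[of "j - 1"] tp[of j] V in
          \<open>auto simp: arg_def U Zu\<close>)
    qed
    define L where "L = args 1 (env_of as) u"
    have Ll: "length L = q" by (simp add: L_def length_args U)
    have Ln: "L ! k = (if Suc k < i then as ! k else if Suc k = i
        then as ! (i - 1) \<otimes>\<^bsub>A (vert \<phi> p)\<^esub> as ! i else as ! Suc k)" if "k < q" for k
      using a[of "Suc k"] that by (simp add: L_def nth_args U)
    \<comment> \<open>With the multiplication on top of input \<open>i\<close>, two neighbouring
      entries are multiplied in A(x_p) before the cochain is applied.\<close>
    have "L = merge (A (vert \<phi> p)) i as"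
      by (rule nth_equalityI) (use Ll Ln len in \<open>auto simp: length_merge nth_merge\<close>)
    then have "ev 2 (env_of as) u = f \<phi> (merge (A (vert \<phi> p)) i as)"
      by (simp only: ev2 U pullu L_def)
    then have "coloring_action 2 (two_tree u v) P Qd Z (J i) g \<phi> as = f \<phi> (merge (A (vert \<phi> p)) i as)"
      using coloring_action_ev[of as] fm by (simp add: root_two Zu t00)
    then show ?thesis
      using False iq i by (simp add: hoch_value[OF \<phi> as])
  qed
qed

end

context algebra_diagram
begin

lemma quilt_op_two:
  assumes uv: "(u, v) \<in> {(1, 2), (2, 1)}" and \<phi>: "\<phi> \<in> strings p" and f: "f \<in> carrier (cochains p q)"
    and as: "as \<in> tuples (A (vert \<phi> p)) (Suc q)" and g: "g 1 = mhat 0 2" "g 2 = f"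
  shows "quilt_op 2 ([u, v], two_tree u v) (bideg 0 p) (bideg 2 q) g \<phi> as =
    (\<Oplus>\<^bsub>A (vert \<phi> 0)\<^esub>i\<in>{1..bideg 2 q u}.
      [(if u = 1 then (if i = 1 then (-1) ^ Suc (p + q) else (-1) ^ p) else (-1) ^ (p + i - 1) :: int)]
        \<cdot>\<^bsub>A (vert \<phi> 0)\<^esub> hoch p q (if u = 1 then (if i = 1 then Suc q else 0) else i) f \<phi> as)"
    (is "_ = (\<Oplus>\<^bsub>?N\<^esub>i\<in>?I. ?t i)")
proof -
  interpret two_vertex u v p q using uv by unfold_locales
  interpret N: abelian_group ?N by (rule A_group[OF vert_Ob[OF \<phi>]]) simp
  have hc: "hoch p q (if u = 1 then (if i = 1 then Suc q else 0) else i) f \<phi> as \<in> carrier ?N" if "i \<in> ?I" for i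
  proof (rule cochain_value[OF hoch_closed[OF f] \<phi> as])
    show "(if u = 1 then (if i = 1 then Suc q else 0) else i) \<le> Suc q"
      using that uv_cases by (auto simp: bideg_simps)
  qed
  have act: "[coloring_sign 2 ([u, v], two_tree u v) P Qd Z (J i)] \<cdot>\<^bsub>?N\<^esub> coloring_action 2 (two_tree u v) P Qd Z (J i) g \<phi> as = ?t i"
    if "i \<in> ?I" for i
    using that coloring_action_two[where g = g, OF uv \<phi> f as _ _ g] coloring_sign_two[of i] by simp
  have tc: "?t i \<in> carrier ?N" if "i \<in> ?I" for i
    using hc[OF that] by (rule N.int_pow_closed)
  have "quilt_op 2 ([u, v], two_tree u v) P Qd g \<phi> as = (\<Oplus>\<^bsub>?N\<^esub>\<zeta>\<in>{Z}. \<Oplus>\<^bsub>?N\<^esub>I\<in>J ` ?I.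
      [coloring_sign 2 ([u, v], two_tree u v) P Qd \<zeta> I] \<cdot>\<^bsub>?N\<^esub> coloring_action 2 (two_tree u v) P Qd \<zeta> I g \<phi> as)"
    using \<phi> as by (simp add: quilt_op_def deg bideg_sum' clr_word_two clr_tree_two Let_def)
  also have "\<dots> = (\<Oplus>\<^bsub>?N\<^esub>I\<in>J ` ?I.
      [coloring_sign 2 ([u, v], two_tree u v) P Qd Z I] \<cdot>\<^bsub>?N\<^esub> coloring_action 2 (two_tree u v) P Qd Z I g \<phi> as)"
  proof -
    have "(\<Oplus>\<^bsub>?N\<^esub>I\<in>J ` ?I. [coloring_sign 2 ([u, v], two_tree u v) P Qd Z I] \<cdot>\<^bsub>?N\<^esub>
        coloring_action 2 (two_tree u v) P Qd Z I g \<phi> as) \<in> carrier ?N"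
      using act tc by (intro N.finsum_in_carrier) auto
    then show ?thesis by simp
  qed
  also have "\<dots> = (\<Oplus>\<^bsub>?N\<^esub>i\<in>?I. [coloring_sign 2 ([u, v], two_tree u v) P Qd Z (J i)] \<cdot>\<^bsub>?N\<^esub>
        coloring_action 2 (two_tree u v) P Qd Z (J i) g \<phi> as)"
    by (rule N.finsum_reindex) (use act tc J_inj in auto)
  also have "\<dots> = (\<Oplus>\<^bsub>?N\<^esub>i\<in>?I. ?t i)"
    by (rule N.finsum_cong') (use act tc in auto)
  finally show ?thesis .
qed

section \<open>The Hochschild differential on the total complex\<close>

lemma bidegrees_finite: "finite (bidegrees n d p' q')"
proof -
  have "bidegrees n d p' q' \<subseteq> (\<Pi>\<^sub>E a\<in>{1..n}. {..p' + d}) \<times> (\<Pi>\<^sub>E a\<in>{1..n}. {..q' + n})"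
  proof
    fix x assume "x \<in> bidegrees n d p' q'"
    then obtain p q where x: "x = (p, q)" "p \<in> {1..n} \<rightarrow>\<^sub>E UNIV" "q \<in> {1..n} \<rightarrow>\<^sub>E UNIV"
      "p' + d = sum p {1..n}" "q' + n = 1 + sum q {1..n}"
      by (auto simp: bidegrees_def)
    have "p a \<le> p' + d \<and> q a \<le> q' + n" if "a \<in> {1..n}" for a
      using member_le_sum[of a "{1..n}" p] member_le_sum[of a "{1..n}" q] x that by auto
    then show "x \<in> (\<Pi>\<^sub>E a\<in>{1..n}. {..p' + d}) \<times> (\<Pi>\<^sub>E a\<in>{1..n}. {..q' + n})"
      using x(1,2,3) by (auto simp: PiE_iff)
  qed
  moreover have "finite \<dots>" by (intro finite_cartesian_product finite_PiE) auto
  ultimately show ?thesis by (rule finite_subset)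
qed

text \<open>The multiplication is zero outside bidegree (0, 2), which fixes the bidegree of the
  other factor. Total input number 0 is impossible, because the multiplication alone has two inputs
  and loses at most one.\<close>

lemma total_op_two:
  assumes uv: "(u, v) \<in> {(1, 2), (2, 1)}" and F: "F \<in> carrier Tot"
  defines "G \<equiv> (\<lambda>a::nat. if a = 1 then mhat else F)"
  shows "total_op 2 ([u, v], two_tree u v) G p 0 = \<zero>\<^bsub>cochains p 0\<^esub>"
    and "total_op 2 ([u, v], two_tree u v) G p (Suc q) =
      quilt_op 2 ([u, v], two_tree u v) (bideg 0 p) (bideg 2 q) (\<lambda>a. G a (bideg 0 p a) (bideg 2 q a))"
proof -
  let ?Q = "([u, v], two_tree u v)"
  note Q = two_quilt[OF uv]
  have G: "G a \<in> carrier Tot" if "a \<in> {1..2}" for a using F mhat_Tot by (simp add: G_def)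
  have deg: "word_deg 2 (fst ?Q) = 0" by (simp add: word_deg_def)
  have sum2: "sum r {Suc 0..2} = r 1 + r 2" for r :: "nat \<Rightarrow> nat" by (simp add: numeral_2_eq_2)
  have mz: "\<exists>v\<in>{1..2}. G v (x v) (y v) = \<zero>\<^bsub>cochains (x v) (y v)\<^esub>" if "x 1 \<noteq> 0 \<or> y 1 \<noteq> 2" for x y
    using mhat_zero[OF that] by (intro bexI[of _ 1]) (simp_all add: G_def)
  show "total_op 2 ?Q G p 0 = \<zero>\<^bsub>cochains p 0\<^esub>"
  proof (rule total_op_eq_zero[OF Q G])
    fix x y assume "(x, y) \<in> bidegrees 2 (word_deg 2 (fst ?Q)) p 0"
    then have "y 1 \<noteq> 2" by (simp add: bidegrees_def sum2)
    then show "\<exists>v\<in>{1..2}. G v (x v) (y v) = \<zero>\<^bsub>cochains (x v) (y v)\<^esub>" by (intro mz) simp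
  qed auto
  interpret K: abelian_group "cochains p (Suc q)" by (rule cochains_group)
  let ?t = "\<lambda>(x, y). quilt_op 2 ?Q x y (\<lambda>a. G a (x a) (y a))"
  let ?x0 = "(bideg 0 p, bideg 2 q)"
  have x0: "?x0 \<in> bidegrees 2 (word_deg 2 (fst ?Q)) p (Suc q)"
    unfolding deg by (simp add: bidegrees_def bideg_sum') (simp add: bideg_def)
  have t0: "?t ?x0 \<in> carrier (cochains p (Suc q))"
    using quilt_term_closed[OF Q G x0] by simp
  have z: "?t z = \<zero>\<^bsub>cochains p (Suc q)\<^esub>" if z: "z \<in> bidegrees 2 (word_deg 2 (fst ?Q)) p (Suc q) - {?x0}" for z
  proof -
    obtain x y where [simp]: "z = (x, y)" by (cases z)
    have xy: "(x, y) \<in> bidegrees 2 (word_deg 2 (fst ?Q)) p (Suc q)" using z by simp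
    have "x 1 \<noteq> 0 \<or> y 1 \<noteq> 2"
    proof (rule ccontr)
      assume "\<not> (x 1 \<noteq> 0 \<or> y 1 \<noteq> 2)"
      then have *: "x 1 = 0" "y 1 = 2" by auto
      then have 2: "x 2 = p" "y 2 = q" using xy unfolding deg by (auto simp: bidegrees_def sum2)
      have "x a = bideg 0 p a \<and> y a = bideg 2 q a" for a
      proof (cases "a \<in> {1..2}")
        case True
        then have "a = 1 \<or> a = 2" by auto
        then show ?thesis using * 2 by (auto simp: bideg_simps)
      next
        case False
        have "x \<in> {1..2} \<rightarrow>\<^sub>E UNIV" "y \<in> {1..2} \<rightarrow>\<^sub>E UNIV"
          using xy by (simp_all add: bidegrees_def)
        from this[THEN PiE_arb, OF False] show ?thesis using False by (auto simp: bideg_def)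
      qed
      then have "x = bideg 0 p" "y = bideg 2 q" by auto
      then show False using z by simp
    qed
    then obtain w where "w \<in> {1..2}" "G w (x w) (y w) = \<zero>\<^bsub>cochains (x w) (y w)\<^esub>" using mz by blast
    then show ?thesis using quilt_term_zero[OF Q G xy] by simp
  qed
  have "total_op 2 ?Q G p (Suc q) = finsum (cochains p (Suc q)) ?t {?x0}"
    unfolding total_op_def by (rule K.finsum_subset_support[OF bidegrees_finite]) (use x0 t0 z in auto)
  also have "\<dots> = ?t ?x0" using t0 by simp
  finally show "total_op 2 ?Q G p (Suc q) = quilt_op 2 ?Q (bideg 0 p) (bideg 2 q) (\<lambda>a. G a (bideg 0 p a) (bideg 2 q a))"
    by simp
qed

lemma delta_H_at:
  assumes F: "F \<in> carrier Tot"
  shows "delta_H F p q = total_op 2 quilt_B (\<lambda>a. if a = 1 then mhat else F) p q \<ominus>\<^bsub>cochains p q\<^esub>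
    total_op 2 quilt_B' (\<lambda>a. if a = 1 then mhat else F) p q"
  unfolding delta_H_def by (intro Tot_a_minus_at total_op_closed quilt_B_quilts) (use F mhat_Tot in auto)

lemma delta_H_0: "F \<in> carrier Tot \<Longrightarrow> delta_H F p 0 = \<zero>\<^bsub>cochains p 0\<^esub>"
  unfolding delta_H_at quilt_B_eq using total_op_two(1)[of 1 2 F p] total_op_two(1)[of 2 1 F p]
  by (simp add: a_minus_def abelian_group.r_neg[OF cochains_group] abelian_groupE(2)[OF cochains_group])

text \<open>
  The two outer faces come from the quilt \<open>12\<close> and the inner ones, with the opposite sign, from \<open>21\<close>.
\<close>

lemma delta_H_Suc:
  assumes F: "F \<in> carrier Tot"
  shows "delta_H F p (Suc q) = alt (cochains p (Suc q)) p (H.D p q (F p q))"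
proof (rule cochain_eqI)
  note Fpq = Tot_at[OF F, of p q]
  show "delta_H F p (Suc q) \<in> carrier (cochains p (Suc q))" using delta_Tot(1)[OF F] by (rule Tot_at)
  show "alt (cochains p (Suc q)) p (H.D p q (F p q)) \<in> carrier (cochains p (Suc q))"
    by (intro H.alt_closed' H.D_closed Fpq)
  fix \<phi> as assume \<phi>: "\<phi> \<in> strings p" and as: "as \<in> tuples (A (vert \<phi> p)) (Suc q)"
  let ?N = "A (vert \<phi> 0)"
  have N: "abelian_group ?N" by (rule A_group[OF vert_Ob[OF \<phi>]]) simp
  interpret N: abelian_group ?N by (rule N)
  note ev = cochains_group N cochain_evaluation_additive[OF \<phi> as]
  define h where "h i = hoch p q i (F p q) \<phi> as" for i
  have h: "h i \<in> carrier ?N" if "i \<le> Suc q" for i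
    unfolding h_def using that by (intro cochain_value[OF hoch_closed[OF Fpq] \<phi> as])
  let ?G = "\<lambda>a::nat. if a = 1 then mhat else F"
  have B: "total_op 2 quilt_B ?G p (Suc q) \<phi> as = alt ?N (Suc (p + q)) (h (Suc q)) \<oplus>\<^bsub>?N\<^esub> alt ?N p (h 0)"
  proof -
    have "{1..2} = {1, 2::nat}" by auto
    then show ?thesis
      using total_op_two(2)[of 1 2 F p q] F quilt_op_two[of 1 2 \<phi> p "F p q" q as, OF _ \<phi> Fpq as] h
      by (simp add: quilt_B_eq bideg_simps alt_def N.int_pow_closed flip: h_def)
  qed
  have B': "total_op 2 quilt_B' ?G p (Suc q) \<phi> as = (\<Oplus>\<^bsub>?N\<^esub>i\<in>{1..q}. alt ?N (p + i - 1) (h i))"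
    using total_op_two(2)[of 2 1 F p q] F quilt_op_two[of 2 1 \<phi> p "F p q" q as, OF _ \<phi> Fpq as] h
    by (simp add: quilt_B_eq bideg_simps alt_def flip: h_def)
  \<comment> \<open>The index is at least 1, so the truncated exponent is exact and differs by one
    from that of the Hochschild sum.\<close>
  have mid: "alt ?N (p + i - 1) (h i) = \<ominus>\<^bsub>?N\<^esub> alt ?N (p + i) (h i)" if "i \<in> {1..q}" for i
    using that h[of i] by (cases i) (auto simp: N.alt_Suc N.minus_minus N.alt_closed)
  have mc: "alt ?N (p + i) (h i) \<in> carrier ?N" if "i \<le> Suc q" for i
    using h[OF that] by (rule N.alt_closed)
  have "(\<Oplus>\<^bsub>?N\<^esub>i\<in>{1..q}. alt ?N (p + i - 1) (h i)) = (\<Oplus>\<^bsub>?N\<^esub>i\<in>{1..q}. \<ominus>\<^bsub>?N\<^esub> alt ?N (p + i) (h i))"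
    using mid mc by (intro N.finsum_cong') auto
  also have "\<dots> = \<ominus>\<^bsub>?N\<^esub> (\<Oplus>\<^bsub>?N\<^esub>i\<in>{1..q}. alt ?N (p + i) (h i))"
    using mc by (intro N.finsum_a_inv) auto
  finally have B'': "total_op 2 quilt_B' ?G p (Suc q) \<phi> as = \<ominus>\<^bsub>?N\<^esub> (\<Oplus>\<^bsub>?N\<^esub>i\<in>{1..q}. alt ?N (p + i) (h i))"
    unfolding B' .
  have "alt (cochains p (Suc q)) p (H.D p q (F p q)) \<phi> as = alt ?N p (H.D p q (F p q) \<phi> as)"
    by (rule additive_alt[OF ev]) (intro H.D_closed Fpq)
  also have "H.D p q (F p q) \<phi> as = (\<Oplus>\<^bsub>?N\<^esub>i\<in>{0..Suc q}. alt (cochains p (Suc q)) i (hoch p q i (F p q)) \<phi> as)"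
    unfolding H.D_def by (intro cochain_ops_value(1)[OF \<phi> as]) (auto intro!: H.alt_closed' hoch_closed Fpq)
  also have "\<dots> = (\<Oplus>\<^bsub>?N\<^esub>i\<in>{0..Suc q}. alt ?N i (h i))"
    by (intro N.finsum_cong') (auto simp: additive_alt[OF ev] hoch_closed Fpq h_def[symmetric] N.alt_closed h)
  also have "alt ?N p \<dots> = (\<Oplus>\<^bsub>?N\<^esub>i\<in>{0..Suc q}. alt ?N p (alt ?N i (h i)))"
    by (intro additive_finsum[OF N N N.alt_additive]) (auto simp: N.alt_closed h)
  also have "\<dots> = (\<Oplus>\<^bsub>?N\<^esub>i\<in>{0..Suc q}. alt ?N (p + i) (h i))"
    by (intro N.finsum_cong') (auto simp: N.alt_alt h mc)
  also have "{0..Suc q} = insert 0 (insert (Suc q) {1..q})" by auto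
  also have "(\<Oplus>\<^bsub>?N\<^esub>i\<in>\<dots>. alt ?N (p + i) (h i)) =
    alt ?N p (h 0) \<oplus>\<^bsub>?N\<^esub> (alt ?N (Suc (p + q)) (h (Suc q)) \<oplus>\<^bsub>?N\<^esub> (\<Oplus>\<^bsub>?N\<^esub>i\<in>{1..q}. alt ?N (p + i) (h i)))"
    using mc mc[of 0] mc[of "Suc q"] by (subst N.finsum_insert; (subst N.finsum_insert)?) (auto simp: N.finsum_in_carrier)
  finally have D: "alt (cochains p (Suc q)) p (H.D p q (F p q)) \<phi> as =
    alt ?N p (h 0) \<oplus>\<^bsub>?N\<^esub> (alt ?N (Suc (p + q)) (h (Suc q)) \<oplus>\<^bsub>?N\<^esub> (\<Oplus>\<^bsub>?N\<^esub>i\<in>{1..q}. alt ?N (p + i) (h i)))" .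
  have "delta_H F p (Suc q) \<phi> as = total_op 2 quilt_B ?G p (Suc q) \<phi> as \<ominus>\<^bsub>?N\<^esub> total_op 2 quilt_B' ?G p (Suc q) \<phi> as"
    unfolding delta_H_at[OF F]
    by (intro additive_a_minus[OF ev] total_op_at quilt_B_quilts) (use F mhat_Tot in auto)
  also have "\<dots> = alt (cochains p (Suc q)) p (H.D p q (F p q)) \<phi> as"
    unfolding B B'' D using mc mc[of 0] mc[of "Suc q"]
    by (simp add: N.minus_eq N.minus_minus N.finsum_in_carrier N.a_ac)
  finally show "delta_H F p (Suc q) \<phi> as = alt (cochains p (Suc q)) p (H.D p q (F p q)) \<phi> as" .
qed

section \<open>The differential\<close>

lemma delta_at: "delta F p q = delta_S F p q \<oplus>\<^bsub>cochains p q\<^esub> delta_H F p q"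
  by (simp add: delta_def Tot_ops)

lemmas S_zero = additive_zero[OF cochains_group cochains_group S.D_additive]
lemmas H_zero = additive_zero[OF cochains_group cochains_group H.D_additive]
lemmas alt_zero' = abelian_group.alt_zero[OF cochains_group]
lemmas cochains_zero_closed = abelian_groupE(2)[OF cochains_group]

section \<open>Additivity of the differential and the vanishing of its square\<close>

lemma delta_S_additive: "additive Tot Tot delta_S"
proof (rule additiveI)
  fix F G assume F: "F \<in> carrier Tot" and G: "G \<in> carrier Tot"
  interpret T: abelian_group Tot by (rule Tot_group)
  show "delta_S (F \<oplus>\<^bsub>Tot\<^esub> G) = delta_S F \<oplus>\<^bsub>Tot\<^esub> delta_S G"
  proof (rule Tot_eqI)
    fix p q
    show "delta_S (F \<oplus>\<^bsub>Tot\<^esub> G) p q = (delta_S F \<oplus>\<^bsub>Tot\<^esub> delta_S G) p q"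
      using Tot_at[OF F] Tot_at[OF G] abelian_monoid.l_zero[OF abelian_group.axioms(1)[OF cochains_group] cochains_zero_closed]
      by (cases p) (simp_all add: Tot_ops delta_S_0 delta_S_Suc additive_add[OF S.D_additive])
  qed (use F G in \<open>simp_all add: delta_S_closed\<close>)
qed (rule delta_S_closed)

lemma delta_H_additive: "additive Tot Tot delta_H"
proof (rule additiveI)
  fix F G assume F: "F \<in> carrier Tot" and G: "G \<in> carrier Tot"
  interpret T: abelian_group Tot by (rule Tot_group)
  show "delta_H (F \<oplus>\<^bsub>Tot\<^esub> G) = delta_H F \<oplus>\<^bsub>Tot\<^esub> delta_H G"
  proof (rule Tot_eqI)
    fix p q
    show "delta_H (F \<oplus>\<^bsub>Tot\<^esub> G) p q = (delta_H F \<oplus>\<^bsub>Tot\<^esub> delta_H G) p q"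
      using Tot_at[OF F] Tot_at[OF G] F G abelian_monoid.l_zero[OF abelian_group.axioms(1)[OF cochains_group] cochains_zero_closed]
      by (cases q) (simp_all add: Tot_ops delta_H_0 delta_H_Suc additive_add[OF H.D_additive] H.D_closed
          additive_add[OF abelian_group.alt_additive[OF cochains_group]])
  qed (use F G in \<open>simp_all add: delta_Tot\<close>)
qed (rule delta_Tot)

lemma delta_additive: "additive Tot Tot delta"
proof (rule additiveI)
  fix F G assume F: "F \<in> carrier Tot" and G: "G \<in> carrier Tot"
  interpret T: abelian_group Tot by (rule Tot_group)
  show "delta (F \<oplus>\<^bsub>Tot\<^esub> G) = delta F \<oplus>\<^bsub>Tot\<^esub> delta G"
    using F G by (simp add: delta_def additive_add[OF delta_S_additive] additive_add[OF delta_H_additive]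
        delta_S_closed delta_Tot(1) T.a_ac)
qed (rule delta_Tot)

lemma total_eqI: "(\<And>p q. F p q = G p q) \<Longrightarrow> F = G"
  by (intro ext) simp

lemma delta_S_delta_S:
  assumes F: "F \<in> carrier Tot"
  shows "delta_S (delta_S F) = \<zero>\<^bsub>Tot\<^esub>"
proof (rule total_eqI)
  fix p q
  show "delta_S (delta_S F) p q = \<zero>\<^bsub>Tot\<^esub> p q"
  proof (cases p)
    case (Suc m)
    then show ?thesis using Tot_at[OF F]
      by (cases m) (simp_all add: delta_S_0 delta_S_Suc Tot_ops S_zero S.D_D)
  qed (simp add: delta_S_0 Tot_ops)
qed

lemma delta_H_delta_H:
  assumes F: "F \<in> carrier Tot"
  shows "delta_H (delta_H F) = \<zero>\<^bsub>Tot\<^esub>"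
proof (rule total_eqI)
  fix p q
  note HF = delta_Tot(1)[OF F]
  show "delta_H (delta_H F) p q = \<zero>\<^bsub>Tot\<^esub> p q"
  proof (cases q)
    case (Suc m)
    show ?thesis
    proof (cases m)
      case 0
      then show ?thesis using Suc by (simp add: delta_H_Suc[OF HF] delta_H_0[OF F] H_zero alt_zero' Tot_ops)
    next
      case (Suc l)
      then show ?thesis using \<open>q = Suc m\<close> Tot_at[OF F]
        by (simp add: delta_H_Suc[OF HF] delta_H_Suc[OF F] additive_alt[OF cochains_group cochains_group H.D_additive]
            H.D_closed H.D_D alt_zero' Tot_ops)
    qed
  qed (simp add: delta_H_0[OF HF] Tot_ops)
qed

text \<open>The two unsigned differentials commute. The sign of \<open>delta_H\<close> is read in
  simplicial degree p - 1 in one order and in degree p in the other, which turns commuting into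
  anticommuting.\<close>

lemma delta_S_delta_H:
  assumes F: "F \<in> carrier Tot"
  shows "delta_S (delta_H F) \<oplus>\<^bsub>Tot\<^esub> delta_H (delta_S F) = \<zero>\<^bsub>Tot\<^esub>"
proof (rule total_eqI)
  fix p q
  note HF = delta_Tot(1)[OF F] and SF = delta_S_closed[OF F]
  have zz: "\<zero>\<^bsub>cochains p q\<^esub> \<oplus>\<^bsub>cochains p q\<^esub> \<zero>\<^bsub>cochains p q\<^esub> = \<zero>\<^bsub>cochains p q\<^esub>" for p q
    using abelian_monoid.l_zero[OF abelian_group.axioms(1)[OF cochains_group] cochains_zero_closed] .
  show "(delta_S (delta_H F) \<oplus>\<^bsub>Tot\<^esub> delta_H (delta_S F)) p q = \<zero>\<^bsub>Tot\<^esub> p q"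
  proof (cases p)
    case 0
    then show ?thesis
      by (cases q) (simp_all add: Tot_ops delta_S_0 delta_H_0[OF SF] delta_H_Suc[OF SF] H_zero alt_zero' zz)
  next
    case (Suc m)
    show ?thesis
    proof (cases q)
      case 0
      then show ?thesis using Suc by (simp add: Tot_ops delta_S_Suc delta_H_0[OF HF] delta_H_0[OF F] delta_H_0[OF SF] S_zero zz)
    next
      case (Suc l)
      interpret K: abelian_group "cochains p q" by (rule cochains_group)
      have c: "H.D p l (S.D l m (F m l)) \<in> carrier (cochains p q)"
        using \<open>p = Suc m\<close> Suc Tot_at[OF F] by (auto intro!: H.D_closed S.D_closed)
      have "delta_S (delta_H F) p q = alt (cochains p q) m (H.D p l (S.D l m (F m l)))"
        using \<open>p = Suc m\<close> Suc Tot_at[OF F]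
        by (simp add: delta_S_Suc delta_H_Suc[OF F] additive_alt[OF cochains_group cochains_group S.D_additive]
            H.D_closed S_D_H_D)
      moreover have "delta_H (delta_S F) p q = alt (cochains p q) p (H.D p l (S.D l m (F m l)))"
        using \<open>p = Suc m\<close> Suc by (simp add: delta_H_Suc[OF SF] delta_S_Suc)
      ultimately show ?thesis
        using c \<open>p = Suc m\<close> K.alt_cancel[OF c, of m] by (simp add: Tot_ops)
    qed
  qed
qed

lemma delta_delta:
  assumes F: "F \<in> carrier Tot"
  shows "delta (delta F) = \<zero>\<^bsub>Tot\<^esub>"
proof -
  interpret T: abelian_group Tot by (rule Tot_group)
  note c = delta_S_closed delta_Tot(1)
  have "delta (delta F) = (delta_S (delta_S F) \<oplus>\<^bsub>Tot\<^esub> delta_S (delta_H F)) \<oplus>\<^bsub>Tot\<^esub>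
      (delta_H (delta_S F) \<oplus>\<^bsub>Tot\<^esub> delta_H (delta_H F))"
    using F by (simp add: delta_def c additive_add[OF delta_S_additive] additive_add[OF delta_H_additive])
  then show ?thesis
    using F delta_S_delta_H[OF F] by (simp add: delta_S_delta_S delta_H_delta_H c)
qed

end

context algebra_diagram
begin

subsection \<open>Linearity\<close>

lemma smult_additive: "r \<in> carrier R \<Longrightarrow> additive (cochains p q) (cochains p q) (\<lambda>f. r \<odot>\<^bsub>cochains p q\<^esub> f)"
  using module.smult_closed[OF cochains_module] module.smult_r_distr[OF cochains_module]
  by (auto simp: additive_def)

lemma cochain_smult_value:
  "\<phi> \<in> strings p \<Longrightarrow> as \<in> tuples (A (vert \<phi> p)) q \<Longrightarrow>
    (r \<odot>\<^bsub>cochains p q\<^esub> f) \<phi> as = r \<odot>\<^bsub>A (vert \<phi> 0)\<^esub> f \<phi> as"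
  by (simp add: cochain_smult_at maps_at_def multilinear_maps_def)

lemma push_smult:
  assumes \<theta>: "mono_on {0..p} \<theta>" "\<theta> p \<le> p'" and r: "r \<in> carrier R" and f: "f \<in> carrier (cochains p q)"
  shows "push p p' \<theta> q (r \<odot>\<^bsub>cochains p q\<^esub> f) = r \<odot>\<^bsub>cochains p' q\<^esub> push p p' \<theta> q f"
proof (rule cochain_eqI)
  note sm = module.smult_closed[OF cochains_module r]
  show "push p p' \<theta> q (r \<odot>\<^bsub>cochains p q\<^esub> f) \<in> carrier (cochains p' q)"
    by (intro push_closed \<theta> sm f)
  show "r \<odot>\<^bsub>cochains p' q\<^esub> push p p' \<theta> q f \<in> carrier (cochains p' q)"
    by (intro push_closed \<theta> sm f)
  fix \<phi> as assume \<phi>: "\<phi> \<in> strings p'" and as: "as \<in> tuples (A (vert \<phi> p')) q"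
  note ps = pull_strings[OF \<phi> \<theta>] and pv = pull_vert[OF \<phi> \<theta>]
  have le: "\<theta> 0 \<le> p'" using \<theta> mono_on_le[of p \<theta> 0 p] by auto
  have mt: "map (transport \<phi> (\<theta> p) p') as \<in> tuples (A (vert (pull p \<theta> \<phi>) p)) q"
    using tuples_transport[OF \<phi> \<theta>(2) _ as] by (simp add: pv)
  have "f (pull p \<theta> \<phi>) (map (transport \<phi> (\<theta> p) p') as) \<in> carrier (A (vert \<phi> (\<theta> 0)))"
    using cochain_value[OF f ps mt] pv by simp
  then show "push p p' \<theta> q (r \<odot>\<^bsub>cochains p q\<^esub> f) \<phi> as = (r \<odot>\<^bsub>cochains p' q\<^esub> push p p' \<theta> q f) \<phi> as"
    using linear_on_smult[OF transport_linear[OF \<phi> _ le] r]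
    by (simp add: push_value[OF \<phi> as] cochain_smult_value[OF \<phi> as] cochain_smult_value[OF ps mt] pv)
qed

lemma hoch_smult:
  assumes i: "i \<le> Suc q" and r: "r \<in> carrier R" and f: "f \<in> carrier (cochains p q)"
  shows "hoch p q i (r \<odot>\<^bsub>cochains p q\<^esub> f) = r \<odot>\<^bsub>cochains p (Suc q)\<^esub> hoch p q i f"
proof (rule cochain_eqI)
  note sm = module.smult_closed[OF cochains_module r]
  show "hoch p q i (r \<odot>\<^bsub>cochains p q\<^esub> f) \<in> carrier (cochains p (Suc q))"
    by (intro hoch_closed i sm f)
  show "r \<odot>\<^bsub>cochains p (Suc q)\<^esub> hoch p q i f \<in> carrier (cochains p (Suc q))"
    by (intro hoch_closed i sm f)
  fix \<phi> as assume \<phi>: "\<phi> \<in> strings p" and as: "as \<in> tuples (A (vert \<phi> p)) (Suc q)"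
  interpret M: nonunital_algebra R "A (vert \<phi> p)" by (rule A_algebra[OF vert_Ob[OF \<phi>]]) simp
  interpret N: nonunital_algebra R "A (vert \<phi> 0)" by (rule A_algebra[OF vert_Ob[OF \<phi>]]) simp
  note m = M.merge_tuples[OF as]
  have t: "transport \<phi> 0 p (as ! 0) \<in> carrier (A (vert \<phi> 0))" "transport \<phi> 0 p (as ! q) \<in> carrier (A (vert \<phi> 0))"
    by (intro transport_closed[OF \<phi>] tuples_nth[OF as]; simp)+
  show "hoch p q i (r \<odot>\<^bsub>cochains p q\<^esub> f) \<phi> as = (r \<odot>\<^bsub>cochains p (Suc q)\<^esub> hoch p q i f) \<phi> as"
    using t r by (simp add: hoch_value[OF \<phi> as] cochain_smult_value[OF \<phi> as] cochain_smult_value[OF \<phi> m] Let_def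
        cochain_value[OF f \<phi> m] N.smult_mult_left N.smult_mult_right)
qed

lemma S_D_smult:
  assumes r: "r \<in> carrier R" and f: "f \<in> carrier (cochains p q)"
  shows "S.D q p (r \<odot>\<^bsub>cochains p q\<^esub> f) = r \<odot>\<^bsub>cochains (Suc p) q\<^esub> S.D q p f"
proof -
  interpret K: module R "cochains (Suc p) q" by (rule cochains_module)
  have comp: "delta_S_comp p q i (r \<odot>\<^bsub>cochains p q\<^esub> f) = r \<odot>\<^bsub>cochains (Suc p) q\<^esub> delta_S_comp p q i f" for i
    unfolding delta_S_comp_push by (intro push_smult mono_coface coface_le r f)
  have "r \<odot>\<^bsub>cochains (Suc p) q\<^esub> S.D q p f =
      (\<Oplus>\<^bsub>cochains (Suc p) q\<^esub>i\<in>{0..Suc p}. r \<odot>\<^bsub>cochains (Suc p) q\<^esub> alt (cochains (Suc p) q) i (delta_S_comp p q i f))"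
    unfolding S.D_def using r f by (intro K.finsum_smult_ldistr) (auto intro!: S.alt_closed' S.d_closed)
  also have "\<dots> = S.D q p (r \<odot>\<^bsub>cochains p q\<^esub> f)"
    unfolding S.D_def using r f
    by (intro K.finsum_cong') (auto simp: comp additive_alt[OF cochains_group cochains_group smult_additive[OF r]]
        S.d_closed intro!: S.alt_closed' K.smult_closed)
  finally show ?thesis by simp
qed

lemma H_D_smult:
  assumes r: "r \<in> carrier R" and f: "f \<in> carrier (cochains p q)"
  shows "H.D p q (r \<odot>\<^bsub>cochains p q\<^esub> f) = r \<odot>\<^bsub>cochains p (Suc q)\<^esub> H.D p q f"
proof -
  interpret K: module R "cochains p (Suc q)" by (rule cochains_module)
  have "r \<odot>\<^bsub>cochains p (Suc q)\<^esub> H.D p q f =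
      (\<Oplus>\<^bsub>cochains p (Suc q)\<^esub>i\<in>{0..Suc q}. r \<odot>\<^bsub>cochains p (Suc q)\<^esub> alt (cochains p (Suc q)) i (hoch p q i f))"
    unfolding H.D_def using r f by (intro K.finsum_smult_ldistr) (auto intro!: H.alt_closed' H.d_closed)
  also have "\<dots> = H.D p q (r \<odot>\<^bsub>cochains p q\<^esub> f)"
    unfolding H.D_def using r f
    by (intro K.finsum_cong') (auto simp: hoch_smult additive_alt[OF cochains_group cochains_group smult_additive[OF r]]
        hoch_closed intro!: H.alt_closed' K.smult_closed)
  finally show ?thesis by simp
qed

text \<open>Scalars matter for the coboundaries: they must form a submodule for the quotient to be a
  module.\<close>

lemma delta_smult:
  assumes r: "r \<in> carrier R" and F: "F \<in> carrier Tot"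
  shows "delta (r \<odot>\<^bsub>Tot\<^esub> F) = r \<odot>\<^bsub>Tot\<^esub> delta F"
proof (rule total_eqI)
  fix p q
  interpret K: module R "cochains p q" by (rule cochains_module)
  note sm = module.smult_closed[OF Tot_module r]
  have "delta_S (r \<odot>\<^bsub>Tot\<^esub> F) p q = r \<odot>\<^bsub>cochains p q\<^esub> delta_S F p q"
    using r Tot_at[OF F] by (cases p) (simp_all add: delta_S_0 delta_S_Suc Tot_ops S_D_smult module.smult_r_null[OF cochains_module])
  moreover have "delta_H (r \<odot>\<^bsub>Tot\<^esub> F) p q = r \<odot>\<^bsub>cochains p q\<^esub> delta_H F p q"
    using r Tot_at[OF F] sm[OF F] F
    by (cases q) (simp_all add: delta_H_0 delta_H_Suc Tot_ops H_D_smult module.smult_r_null[OF cochains_module] H.D_closed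
        additive_alt[OF cochains_group cochains_group smult_additive[OF r]])
  ultimately show "delta (r \<odot>\<^bsub>Tot\<^esub> F) p q = (r \<odot>\<^bsub>Tot\<^esub> delta F) p q"
    using r Tot_at[OF delta_S_closed[OF F]] Tot_at[OF delta_Tot(1)[OF F]]
    by (simp add: delta_at Tot_ops K.smult_r_distr)
qed

section \<open>Normalisation\<close>

lemma cochains_minus_zero: "\<ominus>\<^bsub>cochains p q\<^esub> \<zero>\<^bsub>cochains p q\<^esub> = \<zero>\<^bsub>cochains p q\<^esub>"
proof -
  interpret K: abelian_group "cochains p q" by (rule cochains_group)
  show ?thesis by (rule K.a_inv_zero)
qed

definition homotopy :: "nat \<Rightarrow> ('o, 'm, 'a) total_cochain \<Rightarrow> ('o, 'm, 'a) total_cochain" where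
  "homotopy k F = (\<lambda>p q. if k \<le> p then alt (cochains p q) k (degen q p k (F (Suc p) q)) else \<zero>\<^bsub>cochains p q\<^esub>)"

lemma homotopy_closed:
  assumes F: "F \<in> carrier Tot"
  shows "homotopy k F \<in> carrier Tot"
  unfolding Tot_carrier
proof (intro conjI allI)
  show "homotopy k F p q \<in> carrier (cochains p q)" for p q
    using Tot_at[OF F] by (auto simp: homotopy_def cochains_zero_closed intro!: S.alt_closed' S.s_closed)
  have "{(p, q). homotopy k F p q \<noteq> \<zero>\<^bsub>cochains p q\<^esub>} \<subseteq> (\<lambda>(p, q). (p - 1, q)) ` {(p, q). F p q \<noteq> \<zero>\<^bsub>cochains p q\<^esub>}"
  proof
    fix x assume x: "x \<in> {(p, q). homotopy k F p q \<noteq> \<zero>\<^bsub>cochains p q\<^esub>}"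
    obtain p q where [simp]: "x = (p, q)" by (cases x)
    have "F (Suc p) q \<noteq> \<zero>\<^bsub>cochains (Suc p) q\<^esub>"
      using x S.zero_hom[OF S.s_additive] by (auto simp: homotopy_def alt_zero' split: if_splits)
    then show "x \<in> (\<lambda>(p, q). (p - 1, q)) ` {(p, q). F p q \<noteq> \<zero>\<^bsub>cochains p q\<^esub>}"
      by (intro image_eqI[of _ _ "(Suc p, q)"]) auto
  qed
  then show "finite {(p, q). homotopy k F p q \<noteq> \<zero>\<^bsub>cochains p q\<^esub>}"
    using F by (auto simp: Tot_carrier intro: finite_subset)
qed

lemma homotopy_zero_at: "F (Suc p) q = \<zero>\<^bsub>cochains (Suc p) q\<^esub> \<Longrightarrow> homotopy k F p q = \<zero>\<^bsub>cochains p q\<^esub>"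
  using S.zero_hom[OF S.s_additive, of k p q] by (simp add: homotopy_def alt_zero')

text \<open>The homotopy lowers \<open>p\<close> and leaves \<open>q\<close> alone, so the same
  homotopy works on the full and on the asimplicial complex.\<close>

lemma homotopy_asimplicial: "F \<in> asimplicial \<Longrightarrow> homotopy k F \<in> asimplicial"
  by (auto simp: asimplicial_def homotopy_closed homotopy_zero_at)

lemma homotopy_homogeneous: "homogeneous m F \<Longrightarrow> homogeneous (m - 1) (homotopy k F)"
  by (auto simp: homogeneous_def intro!: homotopy_zero_at)

lemma degen_H_D:
  "k \<le> p \<Longrightarrow> f \<in> carrier (cochains (Suc p) q) \<Longrightarrow> degen (Suc q) p k (H.D (Suc p) q f) = H.D p q (degen q p k f)"
  by (intro push_H_D mono_codegeneracy codegeneracy_le)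

text \<open>
  The codegeneracies commute with the Hochschild differential, so the sign \<open>(-1)\<^sup>p\<close> in \<open>delta_H\<close>
  makes the homotopy anticommute with it.
\<close>

lemma delta_H_homotopy:
  assumes F: "F \<in> carrier Tot" and k: "k \<le> p"
  shows "delta_H (homotopy k F) p q = \<ominus>\<^bsub>cochains p q\<^esub> alt (cochains p q) k (degen q p k (delta_H F (Suc p) q))"
proof -
  interpret K: abelian_group "cochains p q" by (rule cochains_group)
  note TF = homotopy_closed[OF F, of k]
  show ?thesis
  proof (cases q)
    case 0
    then show ?thesis
      using k S.zero_hom[OF S.s_additive[OF k]] by (simp add: delta_H_0[OF TF] delta_H_0[OF F] alt_zero' cochains_minus_zero)
  next
    case (Suc l)
    have f: "F (Suc p) l \<in> carrier (cochains (Suc p) l)" by (rule Tot_at[OF F])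
    define g where "g = H.D p l (degen l p k (F (Suc p) l))"
    have g: "g \<in> carrier (cochains p q)"
      unfolding g_def Suc by (intro H.D_closed S.s_closed k f)
    have "delta_H (homotopy k F) p q = alt (cochains p q) p (H.D p l (alt (cochains p l) k (degen l p k (F (Suc p) l))))"
    proof -
      have "homotopy k F p l = alt (cochains p l) k (degen l p k (F (Suc p) l))"
        using k by (simp add: homotopy_def)
      then show ?thesis unfolding Suc delta_H_Suc[OF TF] by simp
    qed
    also have "\<dots> = alt (cochains p q) p (alt (cochains p q) k g)"
      unfolding g_def Suc using k f
      by (simp add: additive_alt[OF cochains_group cochains_group H.D_additive] S.s_closed)
    finally have 1: "delta_H (homotopy k F) p q = alt (cochains p q) p (alt (cochains p q) k g)" .
    \<comment> \<open>The Hochschild differential is taken here in simplicial degree p + 1, and its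
      sign differs by one from the one after the codegeneracy.\<close>
    have "degen q p k (delta_H F (Suc p) q) = alt (cochains p q) (Suc p) g"
      unfolding g_def Suc delta_H_Suc[OF F] using k f
      by (simp add: additive_alt[OF cochains_group cochains_group S.s_additive[OF k]] H.D_closed degen_H_D)
    then show ?thesis
      using g by (simp add: 1 K.alt_alt K.alt_Suc K.alt_closed K.minus_minus add.commute
          additive_a_inv[OF cochains_group cochains_group K.alt_additive])
  qed
qed

lemma delta_H_zero_at:
  "F \<in> carrier Tot \<Longrightarrow> (\<And>q. F p q = \<zero>\<^bsub>cochains p q\<^esub>) \<Longrightarrow> delta_H F p q = \<zero>\<^bsub>cochains p q\<^esub>"
  by (cases q) (simp_all add: delta_H_0 delta_H_Suc H_zero alt_zero')

text \<open>As \<open>delta F\<close> is reduced, s_k of the simplicial part of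
  \<open>delta F\<close> is minus s_k of the Hochschild part. Therefore \<open>delta_H\<close> of
  the homotopy equals (-1)^k s_k D F, the second term of the formula in \<open>normalise\<close>,
  while \<open>delta_S\<close> of the homotopy gives the first.\<close>

lemma normal_step:
  assumes F: "F \<in> carrier Tot" and n: "\<And>p q. S.normal q k p (F p q)" and d: "delta F \<in> reduced"
  shows "S.normal q (Suc k) p ((F \<ominus>\<^bsub>Tot\<^esub> delta (homotopy k F)) p q)"
proof -
  interpret K: abelian_group "cochains p q" by (rule cochains_group)
  let ?T = "homotopy k F"
  note TF = homotopy_closed[OF F, of k]
  have Fc: "F p q \<in> carrier (cochains p q)" by (rule Tot_at[OF F])
  have G: "(F \<ominus>\<^bsub>Tot\<^esub> delta ?T) p q = F p q \<ominus>\<^bsub>cochains p q\<^esub> (delta_S ?T p q \<oplus>\<^bsub>cochains p q\<^esub> delta_H ?T p q)"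
    using Tot_a_minus_at[OF F delta_Tot(2)[OF TF]] by (simp add: delta_at)
  \<comment> \<open>For p \<le> k there is no codegeneracy with index \<open>k\<close>, so the
    stages \<open>k\<close> and \<open>Suc k\<close> coincide.\<close>
  have big: "S.normal q (Suc k) p (F p q)" if "p \<le> k"
    using n[of q p] that by (auto simp: S.normal_def)
  have dH: "delta_H ?T p q = alt (cochains p q) k (degen q p k (S.D q p (F p q)))" if k: "k \<le> p"
  proof -
    have "S.normal q (Suc p) (Suc p) (delta F (Suc p) q)"
      using d by (simp add: reduced_def flip: reduced_normal)
    then have "degen q p k (delta F (Suc p) q) = \<zero>\<^bsub>cochains p q\<^esub>"
      using k by (auto simp: S.normal_def)
    then have *: "degen q p k (S.D q p (F p q)) \<oplus>\<^bsub>cochains p q\<^esub> degen q p k (delta_H F (Suc p) q) = \<zero>\<^bsub>cochains p q\<^esub>"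
      using additive_add[OF S.s_additive[OF k] S.D_closed[OF Fc] Tot_at[OF delta_Tot(1)[OF F]]]
      by (simp add: delta_at delta_S_Suc)
    have c: "degen q p k (S.D q p (F p q)) \<in> carrier (cochains p q)" "degen q p k (delta_H F (Suc p) q) \<in> carrier (cochains p q)"
      using k Fc Tot_at[OF delta_Tot(1)[OF F]] by (auto intro!: S.s_closed S.D_closed)
    then have "degen q p k (S.D q p (F p q)) = \<ominus>\<^bsub>cochains p q\<^esub> degen q p k (delta_H F (Suc p) q)"
      using K.minus_equality[OF *] by simp
    then show ?thesis
      using c by (simp add: delta_H_homotopy[OF F k] additive_a_inv[OF cochains_group cochains_group K.alt_additive])
  qed
  consider "k < p" | "k = p" | "p < k" by linarith
  then show ?thesis
  proof cases
    case 1
    then obtain m where m: "p = Suc m" "k \<le> m" by (cases p) auto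
    have c: "S.D q m (degen q m k (F p q)) \<in> carrier (cochains p q)" "degen q p k (S.D q p (F p q)) \<in> carrier (cochains p q)"
      using 1 m Fc by (auto intro!: S.s_closed S.D_closed)
    have "delta_S ?T p q = alt (cochains p q) k (S.D q m (degen q m k (F p q)))"
      using m Fc by (simp add: delta_S_Suc homotopy_def additive_alt[OF cochains_group cochains_group S.D_additive] S.s_closed)
    then have "delta_S ?T p q \<oplus>\<^bsub>cochains p q\<^esub> delta_H ?T p q = alt (cochains p q) k
        (S.D q m (degen q m k (F p q)) \<oplus>\<^bsub>cochains p q\<^esub> degen q p k (S.D q p (F p q)))"
      using 1 c by (simp add: dH additive_add[OF K.alt_additive])
    then show ?thesis
      unfolding G using S.normalise[of q k m "F p q"] n[of q p] m by simp
  next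
    \<comment> \<open>At this boundary the homotopy may be nonzero in degree \<open>p\<close> but is
      zero one degree below. It contributes only through \<open>delta_H\<close>, and that
      contribution vanishes because the stage is already complete.\<close>
    case 2
    have "delta_S ?T p q = \<zero>\<^bsub>cochains p q\<^esub>"
      using 2 by (cases p) (simp_all add: delta_S_0 delta_S_Suc homotopy_def S_zero)
    moreover have "degen q p k (S.D q p (F p q)) = \<zero>\<^bsub>cochains p q\<^esub>"
      using S.s_D_zero[OF big] 2 by simp
    then have "delta_H ?T p q = \<zero>\<^bsub>cochains p q\<^esub>"
      using dH 2 by (simp add: alt_zero')
    ultimately show ?thesis
      unfolding G using big 2 Fc by (simp add: K.minus_eq K.a_inv_zero)
  next
    case 3
    have "delta_S ?T p q = \<zero>\<^bsub>cochains p q\<^esub>"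
      using 3 by (cases p) (simp_all add: delta_S_0 delta_S_Suc homotopy_def S_zero)
    moreover have "delta_H ?T p q = \<zero>\<^bsub>cochains p q\<^esub>"
      using 3 by (intro delta_H_zero_at[OF TF]) (simp add: homotopy_def)
    ultimately show ?thesis
      unfolding G using big 3 Fc by (simp add: K.minus_eq K.a_inv_zero)
  qed
qed

section \<open>Total degree and normalisation of a homogeneous cochain\<close>

lemma delta_homogeneous:
  assumes F: "F \<in> carrier Tot" and h: "homogeneous m F"
  shows "homogeneous (m + 1) (delta F)"
  unfolding homogeneous_def
proof (intro allI impI)
  fix p q assume pq: "int (p + q) \<noteq> m + 1"
  have "delta_S F p q = \<zero>\<^bsub>cochains p q\<^esub>"
    using pq h by (cases p) (auto simp: delta_S_0 delta_S_Suc homogeneous_def S_zero)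
  moreover have "delta_H F p q = \<zero>\<^bsub>cochains p q\<^esub>"
    using pq h F by (cases q) (auto simp: delta_H_0 delta_H_Suc homogeneous_def H_zero alt_zero')
  ultimately show "delta F p q = \<zero>\<^bsub>cochains p q\<^esub>"
    using abelian_monoid.l_zero[OF abelian_group.axioms(1)[OF cochains_group] cochains_zero_closed] by (simp add: delta_at)
qed

lemma zero_homogeneous: "homogeneous m \<zero>\<^bsub>Tot\<^esub>"
  by (simp add: homogeneous_def Tot_ops)

lemma add_homogeneous: "homogeneous m F \<Longrightarrow> homogeneous m G \<Longrightarrow> homogeneous m (F \<oplus>\<^bsub>Tot\<^esub> G)"
  using abelian_monoid.l_zero[OF abelian_group.axioms(1)[OF cochains_group] cochains_zero_closed]
  by (auto simp: homogeneous_def Tot_ops)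

lemma smult_homogeneous: "r \<in> carrier R \<Longrightarrow> homogeneous m F \<Longrightarrow> homogeneous m (r \<odot>\<^bsub>Tot\<^esub> F)"
  by (auto simp: homogeneous_def Tot_ops module.smult_r_null[OF cochains_module])

lemma minus_homogeneous:
  assumes "F \<in> carrier Tot" "G \<in> carrier Tot" "homogeneous m F" "homogeneous m G"
  shows "homogeneous m (F \<ominus>\<^bsub>Tot\<^esub> G)"
  unfolding homogeneous_def
proof (intro allI impI)
  fix p q assume "int (p + q) \<noteq> m"
  then show "(F \<ominus>\<^bsub>Tot\<^esub> G) p q = \<zero>\<^bsub>cochains p q\<^esub>"
    using assms abelian_group.r_neg[OF cochains_group cochains_zero_closed]
    by (simp add: Tot_a_minus_at homogeneous_def a_minus_def[of "cochains p q"])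
qed

text \<open>The homotopies of the successive stages are added up in \<open>X\<close>.
  \<open>S\<close> is a parameter so that the correction stays inside the subcomplex under
  consideration.\<close>

lemma normalisation:
  assumes S: "submodule S R Tot" "\<And>F. F \<in> S \<Longrightarrow> delta F \<in> S" "\<And>k F. F \<in> S \<Longrightarrow> homotopy k F \<in> S"
    and F: "F \<in> S" "homogeneous m F" "delta F \<in> reduced"
  obtains X where "X \<in> S" "homogeneous (m - 1) X" "F \<ominus>\<^bsub>Tot\<^esub> delta X \<in> reduced"
proof -
  note E = module.submoduleE[OF Tot_module S(1)]
  interpret T: abelian_group Tot by (rule Tot_group)
  have c: "X \<in> carrier Tot" if "X \<in> S" for X using that E(1) by blast
  have "\<exists>X\<in>S. homogeneous (m - 1) X \<and> (\<forall>p q. S.normal q k p ((F \<ominus>\<^bsub>Tot\<^esub> delta X) p q))" for k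
  proof (induction k)
    case 0
    have z: "\<zero>\<^bsub>Tot\<^esub> \<in> S" using E(2,3,5) by (metis T.r_neg c ex_in_conv)
    have "delta \<zero>\<^bsub>Tot\<^esub> = \<zero>\<^bsub>Tot\<^esub>" by (rule additive_zero[OF Tot_group Tot_group delta_additive])
    then show ?case
      using z c[OF F(1)] Tot_at[OF c[OF F(1)]]
      by (intro bexI[of _ "\<zero>\<^bsub>Tot\<^esub>"]) (auto simp: zero_homogeneous T.minus_eq T.a_inv_zero S.normal_def)
  next
    case (Suc k)
    then obtain X where X: "X \<in> S" "homogeneous (m - 1) X"
      and n: "\<And>p q. S.normal q k p ((F \<ominus>\<^bsub>Tot\<^esub> delta X) p q)" by blast
    let ?G = "F \<ominus>\<^bsub>Tot\<^esub> delta X" and ?Y = "homotopy k (F \<ominus>\<^bsub>Tot\<^esub> delta X)"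
    have GS: "?G \<in> S" unfolding a_minus_def using F(1) X(1) S(2) by (intro E) auto
    \<comment> \<open>The square of \<open>delta\<close> is zero, so the corrected cochain still has
      a reduced differential and the next stage can start.\<close>
    have dG: "delta ?G = delta F"
      using c[OF F(1)] c[OF X(1)] additive_a_minus[OF Tot_group Tot_group delta_additive, of F "delta X"]
      by (simp add: delta_delta delta_Tot T.minus_eq)
    have "S.normal q (Suc k) p ((?G \<ominus>\<^bsub>Tot\<^esub> delta ?Y) p q)" for p q
      using normal_step[OF c[OF GS] n] F(3) dG by simp
    moreover have "?G \<ominus>\<^bsub>Tot\<^esub> delta ?Y = F \<ominus>\<^bsub>Tot\<^esub> delta (X \<oplus>\<^bsub>Tot\<^esub> ?Y)"
    proof -
      have cc: "F \<in> carrier Tot" "delta X \<in> carrier Tot" "delta ?Y \<in> carrier Tot"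
        using c F(1) X(1) GS S by auto
      then show ?thesis
        using c[OF X(1)] c[OF S(3)[OF GS]] additive_add[OF delta_additive]
        by (simp add: T.minus_eq T.minus_add T.a_assoc)
    qed
    moreover have "homogeneous m ?G"
      using minus_homogeneous[OF c[OF F(1)] c[OF S(2)[OF X(1)]] F(2)] delta_homogeneous[OF c[OF X(1)] X(2)] by simp
    then have "homogeneous (m - 1) (X \<oplus>\<^bsub>Tot\<^esub> ?Y)"
      by (intro add_homogeneous X homotopy_homogeneous)
    moreover have "X \<oplus>\<^bsub>Tot\<^esub> ?Y \<in> S" using X(1) GS S(3) by (intro E)
    ultimately show ?case by (intro bexI[of _ "X \<oplus>\<^bsub>Tot\<^esub> ?Y"]) simp_all
  qed
  \<comment> \<open>In total degree \<open>m\<close> components with p > m are zero, and the others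
    have at most \<open>m\<close> codegeneracies, all of them handled after \<open>nat m\<close>
    stages.\<close>
  from this[of "nat m"] obtain X where X: "X \<in> S" "homogeneous (m - 1) X"
    and n: "\<And>p q. S.normal q (nat m) p ((F \<ominus>\<^bsub>Tot\<^esub> delta X) p q)" by blast
  have h: "homogeneous m (F \<ominus>\<^bsub>Tot\<^esub> delta X)"
    using minus_homogeneous[OF c[OF F(1)] c[OF S(2)[OF X(1)]] F(2)] delta_homogeneous[OF c[OF X(1)] X(2)] by simp
  have "(F \<ominus>\<^bsub>Tot\<^esub> delta X) p q \<in> reduced_cochains p q" for p q
  proof (cases "p \<le> nat m")
    case True
    then show ?thesis using n[of q p] by (auto simp: reduced_normal S.normal_def)
  next
    case False
    then have "int (p + q) \<noteq> m" by linarith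
    then show ?thesis using h by (simp add: homogeneous_def reduced_cochains_zero)
  qed
  then show thesis
    using that[OF X] c[OF F(1)] c[OF S(2)[OF X(1)]] by (simp add: reduced_def)
qed

end

section \<open>Isomorphisms of quotients\<close>

text \<open>Surjectivity and injectivity are asked for on representatives, up to \<open>B'\<close>,
  because \<open>normalisation\<close> provides them in exactly this form.\<close>

lemma quotient_iso:
  fixes R (structure)
  assumes M: "module R M" and B: "submodule B R M" and B': "submodule B' R M" and BB: "B \<subseteq> B'"
    and Z: "Z \<subseteq> Z'" "Z' \<subseteq> carrier M"
    and surj: "\<And>z'. z' \<in> Z' \<Longrightarrow> \<exists>z\<in>Z. z' \<ominus>\<^bsub>M\<^esub> z \<in> B'"
    and inj: "\<And>z w. z \<in> Z \<Longrightarrow> w \<in> Z \<Longrightarrow> z \<ominus>\<^bsub>M\<^esub> w \<in> B' \<Longrightarrow> z \<ominus>\<^bsub>M\<^esub> w \<in> B"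
  shows "\<exists>h\<in>module_iso R (quotient_module M Z B) (quotient_module M Z' B'). \<forall>z\<in>Z. h (B +>\<^bsub>M\<^esub> z) = B' +>\<^bsub>M\<^esub> z"
proof -
  interpret M: module R M by fact
  have sg: "abelian_subgroup H M" if "submodule H R M" for H
    using submodule.axioms(1)[OF that] M.abelian_group_axioms
    by (intro abelian_subgroupI3 additive_subgroupI)
  have cos: "H +>\<^bsub>M\<^esub> x = H +>\<^bsub>M\<^esub> y \<longleftrightarrow> x \<ominus>\<^bsub>M\<^esub> y \<in> H"
    if H: "submodule H R M" and xy: "x \<in> carrier M" "y \<in> carrier M" for H x y
  proof -
    interpret H: abelian_subgroup H M by (rule sg[OF H])
    have sub: "subgroup H (add_monoid M)" by (rule submodule.axioms(1)[OF H])
    show ?thesis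
    proof
      assume "H +>\<^bsub>M\<^esub> x = H +>\<^bsub>M\<^esub> y"
      then have "x \<in> H +>\<^bsub>M\<^esub> y" using H.a_rcos_self[OF xy(1)] by simp
      then obtain h where h: "h \<in> H" "x = h \<oplus>\<^bsub>M\<^esub> y" by (auto simp: a_r_coset_def')
      then have "x \<ominus>\<^bsub>M\<^esub> y = h"
        using xy H.a_Hcarr[OF h(1)] by (simp add: M.minus_eq M.a_assoc M.r_neg)
      then show "x \<ominus>\<^bsub>M\<^esub> y \<in> H" using h by simp
    next
      assume h: "x \<ominus>\<^bsub>M\<^esub> y \<in> H"
      have "x = (x \<ominus>\<^bsub>M\<^esub> y) \<oplus>\<^bsub>M\<^esub> y" using xy by (simp add: M.minus_eq M.a_assoc M.l_neg)
      with h have "x \<in> H +>\<^bsub>M\<^esub> y" by (auto simp: a_r_coset_def')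
      then show "H +>\<^bsub>M\<^esub> x = H +>\<^bsub>M\<^esub> y" using M.a_repr_independence[OF _ xy(2) sub] by simp
    qed
  qed
  have plus: "(H +>\<^bsub>M\<^esub> x) <+>\<^bsub>M\<^esub> (H +>\<^bsub>M\<^esub> y) = H +>\<^bsub>M\<^esub> (x \<oplus>\<^bsub>M\<^esub> y)"
    if "submodule H R M" "x \<in> carrier M" "y \<in> carrier M" for H x y
    using abelian_subgroup.a_rcos_sum[OF sg[OF that(1)] that(2,3)] .
  have times: "H <+>\<^bsub>M\<^esub> ((\<lambda>x. r \<odot>\<^bsub>M\<^esub> x) ` (H +>\<^bsub>M\<^esub> x)) = H +>\<^bsub>M\<^esub> (r \<odot>\<^bsub>M\<^esub> x)"
    if H: "submodule H R M" and r: "r \<in> carrier R" and x: "x \<in> carrier M" for H r x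
  proof (intro equalityI subsetI)
    note E = M.submoduleE[OF H]
    have c: "h \<in> carrier M" if "h \<in> H" for h using that E(1) by blast
    fix y assume "y \<in> H <+>\<^bsub>M\<^esub> ((\<lambda>x. r \<odot>\<^bsub>M\<^esub> x) ` (H +>\<^bsub>M\<^esub> x))"
    then obtain a b where ab: "a \<in> H" "b \<in> H" "y = a \<oplus>\<^bsub>M\<^esub> r \<odot>\<^bsub>M\<^esub> (b \<oplus>\<^bsub>M\<^esub> x)"
      by (auto simp: set_add_def' a_r_coset_def')
    then have "y = (a \<oplus>\<^bsub>M\<^esub> r \<odot>\<^bsub>M\<^esub> b) \<oplus>\<^bsub>M\<^esub> r \<odot>\<^bsub>M\<^esub> x"
      using c r x by (simp add: M.smult_r_distr M.a_assoc)
    moreover have "a \<oplus>\<^bsub>M\<^esub> r \<odot>\<^bsub>M\<^esub> b \<in> H" using ab r E by blast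
    ultimately show "y \<in> H +>\<^bsub>M\<^esub> (r \<odot>\<^bsub>M\<^esub> x)" by (auto simp: a_r_coset_def')
  next
    fix y assume "y \<in> H +>\<^bsub>M\<^esub> (r \<odot>\<^bsub>M\<^esub> x)"
    then obtain a where a: "a \<in> H" "y = a \<oplus>\<^bsub>M\<^esub> r \<odot>\<^bsub>M\<^esub> x" by (auto simp: a_r_coset_def')
    moreover have "x \<in> H +>\<^bsub>M\<^esub> x" by (rule abelian_subgroup.a_rcos_self[OF sg[OF H] x])
    ultimately show "y \<in> H <+>\<^bsub>M\<^esub> ((\<lambda>x. r \<odot>\<^bsub>M\<^esub> x) ` (H +>\<^bsub>M\<^esub> x))"
      by (auto simp: set_add_def')
  qed
  \<comment> \<open>Adding \<open>B'\<close> enlarges a coset of \<open>B\<close> to one of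
    \<open>B'\<close>, so the map is defined without choosing representatives.\<close>
  define h where "h X = B' <+>\<^bsub>M\<^esub> X" for X
  have h: "h (B +>\<^bsub>M\<^esub> x) = B' +>\<^bsub>M\<^esub> x" if x: "x \<in> carrier M" for x
  proof (intro equalityI subsetI)
    note E' = M.submoduleE[OF B']
    have c: "b \<in> carrier M" if "b \<in> B'" for b using that E'(1) by blast
    fix y assume "y \<in> h (B +>\<^bsub>M\<^esub> x)"
    then obtain a b where ab: "a \<in> B'" "b \<in> B'" "y = a \<oplus>\<^bsub>M\<^esub> (b \<oplus>\<^bsub>M\<^esub> x)"
      using BB by (auto simp: h_def set_add_def' a_r_coset_def')
    then have "y = (a \<oplus>\<^bsub>M\<^esub> b) \<oplus>\<^bsub>M\<^esub> x" using c x by (simp add: M.a_assoc)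
    then show "y \<in> B' +>\<^bsub>M\<^esub> x" using E'(5)[OF ab(1,2)] by (auto simp: a_r_coset_def')
  next
    fix y assume "y \<in> B' +>\<^bsub>M\<^esub> x"
    then obtain a where a: "a \<in> B'" "y = a \<oplus>\<^bsub>M\<^esub> x" by (auto simp: a_r_coset_def')
    moreover have "x \<in> B +>\<^bsub>M\<^esub> x" by (rule abelian_subgroup.a_rcos_self[OF sg[OF B] x])
    ultimately show "y \<in> h (B +>\<^bsub>M\<^esub> x)" by (auto simp: h_def set_add_def')
  qed
  have ZM: "z \<in> carrier M" if "z \<in> Z" for z using that Z by blast
  let ?Q = "quotient_module M Z B" and ?Q' = "quotient_module M Z' B'"
  have Qc: "carrier ?Q = (\<lambda>z. B +>\<^bsub>M\<^esub> z) ` Z" "carrier ?Q' = (\<lambda>z. B' +>\<^bsub>M\<^esub> z) ` Z'"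
    by (simp_all add: quotient_module_def)
  have "bij_betw h (carrier ?Q) (carrier ?Q')"
    unfolding bij_betw_def
  proof
    show "inj_on h (carrier ?Q)"
    proof (rule inj_onI)
      fix X Y assume "X \<in> carrier ?Q" "Y \<in> carrier ?Q" and eq: "h X = h Y"
      then obtain z w where zw: "z \<in> Z" "w \<in> Z" and X: "X = B +>\<^bsub>M\<^esub> z" "Y = B +>\<^bsub>M\<^esub> w"
        unfolding Qc by blast
      have "B' +>\<^bsub>M\<^esub> z = B' +>\<^bsub>M\<^esub> w" using eq ZM zw by (simp add: X h)
      then show "X = Y" unfolding X using inj[OF zw] cos[OF B' ZM ZM, OF zw] cos[OF B ZM ZM, OF zw] by simp
    qed
    show "h ` carrier ?Q = carrier ?Q'"
    proof (intro equalityI subsetI)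
      fix X assume "X \<in> h ` carrier ?Q"
      then show "X \<in> carrier ?Q'" unfolding Qc using Z h ZM by auto
    next
      fix X assume "X \<in> carrier ?Q'"
      then obtain z' where z': "z' \<in> Z'" "X = B' +>\<^bsub>M\<^esub> z'" unfolding Qc by blast
      obtain z where z: "z \<in> Z" "z' \<ominus>\<^bsub>M\<^esub> z \<in> B'" using surj[OF z'(1)] by blast
      have "z' \<in> carrier M" using z' Z by blast
      then have "X = h (B +>\<^bsub>M\<^esub> z)" using cos[OF B' _ ZM[OF z(1)]] z z'(2) by (simp add: h ZM)
      then show "X \<in> h ` carrier ?Q" unfolding Qc using z(1) by blast
    qed
  qed
  moreover have "h (X \<oplus>\<^bsub>?Q\<^esub> Y) = h X \<oplus>\<^bsub>?Q'\<^esub> h Y" if XY: "X \<in> carrier ?Q" "Y \<in> carrier ?Q" for X Y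
  proof -
    obtain z w where zw: "z \<in> Z" "w \<in> Z" and X: "X = B +>\<^bsub>M\<^esub> z" "Y = B +>\<^bsub>M\<^esub> w"
      using XY unfolding Qc by blast
    show ?thesis using zw ZM by (simp add: quotient_module_def X h plus[OF B] plus[OF B'])
  qed
  moreover have "h (r \<odot>\<^bsub>?Q\<^esub> X) = r \<odot>\<^bsub>?Q'\<^esub> h X" if r: "r \<in> carrier R" and X: "X \<in> carrier ?Q" for r X
  proof -
    obtain z where z: "z \<in> Z" and X: "X = B +>\<^bsub>M\<^esub> z" using X unfolding Qc by blast
    show ?thesis using z ZM r by (simp add: quotient_module_def X h times[OF B] times[OF B'])
  qed
  ultimately have "h \<in> module_iso R ?Q ?Q'" by (simp add: module_iso_def)
  then show ?thesis using h ZM by blast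
qed

section \<open>The comparison of cohomologies\<close>

context algebra_diagram
begin

lemma coboundaries_submodule:
  assumes S: "submodule S R Tot"
  shows "submodule (coboundaries S m) R Tot"
proof (rule Tot_submoduleI)
  note E = module.submoduleE[OF Tot_module S]
  have c: "X \<in> carrier Tot" if "X \<in> S" for X using that E(1) by blast
  have z: "\<zero>\<^bsub>Tot\<^esub> \<in> S" using subgroup.one_closed[OF submodule.axioms(1)[OF S]] by simp
  show "coboundaries S m \<subseteq> carrier Tot"
    using c delta_Tot(2) by (auto simp: coboundaries_def)
  show "\<zero>\<^bsub>Tot\<^esub> \<in> coboundaries S m"
    unfolding coboundaries_def using z
    by (intro image_eqI[of _ _ "\<zero>\<^bsub>Tot\<^esub>"]) (simp_all add: zero_homogeneous additive_zero[OF Tot_group Tot_group delta_additive])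
  show "F \<oplus>\<^bsub>Tot\<^esub> G \<in> coboundaries S m" if FG: "F \<in> coboundaries S m" "G \<in> coboundaries S m" for F G
  proof -
    obtain X Y where X: "X \<in> S" "homogeneous (m - 1) X" "F = delta X" and Y: "Y \<in> S" "homogeneous (m - 1) Y" "G = delta Y"
      using FG by (auto simp: coboundaries_def)
    have "F \<oplus>\<^bsub>Tot\<^esub> G = delta (X \<oplus>\<^bsub>Tot\<^esub> Y)"
      using X Y c by (simp add: additive_add[OF delta_additive])
    then show ?thesis
      unfolding coboundaries_def using X Y E(5) add_homogeneous by blast
  qed
  show "r \<odot>\<^bsub>Tot\<^esub> F \<in> coboundaries S m" if r: "r \<in> carrier R" and F: "F \<in> coboundaries S m" for r F
  proof -
    obtain X where X: "X \<in> S" "homogeneous (m - 1) X" "F = delta X"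
      using F by (auto simp: coboundaries_def)
    then have "r \<odot>\<^bsub>Tot\<^esub> F = delta (r \<odot>\<^bsub>Tot\<^esub> X)" using r c by (simp add: delta_smult)
    then show ?thesis
      unfolding coboundaries_def using X r E(4) smult_homogeneous by blast
  qed
qed

text \<open>For surjectivity a cocycle is normalised. For injectivity it is a primitive
  \<open>Y\<close> of a reduced coboundary that is normalised, one degree lower: its differential is
  reduced though not zero, and subtracting a coboundary from \<open>Y\<close> does not change
  it.\<close>

lemma reduced_inclusion_iso:
  assumes S: "submodule S R Tot" "\<And>F. F \<in> S \<Longrightarrow> delta F \<in> S" "\<And>k F. F \<in> S \<Longrightarrow> homotopy k F \<in> S"
  shows "inclusion_induces_iso (reduced \<inter> S) S m"
proof -
  let ?S = "reduced \<inter> S"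
  note E = module.submoduleE[OF Tot_module S(1)]
  interpret T: abelian_group Tot by (rule Tot_group)
  have c: "X \<in> carrier Tot" if "X \<in> S" for X using that E(1) by blast
  have sub: "submodule ?S R Tot" by (rule submodule_Int[OF reduced_submodule S(1)])
  note E' = module.submoduleE[OF Tot_module sub]
  have "\<exists>h\<in>module_iso R (quotient_module Tot (cocycles ?S m) (coboundaries ?S m))
      (quotient_module Tot (cocycles S m) (coboundaries S m)).
      \<forall>z\<in>cocycles ?S m. h (coboundaries ?S m +>\<^bsub>Tot\<^esub> z) = coboundaries S m +>\<^bsub>Tot\<^esub> z"
  proof (rule quotient_iso[OF Tot_module])
    show "submodule (coboundaries ?S m) R Tot" "submodule (coboundaries S m) R Tot"
      by (intro coboundaries_submodule sub S)+
    show "coboundaries ?S m \<subseteq> coboundaries S m" by (auto simp: coboundaries_def)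
    show "cocycles ?S m \<subseteq> cocycles S m" by (auto simp: cocycles_def)
    show "cocycles S m \<subseteq> carrier Tot" using c by (auto simp: cocycles_def)
  next
    fix F assume "F \<in> cocycles S m"
    then have F: "F \<in> S" "homogeneous m F" "delta F = \<zero>\<^bsub>Tot\<^esub>" by (auto simp: cocycles_def)
    have "\<zero>\<^bsub>Tot\<^esub> \<in> reduced" using subgroup.one_closed[OF submodule.axioms(1)[OF reduced_submodule]] by simp
    then have "delta F \<in> reduced" using F(3) by simp
    then obtain X where X: "X \<in> S" "homogeneous (m - 1) X" "F \<ominus>\<^bsub>Tot\<^esub> delta X \<in> reduced"
      using normalisation[OF S F(1,2)] by blast
    let ?G = "F \<ominus>\<^bsub>Tot\<^esub> delta X"
    note cF = c[OF F(1)] and cX = c[OF X(1)] and cdX = delta_Tot(2)[OF c[OF X(1)]]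
    have "?G \<in> S" unfolding a_minus_def using F X S(2) by (intro E) auto
    moreover have "homogeneous m ?G"
      using minus_homogeneous[OF cF cdX F(2)] delta_homogeneous[OF cX X(2)] by simp
    moreover have "delta ?G = \<zero>\<^bsub>Tot\<^esub>"
      using additive_a_minus[OF Tot_group Tot_group delta_additive cF cdX] F(3)
      by (simp add: delta_delta[OF cX] T.minus_eq T.a_inv_zero)
    ultimately have "?G \<in> cocycles ?S m" using X(3) by (simp add: cocycles_def)
    moreover have "F \<ominus>\<^bsub>Tot\<^esub> ?G = delta X"
      using cF cdX by (simp add: T.minus_eq T.minus_add T.minus_minus T.r_neg1 T.r_neg2)
    then have "F \<ominus>\<^bsub>Tot\<^esub> ?G \<in> coboundaries S m" using X by (auto simp: coboundaries_def)
    ultimately show "\<exists>G\<in>cocycles ?S m. F \<ominus>\<^bsub>Tot\<^esub> G \<in> coboundaries S m" by blast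
  next
    fix F G assume FG: "F \<in> cocycles ?S m" "G \<in> cocycles ?S m" and b: "F \<ominus>\<^bsub>Tot\<^esub> G \<in> coboundaries S m"
    then obtain Y where Y: "Y \<in> S" "homogeneous (m - 1) Y" "F \<ominus>\<^bsub>Tot\<^esub> G = delta Y"
      by (auto simp: coboundaries_def)
    have "F \<ominus>\<^bsub>Tot\<^esub> G \<in> ?S" unfolding a_minus_def using FG by (intro E') (auto simp: cocycles_def)
    then have "delta Y \<in> reduced" using Y(3) by simp
    then obtain X where X: "X \<in> S" "homogeneous (m - 1 - 1) X" "Y \<ominus>\<^bsub>Tot\<^esub> delta X \<in> reduced"
      using normalisation[OF S Y(1,2)] by blast
    let ?G = "Y \<ominus>\<^bsub>Tot\<^esub> delta X"
    note cY = c[OF Y(1)] and cX = c[OF X(1)] and cdX = delta_Tot(2)[OF c[OF X(1)]]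
    have "?G \<in> S" unfolding a_minus_def using Y X S(2) by (intro E) auto
    moreover have "homogeneous (m - 1) ?G"
      using minus_homogeneous[OF cY cdX Y(2)] delta_homogeneous[OF cX X(2)] by simp
    moreover have "delta ?G = delta Y"
      using additive_a_minus[OF Tot_group Tot_group delta_additive cY cdX] delta_Tot(2)[OF cY]
      by (simp add: delta_delta[OF cX] T.minus_eq T.a_inv_zero)
    ultimately show "F \<ominus>\<^bsub>Tot\<^esub> G \<in> coboundaries ?S m"
      unfolding coboundaries_def Y(3) using X(3) by (intro image_eqI[of _ _ ?G]) auto
  qed
  then show ?thesis
    unfolding inclusion_induces_iso_def cohomology_def cohomology_class_def by blast
qed

end

theorem theorem5p8:
  fixes C :: "('o, 'm, 'c) category_scheme"
    and R :: "('k, 'r) ring_scheme"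
    and A :: "'o \<Rightarrow> ('k, 'a, 'e) module_scheme"
    and Am :: "'m \<Rightarrow> 'a \<Rightarrow> 'a"
  assumes "algebra_diagram C R A Am"
  shows "algebra_diagram.mQuilt_subalgebra C R A Am (algebra_diagram.asimplicial C R A) \<and>
    algebra_diagram.mQuilt_subalgebra C R A Am (algebra_diagram.reduced C R A) \<and>
    algebra_diagram.mQuilt_subalgebra C R A Am
      (algebra_diagram.reduced C R A \<inter> algebra_diagram.asimplicial C R A) \<and>
    (\<forall>m. algebra_diagram.inclusion_induces_iso C R A Am
      (algebra_diagram.reduced C R A) (carrier (algebra_diagram.Tot C R A)) m) \<and>
    (\<forall>m. algebra_diagram.inclusion_induces_iso C R A Am
      (algebra_diagram.reduced C R A \<inter> algebra_diagram.asimplicial C R A)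
      (algebra_diagram.asimplicial C R A) m)"
proof -
  interpret algebra_diagram C R A Am by fact
  \<comment> \<open>The full complex is itself an admissible choice of the submodule, since it is
    closed under \<open>delta\<close> and under all homotopies.\<close>
  have "inclusion_induces_iso (reduced \<inter> carrier Tot) (carrier Tot) m" for m
    by (intro reduced_inclusion_iso module.carrier_is_submodule[OF Tot_module] delta_Tot homotopy_closed)
  moreover have "reduced \<inter> carrier Tot = reduced" by (auto simp: reduced_def)
  moreover have "inclusion_induces_iso (reduced \<inter> asimplicial) asimplicial m" for m
    by (intro reduced_inclusion_iso asimplicial_submodule delta_asimplicial homotopy_asimplicial)
  ultimately show ?thesis
    using mQuilt_asimplicial mQuilt_reduced mQuilt_Int by simp
qed

end
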